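(* Let $f_\oplus$ be a probability density on $\mathbb{R}$ with finite second moment, support $D_\oplus$ an interval, and Wasserstein tangent space $\mathcal{T}_{f_\oplus}$, with norm $\|\cdot\|$ of $L^2(\mathbb{R},f_\oplus(u)du)$. Let $\beta_1,\dots,\beta_p\in\mathbb{R}$ and let $\{\epsilon_t\}_{t\in\mathbb{Z}}$ be random elements of $\mathcal{T}_{f_\oplus}$ with covariance kernel $C_\epsilon(u,v)=\operatorname{Cov}(\epsilon_t(u),\epsilon_t(v))$. Assume (A1') the polynomial $\phi(z)=1-\beta_1z-\dots-\beta_pz^p$ has no root in $\{z\in\mathbb{C}:|z|\le1\}$, and write $1/\phi(z)=\sum_{i=0}^\infty\psi_iz^i$ (so $\sum_i|\psi_i|<\infty$); (A2) the $\epsilon_t$ are i.i.d. elements of $\mathcal{T}_{f_\oplus}$, $\mathbb{E}[\epsilon_t(u)]=0$ for all $u\in D_\oplus$, and $\int_{\mathbb{R}}C_\epsilon(u,u)f_\oplus(u)\,du<\infty$. Consider the WAR($p$) equation $V_t=\sum_{j=1}^p\beta_jV_{t-j}+\epsilon_t$, $t\in\mathbb{Z}$, for random elements $V_t\in\mathcal{T}_{f_\oplus}$. Then: (i) $V_t=\sum_{i=0}^\infty\psi_i\epsilon_{t-i}$ is a strictly stationary solution in $\mathcal{T}_{f_\oplus}$ of this equation, and the series converges almost surely and in mean square: $\lim_{n\to\infty}\|V_t-\sum_{i=0}^n\psi_i\epsilon_{t-i}\|=0$ a.s. and $\lim_{n\to\infty}\mathbb{E}\|V_t-\sum_{i=0}^n\psi_i\epsilon_{t-i}\|^2=0$.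 (ii) There is no other solution in $\mathcal{T}_{f_\oplus}$ that is stationary in the Hilbert-space sense defined in the context. (iii) If in addition (A3) holds, namely almost surely $V_t$ is differentiable and $V_t'(u)>-1$ for all $u\in D_\oplus$, then $T_t:=V_t+\mathrm{id}$ is strictly increasing almost surely, and the measures $\operatorname{Exp}_{f_\oplus}(V_t)$ possess densities $f_t$ that form a strictly stationary sequence with common Wasserstein mean $f_\oplus$.
   Context: $\mathcal{W}_2$: Borel probability measures on $\mathbb{R}$ with finite second moment; $\mathcal{D}$: those with a Lebesgue density. For $f,g\in\mathcal{D}$ with quantile functions $F^{-1},G^{-1}$, $d_W(f,g)=\{\int_0^1(G^{-1}(s)-F^{-1}(s))^2ds\}^{1/2}$. For $\mu\in\mathcal{W}_2$ the tangent space $\mathcal{T}_\mu$ is the closure in $L^2(\mathbb{R},d\mu)$ of $\{\lambda(T-\mathrm{id}):T$ the optimal transport map from $\mu$ to some $\nu\in\mathcal{W}_2,\lambda>0\}$ ($\mathcal{T}_f$ when $\mu$ has density $f$); it is a separable Hilbert space. $\operatorname{Exp}_f(V)=(V+\mathrm{id})_\#\mu_f$ (pushforward of the measure with density $f$). The Wasserstein mean of a random density $f$ is $\arg\min_{g\in\mathcal{D}}\mathbb{E}d_W^2(f,g)$. A sequence $\{X_t\}$ in a separable Hilbert space $H$ is stationary (Hilbert-space sense) if $\mathbb{E}\|X_t\|^2<\infty$, $\mathbb{E}X_t$ does not depend on $t$, and the operators $x\mapsto\mathbb{E}[\langle X_t-\mu,x\rangle(X_{t+h}-\mu)]$ ($\mu=\mathbb{E}X_0$)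 do not depend on $t$. Strictly stationary: all finite-dimensional joint laws are shift invariant. *)

theory Defs
  imports "HOL-Probability.Probability"
begin

definition W2_density :: "(real \<Rightarrow> real) \<Rightarrow> bool" where
  "W2_density g \<longleftrightarrow> g \<in> borel_measurable borel \<and> (\<forall>x. 0 \<le> g x)
     \<and> (\<integral>\<^sup>+ x. ennreal (g x) \<partial>lborel) = 1
     \<and> (\<integral>\<^sup>+ x. ennreal (x\<^sup>2 * g x) \<partial>lborel) < \<infinity>"

definition density_support :: "(real \<Rightarrow> real) \<Rightarrow> real set" where
  "density_support g = {x. \<forall>e>0. emeasure (density lborel g) (ball x e) > 0}"

definition W2_measure :: "real measure \<Rightarrow> bool" where
  "W2_measure \<nu> \<longleftrightarrow> prob_space \<nu> \<and> sets \<nu> = sets borel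
     \<and> (\<integral>\<^sup>+ x. ennreal (x\<^sup>2) \<partial>\<nu>) < \<infinity>"

definition coupling :: "real measure \<Rightarrow> real measure \<Rightarrow> (real \<times> real) measure \<Rightarrow> bool" where
  "coupling \<mu> \<nu> \<pi> \<longleftrightarrow> prob_space \<pi> \<and> sets \<pi> = sets (borel \<Otimes>\<^sub>M borel)
     \<and> distr \<pi> borel fst = \<mu> \<and> distr \<pi> borel snd = \<nu>"

definition ot_map :: "real measure \<Rightarrow> real measure \<Rightarrow> (real \<Rightarrow> real) \<Rightarrow> bool" where
  "ot_map \<mu> \<nu> T \<longleftrightarrow> T \<in> borel_measurable borel \<and> distr \<mu> borel T = \<nu>
     \<and> (\<forall>\<pi>. coupling \<mu> \<nu> \<pi> \<longrightarrow>
           (\<integral>\<^sup>+ x. ennreal ((T x - x)\<^sup>2) \<partial>\<mu>) \<le> (\<integral>\<^sup>+ z. ennreal ((fst z - snd z)\<^sup>2) \<partial>\<pi>))"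

definition L2sq :: "(real \<Rightarrow> real) \<Rightarrow> (real \<Rightarrow> real) \<Rightarrow> ennreal" where
  "L2sq f x = (\<integral>\<^sup>+ u. ennreal ((x u)\<^sup>2 * f u) \<partial>lborel)"

definition L2 :: "(real \<Rightarrow> real) \<Rightarrow> (real \<Rightarrow> real) set" where
  "L2 f = {x. x \<in> borel_measurable borel \<and> L2sq f x < \<infinity>}"

definition L2inner :: "(real \<Rightarrow> real) \<Rightarrow> (real \<Rightarrow> real) \<Rightarrow> (real \<Rightarrow> real) \<Rightarrow> real" where
  "L2inner f x y = (\<integral> u. x u * y u * f u \<partial>lborel)"

text \<open>Borel sigma-algebra of the separable Hilbert space L2(f): generated by the
  continuous linear functionals.\<close>
definition L2M :: "(real \<Rightarrow> real) \<Rightarrow> (real \<Rightarrow> real) measure" where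
  "L2M f = sigma (L2 f) {(\<lambda>x. L2inner f x h) -` B \<inter> L2 f | h B. h \<in> L2 f \<and> B \<in> sets borel}"

definition tangent_space :: "(real \<Rightarrow> real) \<Rightarrow> (real \<Rightarrow> real) set" where
  "tangent_space f = {V \<in> L2 f. \<forall>e::real>0. \<exists>c>0. \<exists>T \<nu>. W2_measure \<nu>
      \<and> ot_map (density lborel f) \<nu> T
      \<and> L2sq f (\<lambda>u. V u - c * (T u - u)) < ennreal e}"

definition Exp_map :: "(real \<Rightarrow> real) \<Rightarrow> (real \<Rightarrow> real) \<Rightarrow> real measure" where
  "Exp_map f V = distr (density lborel f) borel (\<lambda>u. V u + u)"

definition cdf_of :: "(real \<Rightarrow> real) \<Rightarrow> real \<Rightarrow> real" where
  "cdf_of g x = measure (density lborel g) {..x}"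

definition quantile_of :: "(real \<Rightarrow> real) \<Rightarrow> real \<Rightarrow> real" where
  "quantile_of g s = Inf {x. s \<le> cdf_of g x}"

definition dW2 :: "(real \<Rightarrow> real) \<Rightarrow> (real \<Rightarrow> real) \<Rightarrow> ennreal" where
  "dW2 f g = (\<integral>\<^sup>+ s\<in>{0<..<1}. ennreal ((quantile_of g s - quantile_of f s)\<^sup>2) \<partial>lborel)"

definition is_wasserstein_mean :: "'a measure \<Rightarrow> ('a \<Rightarrow> real \<Rightarrow> real) \<Rightarrow> (real \<Rightarrow> real) \<Rightarrow> bool" where
  "is_wasserstein_mean M F f0 \<longleftrightarrow> W2_density f0
     \<and> (\<forall>g. W2_density g \<longrightarrow> (\<integral>\<^sup>+ \<omega>. dW2 (F \<omega>) f0 \<partial>M) \<le> (\<integral>\<^sup>+ \<omega>. dW2 (F \<omega>) g \<partial>M))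
     \<and> (\<forall>g. W2_density g \<longrightarrow> (\<integral>\<^sup>+ \<omega>. dW2 (F \<omega>) g \<partial>M) = (\<integral>\<^sup>+ \<omega>. dW2 (F \<omega>) f0 \<partial>M)
            \<longrightarrow> dW2 g f0 = 0)"

definition random_tangent :: "'a measure \<Rightarrow> (real \<Rightarrow> real) \<Rightarrow> ('a \<Rightarrow> real \<Rightarrow> real) \<Rightarrow> bool" where
  "random_tangent M f X \<longleftrightarrow> X \<in> measurable M (L2M f) \<and> (\<forall>\<omega>\<in>space M. X \<omega> \<in> tangent_space f)"

definition strictly_stationary :: "'a measure \<Rightarrow> 'b measure \<Rightarrow> (int \<Rightarrow> 'a \<Rightarrow> 'b) \<Rightarrow> bool" where
  "strictly_stationary M N X \<longleftrightarrow> (\<forall>J h. finite J \<longrightarrow>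
     distr M (PiM J (\<lambda>_. N)) (\<lambda>\<omega>. \<lambda>j\<in>J. X (j + h) \<omega>)
       = distr M (PiM J (\<lambda>_. N)) (\<lambda>\<omega>. \<lambda>j\<in>J. X j \<omega>))"

text \<open>Stationarity in the Hilbert-space sense in L2(f): finite second moments, constant
  mean, lag-h cross-covariance operators not depending on t (compared through all
  their matrix entries).\<close>
definition hilbert_stationary :: "'a measure \<Rightarrow> (real \<Rightarrow> real) \<Rightarrow> (int \<Rightarrow> 'a \<Rightarrow> real \<Rightarrow> real) \<Rightarrow> bool" where
  "hilbert_stationary M f X \<longleftrightarrow>
     (\<forall>t. (\<integral>\<^sup>+ \<omega>. L2sq f (X t \<omega>) \<partial>M) < \<infinity>) \<and>
     (\<exists>m\<in>L2 f.
        (\<forall>t h. h \<in> L2 f \<longrightarrow> (\<integral> \<omega>. L2inner f (X t \<omega>) h \<partial>M) = L2inner f m h) \<and>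
        (\<forall>x\<in>L2 f. \<forall>y\<in>L2 f. \<forall>s t k.
           (\<integral> \<omega>. L2inner f (\<lambda>u. X s \<omega> u - m u) x * L2inner f (\<lambda>u. X (s + k) \<omega> u - m u) y \<partial>M)
         = (\<integral> \<omega>. L2inner f (\<lambda>u. X t \<omega> u - m u) x * L2inner f (\<lambda>u. X (t + k) \<omega> u - m u) y \<partial>M)))"

definition ar_poly :: "nat \<Rightarrow> (nat \<Rightarrow> real) \<Rightarrow> complex \<Rightarrow> complex" where
  "ar_poly p \<beta> z = 1 - (\<Sum>j=1..p. complex_of_real (\<beta> j) * z ^ j)"

definition WAR_solution :: "'a measure \<Rightarrow> (real \<Rightarrow> real) \<Rightarrow> nat \<Rightarrow> (nat \<Rightarrow> real)
     \<Rightarrow> (int \<Rightarrow> 'a \<Rightarrow> real \<Rightarrow> real) \<Rightarrow> (int \<Rightarrow> 'a \<Rightarrow> real \<Rightarrow> real) \<Rightarrow> bool" where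
  "WAR_solution M f p \<beta> \<epsilon> V \<longleftrightarrow> (\<forall>t. random_tangent M f (V t)) \<and>
     (\<forall>t. AE \<omega> in M. L2sq f (\<lambda>u. V t \<omega> u - (\<Sum>j=1..p. \<beta> j * V (t - int j) \<omega> u) - \<epsilon> t \<omega> u) = 0)"

definition lin_partial :: "(nat \<Rightarrow> real) \<Rightarrow> (int \<Rightarrow> 'a \<Rightarrow> real \<Rightarrow> real) \<Rightarrow> int \<Rightarrow> nat \<Rightarrow> 'a \<Rightarrow> real \<Rightarrow> real" where
  "lin_partial \<psi> \<epsilon> t n \<omega> u = (\<Sum>i\<le>n. \<psi> i * \<epsilon> (t - int i) \<omega> u)"

end

theory Submission
  imports Defs "HOL-Complex_Analysis.Complex_Analysis"
begin

text \<open>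
  On the line an increasing map is optimal, so every bounded Lipschitz function is a multiple of
  \<open>T - id\<close> with \<open>T\<close> optimal; such functions are dense, hence the tangent space is all of \<open>L\<^sup>2(f)\<close>.
  Since \<open>1/\<phi>\<close> is holomorphic on a disc of radius larger than one, \<open>\<psi>\<close> is absolutely summable, and
  Cauchy-Schwarz with weights \<open>\<bar>\<psi> i\<bar>\<close> bounds the tails of the series by the random variable
  \<open>\<Sum>i. \<bar>\<psi> i\<bar> \<parallel>\<epsilon> (t - i)\<parallel>\<^sup>2\<close>, which has finite expectation. The recursion for \<open>\<psi>\<close> turns partial sums into
  approximate solutions, and conversely expresses the difference between a stationary solution and
  a partial sum by the last \<open>p\<close> coefficients, which tend to zero.
  Under (A3) the quantile function of the transported density is \<open>T\<close> applied to the quantile function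
  of \<open>f\<close>, so the expected squared distance to \<open>g\<close> is \<open>\<parallel>h\<parallel>\<^sup>2 + E\<parallel>V t\<parallel>\<^sup>2\<close>, where \<open>h\<close> is the optimal
  displacement from \<open>f\<close> to \<open>g\<close>; the cross term vanishes because \<open>V t\<close> is centred.
\<close>

section \<open>The space \<open>L\<^sup>2(f)\<close>\<close>

text \<open>The sigma-algebra \<open>L2M f\<close> sees a random element only through its inner
  products, and the elements are functions rather than classes, so a single value
  \<open>V t \<omega> u\<close> need not be a random variable. Probabilistic steps therefore work
  with the functionals \<open>L2inner f _ h\<close>. One countable dense family,
  \<open>ramps\<close>, makes this sufficient: norms become countable suprema of such functionals,
  and "for each h, almost surely" turns into "almost surely, for all h". The pointwise assumptions
  on the noise are converted into statements about functionals once, by Fubini. Uniqueness is also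
  argued for coordinates, because stationarity in the Hilbert-space sense controls matrix entries: a
  bound in mean for each coordinate, uniform in time, is enough. (A3) gives no positive lower bound
  for the derivative of \<open>T\<close>, so the inverse of \<open>T\<close> need not be Lipschitz.
  A difference bound centred at each single point still makes null sets pull back to null sets,
  which is where the transported densities come from.\<close>

lemma abs_mult_le_sum_squares: "\<bar>a * b\<bar> \<le> a\<^sup>2 + b\<^sup>2" for a b :: real
  using sum_squares_bound[of a b] sum_squares_bound[of a "- b"] zero_le_power2[of a] zero_le_power2[of b]
  by (simp add: abs_le_iff)

locale w2_space =
  fixes f :: "real \<Rightarrow> real"
  assumes W2: "W2_density f"
begin

abbreviation \<mu> :: "real measure" where
  "\<mu> \<equiv> density lborel f"

text \<open>Only a seminorm: elements of \<open>L2 f\<close> are functions, so norm zero means zero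
  up to a null set of the measure with density \<open>f\<close>. For a measurable function that is
  not square integrable the Bochner integral defaults to 0, hence the membership premises
  throughout.\<close>

definition L2norm :: "(real \<Rightarrow> real) \<Rightarrow> real" where
  "L2norm x = sqrt (L2inner f x x)"

lemma f_measurable [measurable]: "f \<in> borel_measurable borel"
  using W2 by (simp add: W2_density_def)

lemma f_nonneg [simp]: "0 \<le> f x"
  using W2 by (simp add: W2_density_def)

lemma prob_space_\<mu>: "prob_space \<mu>"
  using W2 by (intro prob_spaceI) (simp add: emeasure_density W2_density_def)

sublocale \<mu>: prob_space \<mu>
  by (rule prob_space_\<mu>)

lemma real_distribution_\<mu>: "real_distribution \<mu>"
  by unfold_locales auto

lemma L2_measurable: "x \<in> L2 f \<Longrightarrow> x \<in> borel_measurable borel"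
  by (simp add: L2_def)

lemma L2sq_eq_nn_integral:
  "x \<in> borel_measurable borel \<Longrightarrow> L2sq f x = (\<integral>\<^sup>+ u. ennreal ((x u)\<^sup>2) \<partial>\<mu>)"
  by (simp add: L2sq_def nn_integral_density ennreal_mult' mult.commute)

lemma L2_iff: "x \<in> L2 f \<longleftrightarrow> x \<in> borel_measurable borel \<and> integrable \<mu> (\<lambda>u. (x u)\<^sup>2)"
proof (cases "x \<in> borel_measurable borel")
  case True
  then have "integrable \<mu> (\<lambda>u. (x u)\<^sup>2) \<longleftrightarrow> (\<integral>\<^sup>+ u. ennreal ((x u)\<^sup>2) \<partial>\<mu>) < \<infinity>"
    by (subst integrable_iff_bounded) simp
  with True show ?thesis by (simp add: L2_def L2sq_eq_nn_integral)
qed (simp add: L2_def)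

lemma L2inner_eq:
  "x \<in> borel_measurable borel \<Longrightarrow> y \<in> borel_measurable borel \<Longrightarrow> L2inner f x y = (\<integral>u. x u * y u \<partial>\<mu>)"
  by (simp add: L2inner_def integral_real_density mult.commute mult.left_commute)

lemma L2inner_commute: "L2inner f x y = L2inner f y x"
  by (simp add: L2inner_def mult.commute)

lemma integrable_mult_L2:
  assumes "x \<in> L2 f" "y \<in> L2 f"
  shows "integrable \<mu> (\<lambda>u. x u * y u)"
proof (rule Bochner_Integration.integrable_bound)
  show "integrable \<mu> (\<lambda>u. (x u)\<^sup>2 + (y u)\<^sup>2)"
    using assms by (auto simp: L2_iff)
  show "(\<lambda>u. x u * y u) \<in> borel_measurable \<mu>"
    using assms[THEN L2_measurable] by simp
  show "AE u in \<mu>. norm (x u * y u) \<le> norm ((x u)\<^sup>2 + (y u)\<^sup>2)"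
    using abs_mult_le_sum_squares by simp
qed

lemma L2sq_eq: "x \<in> L2 f \<Longrightarrow> L2sq f x = ennreal (L2inner f x x)"
  by (simp add: L2sq_eq_nn_integral L2_iff L2inner_eq nn_integral_eq_integral power2_eq_square)

lemma L2inner_nonneg: "0 \<le> L2inner f x x"
  by (simp add: L2inner_def)

lemma L2norm_nonneg [simp]: "0 \<le> L2norm x"
  by (simp add: L2norm_def L2inner_nonneg)

lemma L2norm_square: "(L2norm x)\<^sup>2 = L2inner f x x"
  by (simp add: L2norm_def L2inner_nonneg)

lemma L2sq_norm: "x \<in> L2 f \<Longrightarrow> L2sq f x = ennreal ((L2norm x)\<^sup>2)"
  by (simp add: L2sq_eq L2norm_square)

lemma L2_zero [simp]: "(\<lambda>u. 0) \<in> L2 f"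
  by (simp add: L2_iff)

lemma L2_cmult [simp]: "x \<in> L2 f \<Longrightarrow> (\<lambda>u. c * x u) \<in> L2 f"
  using borel_measurable_times[OF borel_measurable_const[of c borel], of x]
  by (simp add: L2_iff power_mult_distrib)

lemma L2_add [simp]:
  assumes "x \<in> L2 f" "y \<in> L2 f" shows "(\<lambda>u. x u + y u) \<in> L2 f"
proof -
  have "integrable \<mu> (\<lambda>u. (x u)\<^sup>2 + (y u)\<^sup>2 + 2 * (x u * y u))"
    using assms integrable_mult_L2[OF assms] by (auto simp: L2_iff)
  then show ?thesis
    using assms[THEN L2_measurable] by (simp add: L2_iff power2_sum mult.assoc)
qed

lemma L2_diff [simp]:
  assumes "x \<in> L2 f" "y \<in> L2 f" shows "(\<lambda>u. x u - y u) \<in> L2 f"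
  using L2_add[OF assms(1) L2_cmult[OF assms(2), of "-1"]] by simp

lemma L2_sum [simp]:
  assumes "\<And>i. i \<in> I \<Longrightarrow> x i \<in> L2 f" shows "(\<lambda>u. \<Sum>i\<in>I. x i u) \<in> L2 f"
  using assms by (induction I rule: infinite_finite_induct) auto

lemma L2_bounded:
  assumes "x \<in> borel_measurable borel" "\<And>u. \<bar>x u\<bar> \<le> B"
  shows "x \<in> L2 f"
proof -
  have "(x u)\<^sup>2 \<le> B\<^sup>2" for u
    using assms(2)[of u] by (metis abs_ge_zero power2_abs power_mono)
  then have "integrable \<mu> (\<lambda>u. (x u)\<^sup>2)"
    using assms(1) by (intro \<mu>.integrable_const_bound[where B = "B\<^sup>2"]) auto
  then show ?thesis using assms(1) by (simp add: L2_iff)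
qed

lemma L2_id: "(\<lambda>u. u) \<in> L2 f"
  using W2 by (simp add: L2_def L2sq_def W2_density_def)

lemma L2inner_add_left:
  assumes "x \<in> L2 f" "y \<in> L2 f" "z \<in> L2 f"
  shows "L2inner f (\<lambda>u. x u + y u) z = L2inner f x z + L2inner f y z"
  using assms integrable_mult_L2[of _ z]
  by (simp add: L2inner_eq L2_measurable distrib_right)

lemma L2inner_cmult_left:
  assumes "x \<in> L2 f" "z \<in> L2 f"
  shows "L2inner f (\<lambda>u. c * x u) z = c * L2inner f x z"
  using assms by (simp add: L2inner_eq L2_measurable mult.assoc)

lemma L2inner_diff_left:
  assumes "x \<in> L2 f" "y \<in> L2 f" "z \<in> L2 f"
  shows "L2inner f (\<lambda>u. x u - y u) z = L2inner f x z - L2inner f y z"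
  using assms integrable_mult_L2[of _ z]
  by (simp add: L2inner_eq L2_measurable left_diff_distrib)

lemma L2inner_sum_left:
  assumes "\<And>i. i \<in> I \<Longrightarrow> x i \<in> L2 f" "z \<in> L2 f"
  shows "L2inner f (\<lambda>u. \<Sum>i\<in>I. x i u) z = (\<Sum>i\<in>I. L2inner f (x i) z)"
  using assms(1)
proof (induction I rule: infinite_finite_induct)
  case (insert i I)
  then show ?case using assms(2) by (simp add: L2inner_add_left)
qed (auto simp: L2inner_def)

lemma L2norm_cmult: "x \<in> L2 f \<Longrightarrow> L2norm (\<lambda>u. c * x u) = \<bar>c\<bar> * L2norm x"
  using L2inner_commute[of x "\<lambda>u. c * x u"]
  by (simp add: L2norm_def L2inner_cmult_left real_sqrt_mult mult.assoc[symmetric])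

lemma L2norm_diff_square:
  assumes "x \<in> L2 f" "y \<in> L2 f"
  shows "(L2norm (\<lambda>u. x u - y u))\<^sup>2 = (L2norm x)\<^sup>2 - 2 * L2inner f x y + (L2norm y)\<^sup>2"
proof -
  have *: "L2inner f z (\<lambda>u. x u - y u) = L2inner f x z - L2inner f y z" if "z \<in> L2 f" for z
    using that assms by (subst L2inner_commute) (simp add: L2inner_diff_left)
  show ?thesis
    using assms L2inner_commute[of y x] by (simp add: L2norm_square L2inner_diff_left *)
qed

lemma L2_cauchy_schwarz:
  assumes x: "x \<in> L2 f" and y: "y \<in> L2 f"
  shows "\<bar>L2inner f x y\<bar> \<le> L2norm x * L2norm y"
proof -
  let ?p = "L2inner f x y" and ?a = "(L2norm x)\<^sup>2" and ?b = "(L2norm y)\<^sup>2"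
  have q: "0 \<le> s\<^sup>2 * ?a - 2 * s * t * ?p + t\<^sup>2 * ?b" for s t
  proof -
    have "0 \<le> (L2norm (\<lambda>u. s * x u - t * y u))\<^sup>2" by simp
    also have "\<dots> = s\<^sup>2 * ?a - 2 * s * t * ?p + t\<^sup>2 * ?b"
      using x y L2inner_commute[of x "\<lambda>u. t * y u"] L2inner_commute[of y x]
      by (simp add: L2norm_diff_square L2norm_cmult power_mult_distrib L2inner_cmult_left)
    finally show ?thesis .
  qed
  have "?p\<^sup>2 \<le> ?a * ?b"
  proof (cases "?b = 0")
    case True
    have "?p = 0"
    proof (rule ccontr)
      assume "?p \<noteq> 0"
      \<comment> \<open>With \<open>s = 1\<close> and this value as \<open>t\<close> the nonnegative
        form would equal -1, since its last term vanishes.\<close>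
      then have "2 * ((?a + 1) / (2 * ?p)) * ?p = ?a + 1" by (simp add: field_simps)
      with q[of 1 "(?a + 1) / (2 * ?p)"] True show False by simp
    qed
    then show ?thesis by simp
  next
    case False
    then have "0 < ?b" by simp
    \<comment> \<open>At \<open>s = ?b\<close> the quadratic form is smallest for
      \<open>t = ?p\<close>.\<close>
    have "0 \<le> ?b * (?a * ?b - ?p\<^sup>2)"
      using q[of ?b ?p] by (simp add: algebra_simps power2_eq_square)
    then show ?thesis using \<open>0 < ?b\<close> by (simp add: zero_le_mult_iff)
  qed
  then have "?p\<^sup>2 \<le> (L2norm x * L2norm y)\<^sup>2" by (simp add: power_mult_distrib)
  then show ?thesis by (simp add: abs_le_square_iff[symmetric])
qed

lemma L2norm_diff_triangle:
  assumes x: "x \<in> L2 f" and y: "y \<in> L2 f" and z: "z \<in> L2 f"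
  shows "L2norm (\<lambda>u. x u - z u) \<le> L2norm (\<lambda>u. x u - y u) + L2norm (\<lambda>u. y u - z u)"
proof -
  let ?a = "\<lambda>u. x u - y u" and ?b = "\<lambda>u. z u - y u"
  have ab: "?a \<in> L2 f" "?b \<in> L2 f" using assms by auto
  have n: "L2norm ?b = L2norm (\<lambda>u. y u - z u)"
    using L2norm_cmult[OF ab(2), of "-1"] by simp
  have "(L2norm (\<lambda>u. x u - z u))\<^sup>2 = (L2norm (\<lambda>u. ?a u - ?b u))\<^sup>2" by simp
  also have "\<dots> \<le> (L2norm ?a + L2norm ?b)\<^sup>2"
    using L2_cauchy_schwarz[OF ab] L2norm_diff_square[OF ab]
    by (simp add: power2_sum abs_le_iff)
  finally show ?thesis
    unfolding n by (rule power2_le_imp_le) simp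
qed

lemma L2norm_minus_commute:
  assumes "x \<in> L2 f" "y \<in> L2 f"
  shows "L2norm (\<lambda>u. x u - y u) = L2norm (\<lambda>u. y u - x u)"
  using L2norm_cmult[of "\<lambda>u. x u - y u" "-1"] assms by simp

text \<open>Cauchy-Schwarz against the constant 1, whose norm is 1 because \<open>\<mu>\<close> is a
  probability measure.\<close>

lemma integral_le_L2norm:
  assumes "x \<in> L2 f"
  shows "integrable \<mu> x" "(\<integral>u. \<bar>x u\<bar> \<partial>\<mu>) \<le> L2norm x"
proof -
  have 1: "(\<lambda>u. 1) \<in> L2 f" by (rule L2_bounded[where B = 1]) auto
  show "integrable \<mu> x"
    using integrable_mult_L2[OF assms 1] by simp
  have a: "(\<lambda>u. \<bar>x u\<bar>) \<in> L2 f" using assms L2_measurable[OF assms] by (simp add: L2_iff)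
  have "L2norm (\<lambda>u. 1) = 1"
    using \<mu>.prob_space by (simp add: L2norm_def L2inner_eq)
  moreover have "L2norm (\<lambda>u. \<bar>x u\<bar>) = L2norm x"
    using assms a by (simp add: L2norm_def L2inner_eq L2_measurable)
  moreover have "L2inner f (\<lambda>u. \<bar>x u\<bar>) (\<lambda>u. 1) = (\<integral>u. \<bar>x u\<bar> \<partial>\<mu>)"
    using a by (simp add: L2inner_eq L2_measurable)
  ultimately show "(\<integral>u. \<bar>x u\<bar> \<partial>\<mu>) \<le> L2norm x"
    using L2_cauchy_schwarz[OF a 1] by simp
qed

end

section \<open>Density of piecewise linear functions\<close>

text \<open>A continuous substitute for the indicator of \<open>{..q}\<close>: it is 1 up to
  \<open>q\<close> and falls with slope \<open>n\<close> to reach 0 at \<open>q + 1/n\<close>. For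
  \<open>n = 0\<close> it is constantly 1.\<close>

definition ramp :: "real \<Rightarrow> nat \<Rightarrow> real \<Rightarrow> real" where
  "ramp q n u = max 0 (min 1 (1 + real n * (q - u)))"

text \<open>Coefficients and breakpoints are rational and slopes natural, so that the index type is
  countable and \<open>cs\<close> may range inside an almost sure statement or a measurable
  supremum.\<close>

definition ramps :: "(rat \<times> rat \<times> nat) list \<Rightarrow> real \<Rightarrow> real" where
  "ramps cs u = (\<Sum>(c, q, n)\<leftarrow>cs. of_rat c * ramp (of_rat q) n u)"

lemma ramps_simps [simp]:
  "ramps [] u = 0"
  "ramps ((c, q, n) # cs) u = of_rat c * ramp (of_rat q) n u + ramps cs u"
  "ramps (cs @ ds) u = ramps cs u + ramps ds u"
  by (simp_all add: ramps_def)

lemma ramp_measurable [measurable]: "ramp q n \<in> borel_measurable borel"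
  unfolding ramp_def[abs_def] by measurable

lemma ramp_bounds: "0 \<le> ramp q n u" "ramp q n u \<le> 1"
  by (auto simp: ramp_def)

lemma ramp_lipschitz: "\<bar>ramp q n u - ramp q n v\<bar> \<le> real n * \<bar>u - v\<bar>"
proof -
  have "\<bar>ramp q n u - ramp q n v\<bar> \<le> \<bar>(1 + real n * (q - u)) - (1 + real n * (q - v))\<bar>"
    unfolding ramp_def by linarith
  also have "\<dots> = \<bar>real n * (v - u)\<bar>" by (simp add: algebra_simps)
  also have "\<dots> = real n * \<bar>u - v\<bar>" by (simp add: abs_mult abs_minus_commute)
  finally show ?thesis .
qed

lemma ramps_measurable [measurable]: "ramps cs \<in> borel_measurable borel"
proof (induction cs)
  case (Cons a cs)
  obtain c q n where "a = (c, q, n)" by (cases a)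
  then have "ramps (a # cs) = (\<lambda>u. of_rat c * ramp (of_rat q) n u + ramps cs u)" by auto
  then show ?case using Cons by simp
qed (simp add: ramps_def[abs_def])

lemma ramps_bounded: "\<exists>B. \<forall>u. \<bar>ramps cs u\<bar> \<le> B"
proof (induction cs)
  case (Cons a cs)
  obtain c q n where a: "a = (c, q, n)" by (cases a)
  obtain B where B: "\<And>u. \<bar>ramps cs u\<bar> \<le> B" using Cons by auto
  have "\<bar>ramps (a # cs) u\<bar> \<le> \<bar>of_rat c\<bar> * 1 + B" for u
    unfolding a ramps_simps
    using ramp_bounds[of "of_rat q" n u]
    by (intro order.trans[OF abs_triangle_ineq] add_mono B)
      (auto simp: abs_mult intro!: mult_left_le)
  then show ?case by blast
qed (auto intro!: exI[of _ 0])

lemma ramps_lipschitz: "\<exists>L>0. \<forall>u v. \<bar>ramps cs u - ramps cs v\<bar> \<le> L * \<bar>u - v\<bar>"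
proof (induction cs)
  case (Cons a cs)
  obtain c q n where a: "a = (c, q, n)" by (cases a)
  obtain L where L: "L > 0" "\<And>u v. \<bar>ramps cs u - ramps cs v\<bar> \<le> L * \<bar>u - v\<bar>"
    using Cons by auto
  have "\<bar>ramps (a # cs) u - ramps (a # cs) v\<bar> \<le> (\<bar>of_rat c\<bar> * real n + L) * \<bar>u - v\<bar>" for u v
  proof -
    have "\<bar>ramps (a # cs) u - ramps (a # cs) v\<bar>
       = \<bar>of_rat c * (ramp (of_rat q) n u - ramp (of_rat q) n v) + (ramps cs u - ramps cs v)\<bar>"
      by (simp add: a algebra_simps)
    also have "\<dots> \<le> \<bar>of_rat c\<bar> * (real n * \<bar>u - v\<bar>) + L * \<bar>u - v\<bar>"
      by (intro order.trans[OF abs_triangle_ineq] add_mono L)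
        (auto simp: abs_mult intro!: mult_left_mono ramp_lipschitz)
    finally show ?thesis by (simp add: algebra_simps)
  qed
  moreover have "0 < \<bar>of_rat c\<bar> * real n + L" using L by (simp add: add_nonneg_pos)
  ultimately show ?case by blast
qed (auto intro!: exI[of _ 1])

lemma ramps_scale: "\<exists>ds. ramps ds = (\<lambda>u. of_rat r * ramps cs u)"
proof (induction cs)
  case (Cons a cs)
  obtain c q n where a: "a = (c, q, n)" by (cases a)
  obtain ds where "ramps ds = (\<lambda>u. of_rat r * ramps cs u)" using Cons by auto
  then have "ramps ((r * c, q, n) # ds) = (\<lambda>u. of_rat r * ramps (a # cs) u)"
    by (auto simp: a of_rat_mult algebra_simps)
  then show ?case by blast
qed (auto intro!: exI[of _ "[]"] simp: fun_eq_iff)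

context w2_space
begin

lemma ramps_L2 [simp]: "ramps cs \<in> L2 f"
  using ramps_bounded[of cs] L2_bounded[OF ramps_measurable] by blast

lemma L2_bound:
  assumes g: "g \<in> L2 f" and x: "x \<in> borel_measurable borel" and le: "\<And>u. \<bar>x u\<bar> \<le> \<bar>g u\<bar>"
  shows "x \<in> L2 f"
proof -
  have "(x u)\<^sup>2 \<le> (g u)\<^sup>2" for u using le[of u] by (simp add: abs_le_square_iff)
  moreover have "(\<lambda>u. (x u)\<^sup>2) \<in> borel_measurable \<mu>" using x by simp
  moreover have "integrable \<mu> (\<lambda>u. (g u)\<^sup>2)" using g by (simp add: L2_iff)
  ultimately have "integrable \<mu> (\<lambda>u. (x u)\<^sup>2)"
    by (elim Bochner_Integration.integrable_bound) simp_all
  with x show ?thesis by (simp add: L2_iff)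
qed

text \<open>Membership in the closure of the \<open>ramps\<close>. The lemmas below supply the
  closure properties that measure-theoretic induction asks for.\<close>

definition approximable :: "(real \<Rightarrow> real) \<Rightarrow> bool" where
  "approximable x \<longleftrightarrow> x \<in> L2 f \<and> (\<forall>e>0. \<exists>cs. L2norm (\<lambda>u. x u - ramps cs u) < e)"

lemma L2_dominated_convergence:
  assumes "\<And>n. x n \<in> borel_measurable borel" "g \<in> L2 f" "y \<in> L2 f"
    and "\<And>n u. \<bar>x n u\<bar> \<le> g u" "\<And>u. (\<lambda>n. x n u) \<longlonglongrightarrow> y u"
  shows "\<And>n. x n \<in> L2 f" "(\<lambda>n. L2norm (\<lambda>u. x n u - y u)) \<longlonglongrightarrow> 0"
proof -
  have [measurable]: "y \<in> borel_measurable borel" "\<And>n. x n \<in> borel_measurable borel"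
    "g \<in> borel_measurable borel"
    using assms by (auto dest: L2_measurable)
  have g2: "integrable \<mu> (\<lambda>u. (g u)\<^sup>2)" using assms by (simp add: L2_iff)
  show x: "x n \<in> L2 f" for n
    using assms(4)[of n] by (intro L2_bound[OF assms(2)]) (auto intro: order.trans[OF _ abs_ge_self])
  have yg: "\<bar>y u\<bar> \<le> g u" for u
    using tendsto_rabs[OF assms(5)[of u]] by (rule LIMSEQ_le_const2) (use assms(4) in auto)
  have b: "(x n u - y u)\<^sup>2 \<le> (2 * g u)\<^sup>2" for n u
  proof -
    have "\<bar>x n u - y u\<bar> \<le> 2 * g u" using assms(4)[of n u] yg[of u] by linarith
    then show ?thesis by (metis abs_ge_zero power2_abs power_mono)
  qed
  have "(\<lambda>n. \<integral>u. (x n u - y u)\<^sup>2 \<partial>\<mu>) \<longlonglongrightarrow> (\<integral>u. 0 \<partial>\<mu>)"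
  proof (rule integral_dominated_convergence[where w = "\<lambda>u. (2 * g u)\<^sup>2"])
    show "integrable \<mu> (\<lambda>u. (2 * g u)\<^sup>2)" using g2 by (simp add: power_mult_distrib)
    show "AE u in \<mu>. (\<lambda>n. (x n u - y u)\<^sup>2) \<longlonglongrightarrow> 0"
    proof (rule AE_I2)
      fix u
      show "(\<lambda>n. (x n u - y u)\<^sup>2) \<longlonglongrightarrow> 0"
        using tendsto_power[OF tendsto_diff[OF assms(5)[of u] tendsto_const[of "y u"]], of 2] by simp
    qed
  qed (use b in auto)
  then have "(\<lambda>n. sqrt (\<integral>u. (x n u - y u)\<^sup>2 \<partial>\<mu>)) \<longlonglongrightarrow> 0"
    using tendsto_real_sqrt[of _ 0] by simp
  moreover have "L2norm (\<lambda>u. x n u - y u) = sqrt (\<integral>u. (x n u - y u)\<^sup>2 \<partial>\<mu>)" for n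
    by (simp add: L2norm_def L2inner_eq power2_eq_square)
  ultimately show "(\<lambda>n. L2norm (\<lambda>u. x n u - y u)) \<longlonglongrightarrow> 0" by simp
qed

lemma approximable_limit:
  assumes "\<And>n. approximable (x n)" "y \<in> L2 f" "(\<lambda>n. L2norm (\<lambda>u. x n u - y u)) \<longlonglongrightarrow> 0"
  shows "approximable y"
  unfolding approximable_def
proof (intro conjI allI impI)
  fix e :: real assume "e > 0"
  then have "\<forall>\<^sub>F n in sequentially. L2norm (\<lambda>u. x n u - y u) < e / 2"
    using assms(3) by (intro order_tendstoD) auto
  then obtain n where n: "L2norm (\<lambda>u. x n u - y u) < e / 2"
    by (auto simp: eventually_sequentially)
  have xn: "x n \<in> L2 f" using assms(1)[of n] by (simp add: approximable_def)
  obtain cs where "L2norm (\<lambda>u. x n u - ramps cs u) < e / 2"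
    using assms(1)[of n] \<open>e > 0\<close> by (auto simp: approximable_def dest!: spec[of _ "e / 2"])
  then show "\<exists>cs. L2norm (\<lambda>u. y u - ramps cs u) < e"
    using L2norm_diff_triangle[OF assms(2) xn ramps_L2[of cs]] n L2norm_minus_commute[OF assms(2) xn]
    by (intro exI[of _ cs]) linarith
qed (rule assms)

lemma approximable_dominated:
  assumes "\<And>n. approximable (x n)" "g \<in> L2 f" "y \<in> L2 f"
    and "\<And>n u. \<bar>x n u\<bar> \<le> g u" "\<And>u. (\<lambda>n. x n u) \<longlonglongrightarrow> y u"
  shows "approximable y"
  by (rule approximable_limit[OF assms(1,3) L2_dominated_convergence(2)[OF _ assms(2-5)]])
    (use assms(1) in \<open>auto simp: approximable_def intro: L2_measurable\<close>)

lemma L2norm_add_le: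
  assumes "x \<in> L2 f" "y \<in> L2 f"
  shows "L2norm (\<lambda>u. x u + y u) \<le> L2norm x + L2norm y"
  using L2norm_diff_triangle[of x "\<lambda>u. 0" "\<lambda>u. - 1 * y u"] L2norm_cmult[OF assms(2), of "-1"] assms
    L2_cmult[OF assms(2), of "-1"]
  by simp

lemma approximable_add:
  assumes "approximable x" "approximable y"
  shows "approximable (\<lambda>u. x u + y u)"
  unfolding approximable_def
proof (intro conjI allI impI)
  have L: "x \<in> L2 f" "y \<in> L2 f" using assms by (auto simp: approximable_def)
  then show "(\<lambda>u. x u + y u) \<in> L2 f" by simp
  fix e :: real assume "e > 0"
  then obtain cs ds where cd: "L2norm (\<lambda>u. x u - ramps cs u) < e / 2"
    "L2norm (\<lambda>u. y u - ramps ds u) < e / 2"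
    using assms by (auto simp: approximable_def dest!: spec[of _ "e / 2"])
  have "L2norm (\<lambda>u. (x u - ramps cs u) + (y u - ramps ds u)) < e"
    using L2norm_add_le[of "\<lambda>u. x u - ramps cs u" "\<lambda>u. y u - ramps ds u"] L cd by simp
  then have "L2norm (\<lambda>u. x u + y u - ramps (cs @ ds) u) < e" by (simp add: algebra_simps)
  then show "\<exists>cs. L2norm (\<lambda>u. x u + y u - ramps cs u) < e" by blast
qed

lemma approximable_rat:
  assumes "approximable x" shows "approximable (\<lambda>u. of_rat r * x u)"
  unfolding approximable_def
proof (intro conjI allI impI)
  have L: "x \<in> L2 f" using assms by (auto simp: approximable_def)
  then show "(\<lambda>u. of_rat r * x u) \<in> L2 f" by simp
  fix e :: real assume "e > 0"
  define d where "d = e / (\<bar>of_rat r\<bar> + 1)"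
  have "d > 0" using \<open>e > 0\<close> by (simp add: d_def add_nonneg_pos)
  then obtain cs where c: "L2norm (\<lambda>u. x u - ramps cs u) < d"
    using assms by (auto simp: approximable_def)
  obtain ds where ds: "ramps ds = (\<lambda>u. of_rat r * ramps cs u)" using ramps_scale by blast
  have "L2norm (\<lambda>u. of_rat r * x u - ramps ds u) = L2norm (\<lambda>u. of_rat r * (x u - ramps cs u))"
    by (simp add: ds algebra_simps)
  also have "\<dots> = \<bar>of_rat r\<bar> * L2norm (\<lambda>u. x u - ramps cs u)"
    using L by (simp add: L2norm_cmult)
  also have "\<dots> \<le> \<bar>of_rat r\<bar> * d" using c by (intro mult_left_mono) auto
  also have "\<dots> < (\<bar>of_rat r\<bar> + 1) * d" using \<open>d > 0\<close> by (simp add: algebra_simps)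
  also have "\<dots> = e" unfolding d_def by (simp add: add_nonneg_eq_0_iff)
  finally show "\<exists>cs. L2norm (\<lambda>u. of_rat r * x u - ramps cs u) < e" by blast
qed

lemma approximable_cmult:
  assumes "approximable x" shows "approximable (\<lambda>u. c * x u)"
proof -
  have L: "x \<in> L2 f" using assms by (auto simp: approximable_def)
  \<comment> \<open>Coefficients in \<open>ramps\<close> are rational, so a real factor is reached
    only as a limit of rational ones.\<close>
  have "\<exists>r. \<bar>of_rat r - c\<bar> < 1 / real (Suc n)" for n
  proof -
    obtain r where "c - 1 / real (Suc n) < of_rat r" "of_rat r < c"
      using of_rat_dense[of "c - 1 / real (Suc n)" c] by auto
    then show ?thesis by (intro exI[of _ r]) (simp only: abs_less_iff, linarith)
  qed
  then obtain r where r: "\<And>n. \<bar>of_rat (r n) - c\<bar> < 1 / real (Suc n)" by metis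
  have "(\<lambda>n. L2norm (\<lambda>u. of_rat (r n) * x u - c * x u)) \<longlonglongrightarrow> 0"
  proof (rule tendsto_sandwich[OF _ _ tendsto_const])
    show "(\<lambda>n. 1 / real (Suc n) * L2norm x) \<longlonglongrightarrow> 0"
      using tendsto_mult_right[OF LIMSEQ_inverse_real_of_nat, of "L2norm x"] by (simp add: field_simps)
    have "L2norm (\<lambda>u. of_rat (r n) * x u - c * x u) = \<bar>of_rat (r n) - c\<bar> * L2norm x" for n
      using L2norm_cmult[OF L, of "of_rat (r n) - c"] by (simp add: algebra_simps)
    moreover have "\<bar>of_rat (r n) - c\<bar> * L2norm x \<le> 1 / real (Suc n) * L2norm x" for n
      by (rule mult_right_mono[OF less_imp_le[OF r] L2norm_nonneg])
    ultimately show "\<forall>\<^sub>F n in sequentially. L2norm (\<lambda>u. of_rat (r n) * x u - c * x u) \<le> 1 / real (Suc n) * L2norm x"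
      by simp
  qed simp
  then show ?thesis
    by (intro approximable_limit[OF approximable_rat[OF assms]]) (use L in auto)
qed

lemma approximable_ramps: "approximable (ramps cs)"
  unfolding approximable_def
  by (auto simp: L2norm_def L2inner_def intro!: exI[of _ cs])

lemma approximable_empty: "approximable (indicator {})"
proof -
  have "ramps [] = indicator {}" by (simp add: fun_eq_iff)
  with approximable_ramps[of "[]"] show ?thesis by (simp only:)
qed

lemma approximable_lessEq: "approximable (indicator {..b})"
proof -
  \<comment> \<open>As \<open>q n\<close> lies strictly right of \<open>b\<close>, each ramp is 1 on
    \<open>{..b}\<close>; with slope \<open>Suc n\<close> it vanishes beyond
    \<open>b + 2 / Suc n\<close>, hence the threshold \<open>(u - b) / 2\<close> below.\<close>
  have "\<exists>q. b < of_rat q \<and> of_rat q < b + 1 / real (Suc n)" for n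
    by (rule of_rat_dense) simp
  then obtain q where q: "\<And>n. b < of_rat (q n)" "\<And>n. of_rat (q n) < b + 1 / real (Suc n)"
    by metis
  have r: "ramps [(1, q n, Suc n)] u = ramp (of_rat (q n)) (Suc n) u" for n u by simp
  show ?thesis
  proof (rule approximable_dominated[where x = "\<lambda>n. ramps [(1, q n, Suc n)]" and g = "\<lambda>u. 1"])
    show "\<bar>ramps [(1, q n, Suc n)] u\<bar> \<le> 1" for n u
      using ramp_bounds[of "of_rat (q n)" "Suc n" u] unfolding r by simp
    show "(\<lambda>n. ramps [(1, q n, Suc n)] u) \<longlonglongrightarrow> indicator {..b} u" for u
    proof (cases "u \<le> b")
      case True
      have "ramp (of_rat (q n)) (Suc n) u = 1" for n
      proof -
        have "0 \<le> real (Suc n) * (of_rat (q n) - u)" using q(1)[of n] True by (intro mult_nonneg_nonneg) auto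
        then show ?thesis by (simp add: ramp_def)
      qed
      then show ?thesis using True unfolding r by simp
    next
      case False
      then have "0 < (u - b) / 2" by simp
      have "\<forall>\<^sub>F n in sequentially. 1 / real (Suc n) < (u - b) / 2"
        using order_tendstoD(2)[OF LIMSEQ_inverse_real_of_nat \<open>0 < (u - b) / 2\<close>]
        by (simp add: inverse_eq_divide)
      then have "\<forall>\<^sub>F n in sequentially. ramp (of_rat (q n)) (Suc n) u = 0"
      proof eventually_elim
        case (elim n)
        then have "1 / real (Suc n) \<le> u - of_rat (q n)" using q(2)[of n] by (simp add: field_simps)
        then have "1 \<le> real (Suc n) * (u - of_rat (q n))" by (simp add: field_simps)
        then have "1 + real (Suc n) * (of_rat (q n) - u) \<le> 0" by (simp add: algebra_simps)
        then show ?case by (simp add: ramp_def)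
      qed
      then show ?thesis using False unfolding r by (simp add: tendsto_eventually)
    qed
  qed (auto simp: approximable_ramps intro!: L2_bounded[where B = 1] split: split_indicator)
qed

text \<open>Dynkin's argument on the half-lines. Complements need the constant function, obtained
  first; disjointness makes the indicator of a finite union a sum, and dominated convergence handles
  the countable union.\<close>

lemma approximable_indicator:
  assumes "A \<in> sets borel" shows "approximable (indicator A)"
proof -
  have UNIV: "approximable (indicator UNIV)"
  proof (rule approximable_dominated[where x = "\<lambda>n. indicator {..real n}" and g = "\<lambda>u. 1"])
    show "(\<lambda>n. indicator {..real n} u) \<longlonglongrightarrow> (indicator UNIV u :: real)" for u
    proof (rule tendsto_eventually)
      have "\<forall>\<^sub>F n in sequentially. u \<le> real n"
        using filterlim_real_sequentially by (auto simp: filterlim_at_top)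
      then show "\<forall>\<^sub>F n in sequentially. indicator {..real n} u = (indicator UNIV u :: real)"
        by eventually_elim auto
    qed
  qed (auto simp: approximable_lessEq intro!: L2_bounded[where B = 1] split: split_indicator)
  have "Int_stable (range (atMost :: real \<Rightarrow> _))"
    by (auto simp: Int_stable_def)
  moreover have "range (atMost :: real \<Rightarrow> _) \<subseteq> Pow UNIV" by simp
  moreover have "A \<in> sigma_sets UNIV (range atMost)"
    using assms by (simp add: borel_eq_atMost[where 'a = real])
  ultimately show ?thesis
  proof (induction rule: sigma_sets_induct_disjoint)
    case (basic A) then show ?case using approximable_lessEq by auto
  next
    case empty
    show ?case by (rule approximable_empty)
  next
    case (compl A)
    have "indicator (UNIV - A) = (\<lambda>u. indicator UNIV u + - 1 * indicator A u :: real)"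
      by (auto simp: fun_eq_iff split: split_indicator)
    then show ?case using approximable_add[OF UNIV approximable_cmult[OF compl(2)], of "-1"] by simp
  next
    case (union A)
    have A: "A i \<in> sets borel" for i
      using union by (auto simp: borel_eq_atMost[where 'a = real])
    have fin: "approximable (indicator (\<Union>i<n. A i))" for n
    proof (induction n)
      case 0
      show ?case using approximable_empty by (metis UN_empty lessThan_0)
    next
      case (Suc n)
      have "A n \<inter> A i = {}" if "i < n" for i
        using union(1) that unfolding disjoint_family_on_def by (metis UNIV_I nat_neq_iff)
      then have "A n \<inter> (\<Union>i<n. A i) = {}" by blast
      then have "indicator (\<Union>i<Suc n. A i) = (\<lambda>u. indicator (A n) u + indicator (\<Union>i<n. A i) u :: real)"
        by (auto simp: fun_eq_iff lessThan_Suc split: split_indicator)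
      then show ?case using approximable_add[OF union(3)[of n] Suc] by simp
    qed
    show ?case
    proof (rule approximable_dominated[OF fin, where g = "\<lambda>u. 1"])
      show "(\<lambda>n. indicator (\<Union>i<n. A i) u) \<longlonglongrightarrow> (indicator (\<Union>i. A i) u :: real)" for u
        by (rule LIMSEQ_indicator_UN)
    qed (use A in \<open>auto intro!: L2_bounded[where B = 1] split: split_indicator\<close>)
  qed
qed

lemma approximable_L2:
  assumes "x \<in> L2 f" shows "approximable x"
proof -
  \<comment> \<open>Membership stays inside the induction as a premise: each stage recovers it for
    its pieces, by domination or by dividing out the factor.\<close>
  have pos: "x \<in> L2 f \<longrightarrow> approximable x"
    if "x \<in> borel_measurable borel" "\<And>u. 0 \<le> x u" for x
    using that
  proof (induction rule: borel_measurable_induct_real)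
    case (set A) then show ?case by (simp add: approximable_indicator)
  next
    case (mult x c)
    show ?case
    proof
      assume a: "(\<lambda>u. c * x u) \<in> L2 f"
      show "approximable (\<lambda>u. c * x u)"
      \<comment> \<open>For \<open>c = 0\<close> membership of the product says nothing about
        \<open>x\<close>.\<close>
      proof (cases "c = 0")
        case True
        then show ?thesis using approximable_ramps[of "[]"] by (simp add: ramps_def[abs_def])
      next
        case False
        then have "x \<in> L2 f" using L2_cmult[OF a, of "1 / c"] by simp
        then show ?thesis using mult approximable_cmult by simp
      qed
    qed
  next
    case (add x y)
    show ?case
    proof
      assume a: "(\<lambda>u. y u + x u) \<in> L2 f"
      have "x \<in> L2 f" "y \<in> L2 f"
        using add by (auto intro!: L2_bound[OF a])
      then show "approximable (\<lambda>u. y u + x u)" using add approximable_add by simp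
    qed
  next
    case (seq X)
    show ?case
    proof
      assume x: "x \<in> L2 f"
      have le: "X i u \<le> x u" for i u
        using seq by (intro incseq_le) (auto simp: incseq_def le_fun_def)
      have "X i \<in> L2 f" for i
        using seq(1,2) order.trans[OF seq(2) le] le[of i] by (intro L2_bound[OF x]) auto
      then show "approximable x"
        using seq le x by (intro approximable_dominated[of X x x]) auto
    qed
  qed
  have m [measurable]: "x \<in> borel_measurable borel" using assms by (rule L2_measurable)
  have "(\<lambda>u. max 0 (x u)) \<in> L2 f" "(\<lambda>u. max 0 (- x u)) \<in> L2 f"
    by (auto intro!: L2_bound[OF assms])
  then have "approximable (\<lambda>u. max 0 (x u))" "approximable (\<lambda>u. max 0 (- x u))"
    using pos by auto
  then have "approximable (\<lambda>u. max 0 (x u) + -1 * max 0 (- x u))"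
    by (intro approximable_add approximable_cmult)
  moreover have "(\<lambda>u. max 0 (x u) + -1 * max 0 (- x u)) = x" by (auto simp: max_def)
  ultimately show ?thesis by simp
qed

lemma ramps_dense:
  assumes "x \<in> L2 f" "e > 0"
  obtains cs where "L2norm (\<lambda>u. x u - ramps cs u) < e"
  using approximable_L2[OF assms(1)] assms(2) by (auto simp: approximable_def)

end

section \<open>Optimal maps and the tangent space\<close>

lemma strict_mono_id_plus_contraction:
  fixes h :: "real \<Rightarrow> real"
  assumes "\<And>u v. \<bar>h u - h v\<bar> \<le> L * \<bar>u - v\<bar>" "L < 1"
  shows "strict_mono (\<lambda>u. u + h u)"
proof (rule strict_monoI)
  fix u v :: real assume "u < v"
  then have "L * \<bar>u - v\<bar> < \<bar>u - v\<bar>" using assms(2) by simp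
  with assms(1)[of u v] \<open>u < v\<close> show "u + h u < v + h v" by linarith
qed

lemma real_lipschitz_imp_isCont:
  fixes h :: "real \<Rightarrow> real"
  assumes "\<And>u v. \<bar>h u - h v\<bar> \<le> L * \<bar>u - v\<bar>" "0 < L"
  shows "isCont h x"
  unfolding continuous_at_eps_delta
proof (intro allI impI)
  fix e :: real assume "e > 0"
  show "\<exists>d>0. \<forall>x'. dist x' x < d \<longrightarrow> dist (h x') (h x) < e"
    unfolding dist_real_def
  proof (intro exI[of _ "e / L"] conjI allI impI)
    fix y assume "\<bar>y - x\<bar> < e / L"
    then have "L * \<bar>y - x\<bar> < e" using assms(2) by (simp add: field_simps)
    then show "\<bar>h y - h x\<bar> < e" using assms(1)[of y x] by linarith
  qed (use \<open>e > 0\<close> assms(2) in simp)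
qed

lemma surj_id_plus_bounded:
  fixes h :: "real \<Rightarrow> real"
  assumes "\<And>x. isCont h x" "\<And>u. \<bar>h u\<bar> \<le> B"
  shows "surj (\<lambda>u. u + h u)"
proof -
  have "\<exists>x. x + h x = y" for y
  proof -
    have "\<exists>x\<ge>y - B. x \<le> y + B \<and> x + h x = y"
      using assms(2)[of "y - B"] assms(2)[of "y + B"] assms(1)
      by (intro IVT) (auto intro!: continuous_intros)
    then show ?thesis by blast
  qed
  then show ?thesis by (metis surj_def)
qed

context w2_space
begin

text \<open>With \<open>H' = h\<close> and \<open>S\<close> the inverse of \<open>T = id + h\<close>, the function \<open>x \<mapsto> (x - y)\<^sup>2 + 2 H x\<close> is
  minimal at \<open>S y\<close> because its derivative is \<open>2 (T x - y)\<close>. Hence \<open>(x - y)\<^sup>2 \<ge> - 2 H x + b y\<close>, with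
  equality on the graph of \<open>T\<close>: a pair of Kantorovich potentials certifying optimality.\<close>

lemma ot_map_id_plus_contraction:
  assumes lip: "\<And>u v. \<bar>h u - h v\<bar> \<le> L * \<bar>u - v\<bar>" and L: "0 < L" "L < 1"
    and bd: "\<And>u. \<bar>h u\<bar> \<le> B"
  shows "ot_map \<mu> (distr \<mu> borel (\<lambda>u. u + h u)) (\<lambda>u. u + h u)"
proof -
  define T where "T = (\<lambda>u. u + h u)"
  have cont: "isCont h x" for x
    by (rule real_lipschitz_imp_isCont[OF lip L(1)])
  have smono: "strict_mono T"
    unfolding T_def by (rule strict_mono_id_plus_contraction[OF lip L(2)])
  have surj: "surj T"
    unfolding T_def by (rule surj_id_plus_bounded[OF cont bd])
  define S where "S = inv T"
  have ST: "S (T x) = x" and TS: "T (S y) = y" for x y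
    using smono surj by (simp_all add: S_def strict_mono_imp_inj_on surj_f_inv_f)
  have "mono S"
    using smono by (intro monoI) (metis TS not_le strict_mono_less_eq)
  have h_meas [measurable]: "h \<in> borel_measurable borel"
    by (intro borel_measurable_continuous_onI continuous_at_imp_continuous_on) (simp add: cont)
  have S_meas [measurable]: "S \<in> borel_measurable borel"
    using \<open>mono S\<close> by (rule borel_measurable_mono)
  have T_meas [measurable]: "T \<in> borel_measurable borel"
    unfolding T_def by measurable
  have "\<exists>H. \<forall>x. - \<infinity> < ereal x \<longrightarrow> ereal x < \<infinity> \<longrightarrow> (H has_vector_derivative h x) (at x)"
    by (rule einterval_antiderivative) (auto simp: cont)
  then obtain H where H: "\<And>x. (H has_real_derivative h x) (at x)"
    by (auto simp: has_real_derivative_iff_has_vector_derivative)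
  have H_meas [measurable]: "H \<in> borel_measurable borel"
    using H by (intro borel_measurable_continuous_onI) (meson DERIV_continuous_on has_field_derivative_at_within)
  \<comment> \<open>Linear growth makes the potential integrable, because \<open>\<mu>\<close> has a
    finite first moment.\<close>
  have H_growth: "\<bar>H x\<bar> \<le> \<bar>H 0\<bar> + B * \<bar>x\<bar>" for x
  proof -
    have "norm (H x - H 0) \<le> B * norm (x - 0)"
      using H bd by (intro field_differentiable_bound[of UNIV H h]) auto
    then show ?thesis by simp
  qed
  define b where "b = (\<lambda>y. (y - S y)\<^sup>2 + 2 * H (S y))"
  have b_meas [measurable]: "b \<in> borel_measurable borel" unfolding b_def by measurable
  have key: "- 2 * H x + b y \<le> (x - y)\<^sup>2" for x y
  proof -
    define G where "G = (\<lambda>x. (x - y)\<^sup>2 + 2 * H x)"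
    have G: "(G has_real_derivative 2 * (T z - y)) (at z)" for z
      unfolding G_def T_def by (auto intro!: derivative_eq_intros H simp: algebra_simps)
    have "G (S y) \<le> G x"
    proof (cases "S y \<le> x")
      case True
      show ?thesis
      proof (rule DERIV_nonneg_imp_nondecreasing[OF True])
        fix z assume "S y \<le> z" "z \<le> x"
        then have "T (S y) \<le> T z" using smono by (simp add: strict_mono_less_eq)
        then show "\<exists>d. (G has_real_derivative d) (at z) \<and> 0 \<le> d" using G TS by force
      qed
    next
      case False
      then have "x \<le> S y" by simp
      then show ?thesis
      proof (rule DERIV_nonpos_imp_nonincreasing)
        fix z assume "x \<le> z" "z \<le> S y"
        then have "T z \<le> T (S y)" using smono by (simp add: strict_mono_less_eq)
        then show "\<exists>d. (G has_real_derivative d) (at z) \<and> d \<le> 0" using G[of z] TS by force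
      qed
    qed
    then show ?thesis by (simp add: G_def b_def power2_commute)
  qed
  have eq: "- 2 * H x + b (T x) = (T x - x)\<^sup>2" for x
    by (simp add: b_def ST)
  have int_H: "integrable \<mu> H"
  proof (rule Bochner_Integration.integrable_bound)
    show "integrable \<mu> (\<lambda>x. \<bar>H 0\<bar> + B * \<bar>x\<bar>)"
      using integral_le_L2norm(1)[OF L2_id] by auto
    show "AE x in \<mu>. norm (H x) \<le> norm (\<bar>H 0\<bar> + B * \<bar>x\<bar>)"
      using H_growth by (auto intro!: AE_I2 order.trans[OF _ abs_ge_self])
  qed simp
  have "h \<in> L2 f" using bd by (intro L2_bounded) auto
  then have int_h2: "integrable \<mu> (\<lambda>x. (T x - x)\<^sup>2)" by (simp add: L2_iff T_def)
  \<comment> \<open>Along the graph of \<open>T\<close> the equality case expresses \<open>b\<close>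
    by functions already known to be integrable.\<close>
  have int_b: "integrable \<mu> (\<lambda>x. b (T x))"
  proof -
    have "(\<lambda>x. b (T x)) = (\<lambda>x. (T x - x)\<^sup>2 + 2 * H x)"
      using eq by (auto simp: fun_eq_iff algebra_simps)
    then show ?thesis using int_H int_h2 by simp
  qed
  have opt: "(\<integral>\<^sup>+ x. ennreal ((T x - x)\<^sup>2) \<partial>\<mu>) \<le> (\<integral>\<^sup>+ z. ennreal ((fst z - snd z)\<^sup>2) \<partial>\<pi>)"
    if "coupling \<mu> (distr \<mu> borel T) \<pi>" for \<pi>
  proof -
    have [measurable_cong]: "sets \<pi> = sets (borel \<Otimes>\<^sub>M borel)"
      and m1: "distr \<pi> borel fst = \<mu>" and m2: "distr \<pi> borel snd = distr \<mu> borel T"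
      using that by (auto simp: coupling_def)
    have i1: "integrable \<pi> (\<lambda>z. H (fst z))"
      using int_H by (subst (asm) m1[symmetric]) (subst (asm) integrable_distr_eq; simp)
    have "integrable (distr \<mu> borel T) b"
      using int_b by (subst integrable_distr_eq) auto
    then have i2: "integrable \<pi> (\<lambda>z. b (snd z))"
      by (subst (asm) m2[symmetric]) (subst (asm) integrable_distr_eq; simp)
    have e1: "(\<integral>z. H (fst z) \<partial>\<pi>) = (\<integral>x. H x \<partial>\<mu>)"
      by (simp add: integral_distr flip: m1)
    have e2: "(\<integral>z. b (snd z) \<partial>\<pi>) = (\<integral>x. b (T x) \<partial>\<mu>)"
    proof -
      have "(\<integral>z. b (snd z) \<partial>\<pi>) = (\<integral>y. b y \<partial>distr \<pi> borel snd)" by (simp add: integral_distr)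
      also have "\<dots> = (\<integral>x. b (T x) \<partial>\<mu>)" unfolding m2 by (simp add: integral_distr)
      finally show ?thesis .
    qed
    show ?thesis
    proof (cases "(\<integral>\<^sup>+ z. ennreal ((fst z - snd z)\<^sup>2) \<partial>\<pi>) < \<infinity>")
      case True
      then have i3: "integrable \<pi> (\<lambda>z. (fst z - snd z)\<^sup>2)"
        by (subst integrable_iff_bounded) simp
      have "(\<integral>x. (T x - x)\<^sup>2 \<partial>\<mu>) = (\<integral>x. - 2 * H x + b (T x) \<partial>\<mu>)"
        by (simp only: eq)
      also have "\<dots> = - 2 * (\<integral>x. H x \<partial>\<mu>) + (\<integral>x. b (T x) \<partial>\<mu>)"
        using int_H int_b by simp
      also have "\<dots> = (\<integral>z. - 2 * H (fst z) + b (snd z) \<partial>\<pi>)"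
        using i1 i2 e1 e2 by simp
      also have "\<dots> \<le> (\<integral>z. (fst z - snd z)\<^sup>2 \<partial>\<pi>)"
        using i1 i2 i3 key by (intro integral_mono) auto
      finally show ?thesis
        using int_h2 i3 by (simp add: nn_integral_eq_integral ennreal_leI)
    next
      case False
      then show ?thesis by (simp add: not_less top.extremum_unique)
    qed
  qed
  show ?thesis
    using opt T_meas unfolding T_def ot_map_def by blast
qed

lemma tangent_space_eq_L2: "tangent_space f = L2 f"
proof
  show "L2 f \<subseteq> tangent_space f"
  proof
    fix V assume V: "V \<in> L2 f"
    show "V \<in> tangent_space f"
      unfolding tangent_space_def
    proof (intro CollectI conjI allI impI)
      fix e :: real assume "0 < e"
      then obtain cs where cs: "L2norm (\<lambda>u. V u - ramps cs u) < sqrt e"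
        using ramps_dense[OF V, of "sqrt e"] by auto
      obtain L where L: "L > 0" "\<And>u v. \<bar>ramps cs u - ramps cs v\<bar> \<le> L * \<bar>u - v\<bar>"
        using ramps_lipschitz by blast
      obtain B where B: "\<And>u. \<bar>ramps cs u\<bar> \<le> B" using ramps_bounded by blast
      \<comment> \<open>Division by twice the Lipschitz constant turns the displacement into a
        contraction with factor 1/2, so the identity plus it is increasing and hence
        optimal.\<close>
      define c where "c = 2 * L"
      define h where "h = (\<lambda>u. ramps cs u / c)"
      have "c > 0" using L by (simp add: c_def)
      have h1: "\<bar>h u - h v\<bar> \<le> 1 / 2 * \<bar>u - v\<bar>" for u v
      proof -
        have "\<bar>h u - h v\<bar> = \<bar>ramps cs u - ramps cs v\<bar> / c"
          using \<open>c > 0\<close> by (simp add: h_def diff_divide_distrib[symmetric])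
        also have "\<dots> \<le> L * \<bar>u - v\<bar> / c" using L \<open>c > 0\<close> by (intro divide_right_mono) auto
        finally show ?thesis using L by (simp add: c_def)
      qed
      have h2: "\<bar>h u\<bar> \<le> B / c" for u
        using B \<open>c > 0\<close> by (auto simp: h_def abs_divide intro!: divide_right_mono)
      have [measurable]: "h \<in> borel_measurable borel" unfolding h_def by measurable
      have ot: "ot_map \<mu> (distr \<mu> borel (\<lambda>u. u + h u)) (\<lambda>u. u + h u)"
        by (rule ot_map_id_plus_contraction[OF h1 _ _ h2]) auto
      have hL: "h \<in> L2 f" using h2 by (intro L2_bounded) auto
      have "W2_measure (distr \<mu> borel (\<lambda>u. u + h u))"
        unfolding W2_measure_def
      proof (intro conjI)
        show "prob_space (distr \<mu> borel (\<lambda>u. u + h u))" by (rule \<mu>.prob_space_distr) simp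
        have "(\<integral>\<^sup>+ u. ennreal ((u + h u)\<^sup>2) \<partial>\<mu>) = L2sq f (\<lambda>u. u + h u)"
          by (simp add: L2sq_eq_nn_integral)
        also have "\<dots> < \<infinity>" using L2_add[OF L2_id hL] by (simp add: L2_def)
        finally show "(\<integral>\<^sup>+ x. ennreal (x\<^sup>2) \<partial>distr \<mu> borel (\<lambda>u. u + h u)) < \<infinity>"
          by (simp add: nn_integral_distr)
      qed simp
      moreover have "L2sq f (\<lambda>u. V u - c * (u + h u - u)) < ennreal e"
      proof -
        have "(\<lambda>u. V u - c * (u + h u - u)) = (\<lambda>u. V u - ramps cs u)"
          using \<open>c > 0\<close> by (simp add: h_def)
        moreover have "(L2norm (\<lambda>u. V u - ramps cs u))\<^sup>2 < e"
          using cs \<open>0 < e\<close> by (metis L2norm_nonneg less_imp_le power_strict_mono real_sqrt_pow2 pos2)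
        ultimately show ?thesis
          using V \<open>0 < e\<close> by (simp add: L2sq_norm ennreal_less_iff)
      qed
      ultimately show "\<exists>c>0. \<exists>T \<nu>. W2_measure \<nu> \<and> ot_map \<mu> \<nu> T
          \<and> L2sq f (\<lambda>u. V u - c * (T u - u)) < ennreal e"
        using ot \<open>c > 0\<close> by blast
    qed (rule V)
  qed
qed (auto simp: tangent_space_def)

end

section \<open>Measurability on \<open>L\<^sup>2(f)\<close>\<close>

lemma ramp_tendsto_indicator: "(\<lambda>n. ramp a n u) \<longlonglongrightarrow> indicator {..a} u"
proof (cases "u \<le> a")
  case True
  then have "ramp a n u = 1" for n by (simp add: ramp_def)
  then show ?thesis using True by simp
next
  case False
  obtain N where N: "1 / (u - a) < real N" using reals_Archimedean2 by blast
  have "ramp a n u = 0" if "n \<ge> N" for n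
  proof -
    have "1 / (u - a) < real n" using N that by linarith
    then have "1 < real n * (u - a)" using False by (simp add: field_simps)
    then show ?thesis by (simp add: ramp_def algebra_simps)
  qed
  then show ?thesis using False by (auto simp: eventually_sequentially intro!: tendsto_eventually exI[of _ N])
qed

text \<open>The second premise says that \<open>g\<close> is pointwise the supremum of the countable
  family \<open>G\<close>; strict inequalities express this without \<open>Sup\<close> on the reals
  and its boundedness conditions.\<close>

lemma borel_measurable_countable_sup_rep:
  fixes g :: "'a \<Rightarrow> real" and G :: "'c::countable \<Rightarrow> 'a \<Rightarrow> real"
  assumes "\<And>c. G c \<in> borel_measurable M"
    and "\<And>x a. x \<in> space M \<Longrightarrow> a < g x \<longleftrightarrow> (\<exists>c. a < G c x)"
  shows "g \<in> borel_measurable M"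
  unfolding borel_measurable_iff_greater
proof
  fix a
  have "{w \<in> space M. a < g w} = (\<Union>c. {w \<in> space M. a < G c w})" using assms(2) by auto
  also have "\<dots> \<in> sets M"
    using assms(1) by (intro sets.countable_UN') (auto simp: borel_measurable_iff_greater)
  finally show "{w \<in> space M. a < g w} \<in> sets M" .
qed

context w2_space
begin

lemma space_L2M [simp]: "space (L2M f) = L2 f"
  unfolding L2M_def by (rule space_measure_of) auto

lemma measurable_L2inner [measurable]:
  assumes "h \<in> L2 f" shows "(\<lambda>x. L2inner f x h) \<in> borel_measurable (L2M f)"
proof (rule measurableI)
  fix B :: "real set" assume "B \<in> sets borel"
  then have "(\<lambda>x. L2inner f x h) -` B \<inter> L2 f \<in> {(\<lambda>x. L2inner f x h) -` B \<inter> L2 f | h B. h \<in> L2 f \<and> B \<in> sets borel}"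
    using assms by blast
  then show "(\<lambda>x. L2inner f x h) -` B \<inter> space (L2M f) \<in> sets (L2M f)"
    unfolding space_L2M unfolding L2M_def by (subst sets_measure_of) auto
qed simp

lemma measurable_L2M_I:
  assumes "\<And>\<omega>. \<omega> \<in> space M \<Longrightarrow> X \<omega> \<in> L2 f"
    and "\<And>h. h \<in> L2 f \<Longrightarrow> (\<lambda>\<omega>. L2inner f (X \<omega>) h) \<in> borel_measurable M"
  shows "X \<in> measurable M (L2M f)"
  unfolding L2M_def
proof (rule measurable_measure_of)
  fix A assume "A \<in> {(\<lambda>x. L2inner f x h) -` B \<inter> L2 f | h B. h \<in> L2 f \<and> B \<in> sets borel}"
  then obtain h B where A: "A = (\<lambda>x. L2inner f x h) -` B \<inter> L2 f" "h \<in> L2 f" "B \<in> sets borel" by blast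
  have "X -` A \<inter> space M = (\<lambda>\<omega>. L2inner f (X \<omega>) h) -` B \<inter> space M"
    using assms(1) by (auto simp: A)
  then show "X -` A \<inter> space M \<in> sets M"
    using measurable_sets[OF assms(2)[OF A(2)] A(3)] by simp
qed (use assms in auto)

lemma measurable_L2M_L2:
  "X \<in> measurable M (L2M f) \<Longrightarrow> \<omega> \<in> space M \<Longrightarrow> X \<omega> \<in> L2 f"
  using measurable_space[of X M "L2M f" \<omega>] by simp

lemma measurable_L2inner_comp:
  assumes "X \<in> measurable M (L2M f)" "h \<in> L2 f"
  shows "(\<lambda>\<omega>. L2inner f (X \<omega>) h) \<in> borel_measurable M"
  using measurable_compose[OF assms(1) measurable_L2inner[OF assms(2)]] .

lemma measurable_L2M_diff:
  assumes "X \<in> measurable M (L2M f)" "Y \<in> measurable M (L2M f)"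
  shows "(\<lambda>\<omega> u. X \<omega> u - Y \<omega> u) \<in> measurable M (L2M f)"
proof (rule measurable_L2M_I)
  fix h assume h: "h \<in> L2 f"
  have "(\<lambda>\<omega>. L2inner f (X \<omega>) h - L2inner f (Y \<omega>) h) \<in> borel_measurable M"
    by (intro borel_measurable_diff measurable_L2inner_comp assms h)
  then show "(\<lambda>\<omega>. L2inner f (\<lambda>u. X \<omega> u - Y \<omega> u) h) \<in> borel_measurable M"
    by (rule measurable_cong[THEN iffD1, rotated])
      (simp add: L2inner_diff_left measurable_L2M_L2[OF assms(1)] measurable_L2M_L2[OF assms(2)] h)
qed (simp add: measurable_L2M_L2[OF assms(1)] measurable_L2M_L2[OF assms(2)])

lemma measurable_L2M_cmult:
  assumes "X \<in> measurable M (L2M f)"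
  shows "(\<lambda>\<omega> u. c * X \<omega> u) \<in> measurable M (L2M f)"
proof (rule measurable_L2M_I)
  fix h assume h: "h \<in> L2 f"
  have "(\<lambda>\<omega>. c * L2inner f (X \<omega>) h) \<in> borel_measurable M"
    by (intro borel_measurable_times measurable_L2inner_comp assms h borel_measurable_const)
  then show "(\<lambda>\<omega>. L2inner f (\<lambda>u. c * X \<omega> u) h) \<in> borel_measurable M"
    by (rule measurable_cong[THEN iffD1, rotated])
      (simp add: L2inner_cmult_left measurable_L2M_L2[OF assms(1)] h)
qed (simp add: measurable_L2M_L2[OF assms(1)])

lemma measurable_L2M_sum:
  assumes "\<And>i. i \<in> I \<Longrightarrow> X i \<in> measurable M (L2M f)"
  shows "(\<lambda>\<omega> u. \<Sum>i\<in>I. X i \<omega> u) \<in> measurable M (L2M f)"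
proof (rule measurable_L2M_I)
  fix h assume h: "h \<in> L2 f"
  have "(\<lambda>\<omega>. \<Sum>i\<in>I. L2inner f (X i \<omega>) h) \<in> borel_measurable M"
    by (intro borel_measurable_sum measurable_L2inner_comp assms h)
  then show "(\<lambda>\<omega>. L2inner f (\<lambda>u. \<Sum>i\<in>I. X i \<omega> u) h) \<in> borel_measurable M"
    by (rule measurable_cong[THEN iffD1, rotated])
      (simp add: L2inner_sum_left measurable_L2M_L2[OF assms] h)
qed (simp add: measurable_L2M_L2[OF assms])

text \<open>The squared norm is the supremum of the measurable functionals \<open>2 \<langle>x, d\<rangle> - \<parallel>d\<parallel>\<^sup>2 = \<parallel>x\<parallel>\<^sup>2 - \<parallel>x - d\<parallel>\<^sup>2\<close>
  over a countable dense set.\<close>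

lemma measurable_L2norm_square [measurable]: "(\<lambda>x. (L2norm x)\<^sup>2) \<in> borel_measurable (L2M f)"
proof (rule borel_measurable_countable_sup_rep)
  show "(\<lambda>x. 2 * L2inner f x (ramps cs) - (L2norm (ramps cs))\<^sup>2) \<in> borel_measurable (L2M f)" for cs
    using measurable_L2inner[OF ramps_L2[of cs]] by measurable
  fix x a assume "x \<in> space (L2M f)"
  then have x: "x \<in> L2 f" by simp
  have eq: "2 * L2inner f x (ramps cs) - (L2norm (ramps cs))\<^sup>2 = (L2norm x)\<^sup>2 - (L2norm (\<lambda>u. x u - ramps cs u))\<^sup>2" for cs
    using L2norm_diff_square[OF x ramps_L2[of cs]] by simp
  show "a < (L2norm x)\<^sup>2 \<longleftrightarrow> (\<exists>cs. a < 2 * L2inner f x (ramps cs) - (L2norm (ramps cs))\<^sup>2)"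
    unfolding eq
  proof
    assume a: "a < (L2norm x)\<^sup>2"
    then obtain cs where "L2norm (\<lambda>u. x u - ramps cs u) < sqrt ((L2norm x)\<^sup>2 - a)"
      using ramps_dense[OF x, of "sqrt ((L2norm x)\<^sup>2 - a)"] by auto
    then have "(L2norm (\<lambda>u. x u - ramps cs u))\<^sup>2 < (sqrt ((L2norm x)\<^sup>2 - a))\<^sup>2"
      by (intro power_strict_mono) auto
    then show "\<exists>cs. a < (L2norm x)\<^sup>2 - (L2norm (\<lambda>u. x u - ramps cs u))\<^sup>2"
      using a by (intro exI[of _ cs]) simp
  next
    assume "\<exists>cs. a < (L2norm x)\<^sup>2 - (L2norm (\<lambda>u. x u - ramps cs u))\<^sup>2"
    then obtain cs where "a < (L2norm x)\<^sup>2 - (L2norm (\<lambda>u. x u - ramps cs u))\<^sup>2" by blast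
    then show "a < (L2norm x)\<^sup>2" using zero_le_power2[of "L2norm (\<lambda>u. x u - ramps cs u)"] by linarith
  qed
qed

lemma measurable_L2norm [measurable]: "L2norm \<in> borel_measurable (L2M f)"
proof -
  have "(\<lambda>x. sqrt ((L2norm x)\<^sup>2)) \<in> borel_measurable (L2M f)" by measurable
  then show ?thesis by simp
qed

lemma measurable_L2sq: "L2sq f \<in> borel_measurable (L2M f)"
proof -
  have "(\<lambda>x. ennreal ((L2norm x)\<^sup>2)) \<in> borel_measurable (L2M f)" by measurable
  then show ?thesis by (rule measurable_cong[THEN iffD1, rotated]) (simp add: L2sq_norm)
qed

text \<open>As in McShane's extension formula, a Lipschitz functional is the supremum of
  \<open>\<Psi> d - K * L2norm (x - d)\<close> over a dense set of \<open>d\<close>, so its values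
  at countably many points determine it.\<close>

lemma measurable_lipschitz_L2:
  assumes lip: "\<And>x y. x \<in> L2 f \<Longrightarrow> y \<in> L2 f \<Longrightarrow> \<bar>\<Psi> x - \<Psi> y\<bar> \<le> K * L2norm (\<lambda>u. x u - y u)" and "0 \<le> K"
  shows "\<Psi> \<in> borel_measurable (L2M f)"
proof (rule borel_measurable_countable_sup_rep)
  fix cs
  have "(\<lambda>x. L2norm (\<lambda>u. x u - ramps cs u)) \<in> borel_measurable (L2M f)"
    by (rule measurable_compose[OF measurable_L2M_diff measurable_L2norm]) (auto intro!: measurable_L2M_I)
  then show "(\<lambda>x. \<Psi> (ramps cs) - K * L2norm (\<lambda>u. x u - ramps cs u)) \<in> borel_measurable (L2M f)"
    by measurable
next
  fix x a assume "x \<in> space (L2M f)"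
  then have x: "x \<in> L2 f" by simp
  show "a < \<Psi> x \<longleftrightarrow> (\<exists>cs. a < \<Psi> (ramps cs) - K * L2norm (\<lambda>u. x u - ramps cs u))"
  proof
    assume a: "a < \<Psi> x"
    \<comment> \<open>A ramp at distance below \<open>e\<close> loses at most \<open>K * e\<close>
      by the Lipschitz bound and as much again by the penalty; the extra 1 covers
      \<open>K = 0\<close>.\<close>
    define e where "e = (\<Psi> x - a) / (2 * K + 1)"
    have "0 < e" using a \<open>0 \<le> K\<close> by (simp add: e_def)
    then obtain cs where cs: "L2norm (\<lambda>u. x u - ramps cs u) < e"
      using ramps_dense[OF x] by blast
    have "2 * (K * L2norm (\<lambda>u. x u - ramps cs u)) \<le> 2 * K * e"
      using cs \<open>0 \<le> K\<close> by (simp add: mult_left_mono)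
    also have "\<dots> < (2 * K + 1) * e" using \<open>0 < e\<close> by (simp add: algebra_simps)
    also have "\<dots> = \<Psi> x - a" using \<open>0 \<le> K\<close> by (simp add: e_def)
    finally show "\<exists>cs. a < \<Psi> (ramps cs) - K * L2norm (\<lambda>u. x u - ramps cs u)"
      using lip[OF x ramps_L2[of cs]] by (intro exI[of _ cs]) linarith
  next
    assume "\<exists>cs. a < \<Psi> (ramps cs) - K * L2norm (\<lambda>u. x u - ramps cs u)"
    then obtain cs where "a < \<Psi> (ramps cs) - K * L2norm (\<lambda>u. x u - ramps cs u)" by blast
    then show "a < \<Psi> x" using lip[OF x ramps_L2[of cs]] by linarith
  qed
qed

text \<open>It suffices to treat the mass of half-lines. This need not be continuous in
  \<open>V\<close>, but with \<open>ramp a n\<close> in place of the indicator it becomes Lipschitz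
  with constant \<open>n\<close>, and these functionals converge to it.\<close>

lemma measurable_Exp_map: "Exp_map f \<in> measurable (L2M f) (subprob_algebra borel)"
proof (rule measurable_subprob_algebra_generated[where \<Omega> = UNIV and G = "range atMost"])
  show "sets borel = sigma_sets UNIV (range (atMost :: real \<Rightarrow> _))"
    by (simp add: borel_eq_atMost[where 'a = real])
  show "Int_stable (range (atMost :: real \<Rightarrow> _))" by (auto simp: Int_stable_def)
  have Vm: "(\<lambda>u. V u + u) \<in> borel_measurable borel" if "V \<in> L2 f" for V
    using L2_measurable[OF that] by measurable
  have pr: "prob_space (Exp_map f V)" if "V \<in> L2 f" for V
    unfolding Exp_map_def using Vm[OF that] by (intro \<mu>.prob_space_distr) simp
  show "subprob_space (Exp_map f V)" if "V \<in> space (L2M f)" for V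
    using pr that by (simp add: prob_space_imp_subprob_space)
  show "sets (Exp_map f V) = sets borel" for V by (simp add: Exp_map_def)
  have "(\<lambda>V. emeasure (Exp_map f V) UNIV) \<in> borel_measurable (L2M f) \<longleftrightarrow>
      (\<lambda>V. 1 :: ennreal) \<in> borel_measurable (L2M f)"
  proof (rule measurable_cong)
    fix V assume "V \<in> space (L2M f)"
    then show "emeasure (Exp_map f V) UNIV = 1"
      using prob_space.emeasure_space_1[OF pr, of V] by (simp add: Exp_map_def)
  qed
  then show "(\<lambda>V. emeasure (Exp_map f V) UNIV) \<in> borel_measurable (L2M f)" by simp
  fix A assume "A \<in> range (atMost :: real \<Rightarrow> _)"
  then obtain a where A: "A = {..a}" by blast
  define \<Psi> where "\<Psi> n V = (\<integral>u. ramp a n (V u + u) \<partial>\<mu>)" for n V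
  have int: "integrable \<mu> (\<lambda>u. ramp a n (V u + u))" if "V \<in> L2 f" for n V
  proof (rule \<mu>.integrable_const_bound[where B = 1])
    show "(\<lambda>u. ramp a n (V u + u)) \<in> borel_measurable \<mu>"
      using measurable_compose[OF Vm[OF that] ramp_measurable] by simp
  qed (use ramp_bounds in auto)
  have meas: "\<Psi> n \<in> borel_measurable (L2M f)" for n
  proof (rule measurable_lipschitz_L2[where K = "real n"])
    fix x y assume xy: "x \<in> L2 f" "y \<in> L2 f"
    then have d: "(\<lambda>u. x u - y u) \<in> L2 f" by simp
    have "\<bar>\<Psi> n x - \<Psi> n y\<bar> = \<bar>\<integral>u. ramp a n (x u + u) - ramp a n (y u + u) \<partial>\<mu>\<bar>"
      using int xy by (simp add: \<Psi>_def)
    also have "\<dots> \<le> (\<integral>u. \<bar>ramp a n (x u + u) - ramp a n (y u + u)\<bar> \<partial>\<mu>)"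
      by (rule integral_abs_bound)
    also have "\<dots> \<le> (\<integral>u. real n * \<bar>x u - y u\<bar> \<partial>\<mu>)"
    proof (rule integral_mono)
      show "integrable \<mu> (\<lambda>u. \<bar>ramp a n (x u + u) - ramp a n (y u + u)\<bar>)" using int xy by auto
      show "integrable \<mu> (\<lambda>u. real n * \<bar>x u - y u\<bar>)" using integral_le_L2norm(1)[OF d] by auto
      show "\<bar>ramp a n (x u + u) - ramp a n (y u + u)\<bar> \<le> real n * \<bar>x u - y u\<bar>" for u
        using ramp_lipschitz[of a n "x u + u" "y u + u"] by simp
    qed
    also have "\<dots> \<le> real n * L2norm (\<lambda>u. x u - y u)"
      using integral_le_L2norm(2)[OF d] by (simp add: mult_left_mono)
    finally show "\<bar>\<Psi> n x - \<Psi> n y\<bar> \<le> real n * L2norm (\<lambda>u. x u - y u)" .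
  qed simp
  have lim: "(\<lambda>n. \<Psi> n V) \<longlonglongrightarrow> measure (Exp_map f V) A" if V: "V \<in> L2 f" for V
  proof -
    have [measurable]: "(\<lambda>u. V u + u) \<in> borel_measurable borel" by (rule Vm[OF V])
    have "(\<lambda>n. \<Psi> n V) \<longlonglongrightarrow> (\<integral>u. indicator {..a} (V u + u) \<partial>\<mu>)"
      unfolding \<Psi>_def
    proof (rule integral_dominated_convergence[where w = "\<lambda>_. 1"])
      show "AE u in \<mu>. (\<lambda>n. ramp a n (V u + u)) \<longlonglongrightarrow> indicator {..a} (V u + u)"
        using ramp_tendsto_indicator by auto
      show "AE u in \<mu>. norm (ramp a n (V u + u)) \<le> 1" for n
        using ramp_bounds by auto
    qed (use measurable_compose[OF Vm[OF V] ramp_measurable] in auto)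
    also have "(\<integral>u. indicator {..a} (V u + u) \<partial>\<mu>) = (\<integral>x. indicat_real {..a} x \<partial>Exp_map f V)"
      unfolding Exp_map_def by (subst integral_distr) simp_all
    also have "\<dots> = measure (Exp_map f V) A" by (simp add: A Exp_map_def)
    finally show ?thesis .
  qed
  have "(\<lambda>V. measure (Exp_map f V) A) \<in> borel_measurable (L2M f)"
    by (rule borel_measurable_LIMSEQ_real[of _ \<Psi>]) (simp_all add: lim meas)
  then have "(\<lambda>V. ennreal (measure (Exp_map f V) A)) \<in> borel_measurable (L2M f)" by measurable
  then show "(\<lambda>V. emeasure (Exp_map f V) A) \<in> borel_measurable (L2M f)"
    by (rule measurable_cong[THEN iffD1, rotated])
      (simp add: finite_measure.emeasure_eq_measure[OF prob_space.finite_measure[OF pr]])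
qed simp

end

section \<open>The coefficients of the inverse autoregressive polynomial\<close>

text \<open>A nonzero coefficient of positive index would make the zeros of the sum isolated; index
  0 is read off at the centre. Serves to compare coefficients.\<close>

lemma powser_zero_imp_coeff_zero:
  fixes a :: "nat \<Rightarrow> complex"
  assumes "0 < r" "\<And>z. norm z < r \<Longrightarrow> (\<lambda>n. a n * z ^ n) sums 0"
  shows "a m = 0"
proof (cases "m = 0")
  case True
  have "(\<lambda>n. a n * 0 ^ n) sums 0" using assms(2)[of 0] \<open>0 < r\<close> by (simp only: norm_zero)
  moreover have "(\<lambda>n. a n * 0 ^ n) sums a 0" by (rule powser_sums_zero)
  ultimately show ?thesis using True sums_unique2 by blast
next
  case False
  show ?thesis
  proof (rule ccontr)
    assume "a m \<noteq> 0"
    then obtain s where s: "0 < s" "\<And>z. z \<in> cball 0 s - {0::complex} \<Longrightarrow> (\<lambda>_. 0::complex) z \<noteq> 0"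
      using powser_0_nonzero[of r 0 a "\<lambda>_. 0" m] assms False by auto
    have "complex_of_real s \<in> cball 0 s - {0}" using \<open>0 < s\<close> by simp
    from s(2)[OF this] show False by simp
  qed
qed

lemma holomorphic_ar_poly: "ar_poly p \<beta> holomorphic_on A"
  unfolding ar_poly_def by (intro holomorphic_intros)

lemma summable_abs_psi:
  assumes A1: "\<forall>z::complex. cmod z \<le> 1 \<longrightarrow> ar_poly p \<beta> z \<noteq> 0"
    and psi: "\<forall>z::complex. cmod z \<le> 1 \<longrightarrow> (\<lambda>i. complex_of_real (\<psi> i) * z ^ i) sums (1 / ar_poly p \<beta> z)"
  shows "summable (\<lambda>i. \<bar>\<psi> i\<bar>)"
proof -
  have "open {z. ar_poly p \<beta> z \<noteq> 0}"
  proof -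
    have "continuous_on UNIV (ar_poly p \<beta>)"
      by (rule holomorphic_on_imp_continuous_on[OF holomorphic_ar_poly])
    then show ?thesis by (intro open_Collect_neq) auto
  qed
  moreover have "cball 0 1 \<subseteq> {z. ar_poly p \<beta> z \<noteq> 0}" using A1 by auto
  \<comment> \<open>By compactness of the closed unit disc a whole margin of width \<open>d\<close>
    around it is free of zeros.\<close>
  ultimately obtain d where d: "d > 0" "(\<Union>x\<in>cball 0 1. cball x d) \<subseteq> {z. ar_poly p \<beta> z \<noteq> 0}"
    using compact_subset_open_imp_cball_epsilon_subset[OF compact_cball[of 0 1]] by blast
  have nz: "ar_poly p \<beta> z \<noteq> 0" if "z \<in> ball 0 (1 + d)" for z
  proof (cases "norm z \<le> 1")
    case False
    \<comment> \<open>The radial projection of \<open>z\<close> to the unit circle, at distance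
      \<open>norm z - 1 < d\<close> from \<open>z\<close>.\<close>
    define w where "w = z / of_real (norm z)"
    have "z \<noteq> 0" using False by auto
    then have "norm w = 1" by (simp add: w_def norm_divide)
    have "w - z = w * of_real (1 - norm z)" using \<open>z \<noteq> 0\<close> by (auto simp: w_def field_simps)
    then have "norm (w - z) = norm w * \<bar>1 - norm z\<bar>" by (metis norm_mult norm_of_real)
    then have "norm (w - z) = norm z - 1" using \<open>norm w = 1\<close> False by simp
    then have "z \<in> cball w d" using that by (simp add: dist_norm)
    moreover have "w \<in> cball 0 1" using \<open>norm w = 1\<close> by simp
    ultimately show ?thesis using d(2) by blast
  qed (use A1 in auto)
  define g where "g = (\<lambda>z. 1 / ar_poly p \<beta> z)"
  define c where "c = (\<lambda>n. (deriv ^^ n) g 0 / fact n)"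
  have hol: "g holomorphic_on ball 0 (1 + d)"
    unfolding g_def using nz by (intro holomorphic_intros holomorphic_ar_poly) auto
  have c: "(\<lambda>n. c n * z ^ n) sums g z" if "z \<in> ball 0 (1 + d)" for z
    using holomorphic_power_series[OF hol that] by (simp add: c_def)
  have "complex_of_real (\<psi> n) = c n" for n
  proof -
    have "(\<lambda>n. (of_real (\<psi> n) - c n) * z ^ n) sums 0" if "norm z < 1" for z
    proof -
      have "(\<lambda>n. of_real (\<psi> n) * z ^ n - c n * z ^ n) sums (g z - g z)"
        using that d(1) by (intro sums_diff c) (use psi g_def in auto)
      then show ?thesis by (simp add: algebra_simps)
    qed
    from powser_zero_imp_coeff_zero[OF zero_less_one this, of n] show ?thesis by simp
  qed
  \<comment> \<open>The radius \<open>1 + d / 2\<close> lies strictly between 1 and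
    \<open>1 + d\<close>; convergence there forces absolute convergence at 1.\<close>
  moreover have "summable (\<lambda>n. norm (c n * 1 ^ n))"
  proof (rule powser_insidea)
    show "summable (\<lambda>n. c n * of_real (1 + d / 2) ^ n)"
    proof (rule sums_summable[OF c])
      show "complex_of_real (1 + d / 2) \<in> ball 0 (1 + d)"
        unfolding mem_ball_0 norm_of_real using d(1) by simp
    qed
    show "norm (1::complex) < norm (complex_of_real (1 + d / 2))"
      unfolding norm_of_real using d(1) by simp
  qed
  moreover have "norm (c n) = \<bar>\<psi> n\<bar>" for n using calculation(1)[of n] by (metis norm_of_real)
  ultimately show ?thesis by simp
qed

text \<open>The coefficients of the series times \<open>ar_poly\<close> are compared with those of
  1. Restricting to \<open>j \<le> n\<close> keeps the truncated subtraction \<open>n - j\<close> a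
  true difference.\<close>

lemma psi_recursion:
  assumes A1: "\<forall>z::complex. cmod z \<le> 1 \<longrightarrow> ar_poly p \<beta> z \<noteq> 0"
    and psi: "\<forall>z::complex. cmod z \<le> 1 \<longrightarrow> (\<lambda>i. complex_of_real (\<psi> i) * z ^ i) sums (1 / ar_poly p \<beta> z)"
  shows "\<psi> n - (\<Sum>j\<in>{1..p} \<inter> {..n}. \<beta> j * \<psi> (n - j)) = (if n = 0 then 1 else 0)"
proof -
  define a where "a = (\<lambda>n. complex_of_real (\<psi> n - (\<Sum>j\<in>{1..p} \<inter> {..n}. \<beta> j * \<psi> (n - j))) - (if n = 0 then 1 else 0))"
  have "(\<lambda>n. a n * z ^ n) sums 0" if z: "norm z < 1" for z
  proof -
    define s where "s = 1 / ar_poly p \<beta> z"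
    have s: "(\<lambda>n. of_real (\<psi> n) * z ^ n) sums s" using psi z by (auto simp: s_def)
    \<comment> \<open>The series times \<open>z ^ j\<close>, rewritten as a series in the same index
      with zeros in front, so that the lags can be added termwise.\<close>
    have sh: "(\<lambda>n. (if j \<le> n then of_real (\<psi> (n - j)) * z ^ n else 0)) sums (z ^ j * s)" for j
    proof -
      have "(\<lambda>n. z ^ j * (of_real (\<psi> n) * z ^ n)) sums (z ^ j * s)" by (rule sums_mult[OF s])
      then have "(\<lambda>n. (if j \<le> n + j then of_real (\<psi> (n + j - j)) * z ^ (n + j) else 0)) sums (z ^ j * s)"
        by (simp add: power_add mult_ac)
      then show ?thesis by (subst (asm) sums_iff_shift) simp
    qed
    have "(\<lambda>n. of_real (\<psi> n) * z ^ n - (\<Sum>j=1..p. of_real (\<beta> j) *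
        (if j \<le> n then of_real (\<psi> (n - j)) * z ^ n else 0)) - (if n = 0 then 1 else 0))
      sums (s - (\<Sum>j=1..p. of_real (\<beta> j) * (z ^ j * s)) - 1)"
      using sums_single[of 0 "\<lambda>_. 1::complex"]
      by (intro sums_diff s sums_sum sums_mult sh) (simp add: eq_commute)
    moreover have "s - (\<Sum>j=1..p. of_real (\<beta> j) * (z ^ j * s)) - 1 = 0"
    proof -
      have "s - (\<Sum>j=1..p. of_real (\<beta> j) * (z ^ j * s)) = s * ar_poly p \<beta> z"
        by (simp add: ar_poly_def right_diff_distrib sum_distrib_left mult_ac)
      also have "\<dots> = 1" using A1 z by (simp add: s_def)
      finally show ?thesis by simp
    qed
    moreover have "of_real (\<psi> n) * z ^ n - (\<Sum>j=1..p. of_real (\<beta> j) *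
        (if j \<le> n then of_real (\<psi> (n - j)) * z ^ n else 0)) - (if n = 0 then 1 else 0) = a n * z ^ n" for n
    proof -
      have "(\<Sum>j=1..p. of_real (\<beta> j) * (if j \<le> n then of_real (\<psi> (n - j)) * z ^ n else 0))
        = (\<Sum>j\<in>{1..p} \<inter> {..n}. of_real (\<beta> j) * (of_real (\<psi> (n - j)) * z ^ n))"
        by (subst sum.inter_restrict) (auto intro!: sum.cong)
      then show ?thesis
        by (simp add: a_def algebra_simps sum_distrib_right sum_distrib_left)
    qed
    ultimately show ?thesis by simp
  qed
  from powser_zero_imp_coeff_zero[OF zero_less_one this, of n] have "a n = 0" .
  then have "complex_of_real (\<psi> n - (\<Sum>j\<in>{1..p} \<inter> {..n}. \<beta> j * \<psi> (n - j))) = of_real (if n = 0 then 1 else 0)"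
    by (simp add: a_def)
  then show ?thesis by (simp only: of_real_eq_iff)
qed

text \<open>The finite, exact form of the inversion: with all indices \<open>i + j\<close> cut off
  at \<open>n\<close>, the coefficient of \<open>e k\<close> is the left side of the recursion at
  \<open>k\<close>, so only \<open>e 0\<close> survives. It is applied with \<open>e\<close> the
  lagged noise to verify the equation, and with \<open>e\<close> the lagged coordinates of a
  solution to prove uniqueness.\<close>

lemma psi_convolution:
  fixes \<psi> \<beta> :: "nat \<Rightarrow> real" and e :: "nat \<Rightarrow> real"
  assumes rec: "\<And>n. \<psi> n - (\<Sum>j\<in>{1..p} \<inter> {..n}. \<beta> j * \<psi> (n - j)) = (if n = 0 then 1 else 0)"
  shows "(\<Sum>i\<le>n. \<psi> i * e i) - (\<Sum>j=1..p. \<beta> j * (\<Sum>i | i + j \<le> n. \<psi> i * e (i + j))) = e 0"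
proof -
  have inner: "(\<Sum>i | i + j \<le> n. \<psi> i * e (i + j)) = (\<Sum>k\<le>n. if j \<le> k then \<psi> (k - j) * e k else 0)" for j
  proof -
    have "(\<Sum>i | i + j \<le> n. \<psi> i * e (i + j)) = (\<Sum>k\<in>{j..n}. \<psi> (k - j) * e k)"
      by (rule sum.reindex_bij_witness[of _ "\<lambda>k. k - j" "\<lambda>i. i + j"]) auto
    also have "\<dots> = (\<Sum>k\<in>{..n} \<inter> {j..}. \<psi> (k - j) * e k)" by (rule sum.cong) auto
    also have "\<dots> = (\<Sum>k\<le>n. if j \<le> k then \<psi> (k - j) * e k else 0)"
      by (subst sum.inter_restrict) (auto intro!: sum.cong)
    finally show ?thesis .
  qed
  have "(\<Sum>j=1..p. \<beta> j * (\<Sum>i | i + j \<le> n. \<psi> i * e (i + j)))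
      = (\<Sum>k\<le>n. \<Sum>j=1..p. \<beta> j * (if j \<le> k then \<psi> (k - j) * e k else 0))"
    unfolding inner sum_distrib_left by (rule sum.swap)
  also have "\<dots> = (\<Sum>k\<le>n. (\<Sum>j\<in>{1..p} \<inter> {..k}. \<beta> j * \<psi> (k - j)) * e k)"
  proof (rule sum.cong[OF refl])
    fix k
    show "(\<Sum>j=1..p. \<beta> j * (if j \<le> k then \<psi> (k - j) * e k else 0))
      = (\<Sum>j\<in>{1..p} \<inter> {..k}. \<beta> j * \<psi> (k - j)) * e k"
      by (subst sum.inter_restrict) (auto simp: sum_distrib_right intro!: sum.cong)
  qed
  finally have "(\<Sum>i\<le>n. \<psi> i * e i) - (\<Sum>j=1..p. \<beta> j * (\<Sum>i | i + j \<le> n. \<psi> i * e (i + j)))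
      = (\<Sum>k\<le>n. (\<psi> k - (\<Sum>j\<in>{1..p} \<inter> {..k}. \<beta> j * \<psi> (k - j))) * e k)"
    by (simp add: sum_subtractf left_diff_distrib)
  also have "\<dots> = (\<Sum>k\<le>n. if k = 0 then e k else 0)"
    unfolding rec by (intro sum.cong) auto
  also have "\<dots> = e 0" by (simp add: sum.delta)
  finally show ?thesis .
qed

section \<open>The linear process\<close>

lemma suminf_cauchy_schwarz:
  fixes \<psi> a :: "nat \<Rightarrow> real"
  assumes w: "summable (\<lambda>i. \<bar>\<psi> i\<bar>)" and wa: "summable (\<lambda>i. \<bar>\<psi> i\<bar> * (a i)\<^sup>2)"
  shows "summable (\<lambda>i. \<psi> i * a i)"
    "(\<Sum>i. \<psi> i * a i)\<^sup>2 \<le> (\<Sum>i. \<bar>\<psi> i\<bar>) * (\<Sum>i. \<bar>\<psi> i\<bar> * (a i)\<^sup>2)"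
proof -
  show sm: "summable (\<lambda>i. \<psi> i * a i)"
  proof (rule summable_comparison_test'[OF summable_add[OF w wa]])
    fix i
    have "\<bar>a i\<bar> \<le> 1 + (a i)\<^sup>2"
    proof (cases "\<bar>a i\<bar> \<le> 1")
      case False
      then have "\<bar>a i\<bar> \<le> \<bar>a i\<bar>\<^sup>2" by (intro self_le_power) auto
      then show ?thesis by simp
    qed (simp add: add_increasing2)
    then have "\<bar>\<psi> i\<bar> * \<bar>a i\<bar> \<le> \<bar>\<psi> i\<bar> * (1 + (a i)\<^sup>2)" by (rule mult_left_mono) simp
    then show "norm (\<psi> i * a i) \<le> \<bar>\<psi> i\<bar> + \<bar>\<psi> i\<bar> * (a i)\<^sup>2"
      by (simp add: abs_mult distrib_left)
  qed
  have "(\<Sum>i<n. \<psi> i * a i)\<^sup>2 \<le> (\<Sum>i. \<bar>\<psi> i\<bar>) * (\<Sum>i. \<bar>\<psi> i\<bar> * (a i)\<^sup>2)" for n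
  proof -
    \<comment> \<open>Each factor receives a square root of the weight; the sign goes with
      \<open>a i\<close>, where squaring removes it.\<close>
    have "\<psi> i * a i = sqrt \<bar>\<psi> i\<bar> * (sgn (\<psi> i) * sqrt \<bar>\<psi> i\<bar> * a i)" for i
      using real_sqrt_mult_self[of "\<bar>\<psi> i\<bar>"] sgn_mult_abs[of "\<psi> i"]
      by (smt (verit) mult.assoc mult.commute abs_abs)
    then have "(\<Sum>i<n. \<psi> i * a i)\<^sup>2 = (\<Sum>i<n. sqrt \<bar>\<psi> i\<bar> * (sgn (\<psi> i) * sqrt \<bar>\<psi> i\<bar> * a i))\<^sup>2"
      by (simp only:)
    also have "\<dots> \<le> (\<Sum>i<n. (sqrt \<bar>\<psi> i\<bar>)\<^sup>2) * (\<Sum>i<n. (sgn (\<psi> i) * sqrt \<bar>\<psi> i\<bar> * a i)\<^sup>2)"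
      by (rule Cauchy_Schwarz_ineq_sum)
    also have "(\<Sum>i<n. (sgn (\<psi> i) * sqrt \<bar>\<psi> i\<bar> * a i)\<^sup>2) = (\<Sum>i<n. \<bar>\<psi> i\<bar> * (a i)\<^sup>2)"
      by (intro sum.cong) (auto simp: power_mult_distrib sgn_if)
    also have "(\<Sum>i<n. (sqrt \<bar>\<psi> i\<bar>)\<^sup>2) * (\<Sum>i<n. \<bar>\<psi> i\<bar> * (a i)\<^sup>2)
        \<le> (\<Sum>i. \<bar>\<psi> i\<bar>) * (\<Sum>i. \<bar>\<psi> i\<bar> * (a i)\<^sup>2)"
      using w wa by (intro mult_mono) (auto intro!: sum_le_suminf suminf_nonneg sum_nonneg)
    finally show ?thesis .
  qed
  then show "(\<Sum>i. \<psi> i * a i)\<^sup>2 \<le> (\<Sum>i. \<bar>\<psi> i\<bar>) * (\<Sum>i. \<bar>\<psi> i\<bar> * (a i)\<^sup>2)"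
    using tendsto_power[OF summable_LIMSEQ[OF sm], of 2]
    by (intro LIMSEQ_le_const2[of "\<lambda>n. (\<Sum>i<n. \<psi> i * a i)\<^sup>2"]) auto
qed

context w2_space
begin

text \<open>The series is summed pointwise in \<open>u\<close>. Tonelli turns the finite weighted
  energy into summability at almost every \<open>u\<close>; there the weighted Cauchy-Schwarz
  inequality applies and is integrated. On the exceptional null set the value of \<open>v\<close> is
  immaterial.\<close>

lemma L2_series:
  fixes e :: "nat \<Rightarrow> real \<Rightarrow> real"
  assumes e: "\<And>i. e i \<in> L2 f" and w: "summable (\<lambda>i. \<bar>\<psi> i\<bar>)"
    and we: "summable (\<lambda>i. \<bar>\<psi> i\<bar> * (L2norm (e i))\<^sup>2)"
  defines "v \<equiv> (\<lambda>u. \<Sum>i. \<psi> i * e i u)"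
  shows "v \<in> L2 f"
    "(L2norm (\<lambda>u. v u - (\<Sum>i\<le>n. \<psi> i * e i u)))\<^sup>2 \<le> (\<Sum>i. \<bar>\<psi> (i + Suc n)\<bar>) * (\<Sum>i. \<bar>\<psi> i\<bar> * (L2norm (e i))\<^sup>2)"
proof -
  have [measurable]: "e i \<in> borel_measurable borel" for i using e by (rule L2_measurable)
  have vm [measurable]: "v \<in> borel_measurable borel" unfolding v_def by measurable
  let ?Q = "\<Sum>i. \<bar>\<psi> i\<bar> * (L2norm (e i))\<^sup>2"
  let ?A = "\<lambda>n. \<Sum>i. \<bar>\<psi> (i + n)\<bar>"
  have nn: "(\<integral>\<^sup>+u. (\<Sum>i. ennreal (\<bar>\<psi> i\<bar> * (e i u)\<^sup>2)) \<partial>\<mu>) = ennreal ?Q"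
  proof -
    have "(\<integral>\<^sup>+u. (\<Sum>i. ennreal (\<bar>\<psi> i\<bar> * (e i u)\<^sup>2)) \<partial>\<mu>) = (\<Sum>i. \<integral>\<^sup>+u. ennreal (\<bar>\<psi> i\<bar> * (e i u)\<^sup>2) \<partial>\<mu>)"
      by (rule nn_integral_suminf) simp
    also have "\<dots> = (\<Sum>i. ennreal (\<bar>\<psi> i\<bar> * (L2norm (e i))\<^sup>2))"
    proof (intro arg_cong[of _ _ suminf] ext)
      fix i
      have "(\<integral>\<^sup>+u. ennreal (\<bar>\<psi> i\<bar> * (e i u)\<^sup>2) \<partial>\<mu>) = ennreal \<bar>\<psi> i\<bar> * L2sq f (e i)"
        by (simp add: ennreal_mult nn_integral_cmult L2sq_eq_nn_integral)
      then show "(\<integral>\<^sup>+u. ennreal (\<bar>\<psi> i\<bar> * (e i u)\<^sup>2) \<partial>\<mu>) = ennreal (\<bar>\<psi> i\<bar> * (L2norm (e i))\<^sup>2)"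
        using e by (simp add: L2sq_norm ennreal_mult)
    qed
    also have "\<dots> = ennreal ?Q" using we by (intro suminf_ennreal2) auto
    finally show ?thesis .
  qed
  then have "AE u in \<mu>. (\<Sum>i. ennreal (\<bar>\<psi> i\<bar> * (e i u)\<^sup>2)) \<noteq> \<infinity>"
    by (intro nn_integral_PInf_AE) auto
  then have ae: "AE u in \<mu>. summable (\<lambda>i. \<bar>\<psi> i\<bar> * (e i u)\<^sup>2)"
    by eventually_elim (auto intro!: summable_suminf_not_top)
  have bound: "(\<integral>\<^sup>+u. ennreal ((v u - (\<Sum>i<n. \<psi> i * e i u))\<^sup>2) \<partial>\<mu>) \<le> ennreal (?A n * ?Q)" for n
  proof -
    have wn: "summable (\<lambda>i. \<bar>\<psi> (i + n)\<bar>)"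
      using w by (subst summable_iff_shift)
    have "(\<integral>\<^sup>+u. ennreal ((v u - (\<Sum>i<n. \<psi> i * e i u))\<^sup>2) \<partial>\<mu>)
        \<le> (\<integral>\<^sup>+u. ennreal (?A n) * (\<Sum>i. ennreal (\<bar>\<psi> i\<bar> * (e i u)\<^sup>2)) \<partial>\<mu>)"
    proof (rule nn_integral_mono_AE, use ae in eventually_elim)
      case (elim u)
      have sn: "summable (\<lambda>i. \<bar>\<psi> (i + n)\<bar> * (e (i + n) u)\<^sup>2)"
        using elim by (subst summable_iff_shift[where f = "\<lambda>i. \<bar>\<psi> i\<bar> * (e i u)\<^sup>2"])
      have "v u - (\<Sum>i<n. \<psi> i * e i u) = (\<Sum>i. \<psi> (i + n) * e (i + n) u)"
        using suminf_minus_initial_segment[OF suminf_cauchy_schwarz(1)[OF w elim], of n] by (simp add: v_def)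
      then have "(v u - (\<Sum>i<n. \<psi> i * e i u))\<^sup>2 \<le> ?A n * (\<Sum>i. \<bar>\<psi> (i + n)\<bar> * (e (i + n) u)\<^sup>2)"
        using suminf_cauchy_schwarz(2)[OF wn sn] by simp
      also have "\<dots> \<le> ?A n * (\<Sum>i. \<bar>\<psi> i\<bar> * (e i u)\<^sup>2)"
      proof (rule mult_left_mono)
        show "0 \<le> ?A n" using wn by (intro suminf_nonneg) auto
        show "(\<Sum>i. \<bar>\<psi> (i + n)\<bar> * (e (i + n) u)\<^sup>2) \<le> (\<Sum>i. \<bar>\<psi> i\<bar> * (e i u)\<^sup>2)"
          using suminf_split_initial_segment[OF elim, of n] by (simp add: sum_nonneg)
      qed
      finally have "ennreal ((v u - (\<Sum>i<n. \<psi> i * e i u))\<^sup>2) \<le> ennreal (?A n * (\<Sum>i. \<bar>\<psi> i\<bar> * (e i u)\<^sup>2))"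
        by (rule ennreal_leI)
      also have "\<dots> = ennreal (?A n) * (\<Sum>i. ennreal (\<bar>\<psi> i\<bar> * (e i u)\<^sup>2))"
        using wn elim by (subst suminf_ennreal2) (auto intro!: ennreal_mult suminf_nonneg)
      finally show ?case .
    qed
    also have "\<dots> = ennreal (?A n) * ennreal ?Q"
      by (subst nn_integral_cmult) (simp_all add: nn)
    also have "\<dots> = ennreal (?A n * ?Q)"
      using wn we by (intro ennreal_mult[symmetric]) (auto intro!: suminf_nonneg)
    finally show ?thesis .
  qed
  \<comment> \<open>At \<open>n = 0\<close> the partial sum is empty, so the bound concerns
    \<open>v\<close> itself.\<close>
  show vL: "v \<in> L2 f"
    using bound[of 0] by (auto simp: L2_def L2sq_eq_nn_integral intro: le_less_trans)
  have SL: "(\<lambda>u. \<Sum>i\<le>n. \<psi> i * e i u) \<in> L2 f" using e by simp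
  have "ennreal ((L2norm (\<lambda>u. v u - (\<Sum>i\<le>n. \<psi> i * e i u)))\<^sup>2) = L2sq f (\<lambda>u. v u - (\<Sum>i\<le>n. \<psi> i * e i u))"
    using vL SL by (subst L2sq_norm) auto
  \<comment> \<open>The partial sums in the claim include \<open>i = n\<close>, hence the tail
    starts at \<open>Suc n\<close>.\<close>
  also have "\<dots> = (\<integral>\<^sup>+u. ennreal ((v u - (\<Sum>i<Suc n. \<psi> i * e i u))\<^sup>2) \<partial>\<mu>)"
    by (simp add: L2sq_eq_nn_integral lessThan_Suc_atMost)
  also have "\<dots> \<le> ennreal (?A (Suc n) * ?Q)" by (rule bound)
  finally show "(L2norm (\<lambda>u. v u - (\<Sum>i\<le>n. \<psi> i * e i u)))\<^sup>2 \<le> ?A (Suc n) * ?Q"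
    using w we by (subst (asm) ennreal_le_iff)
      (auto intro!: mult_nonneg_nonneg suminf_nonneg simp: summable_iff_shift[where f = "\<lambda>i. \<bar>\<psi> i\<bar>"]
        simp del: add_Suc_right)
qed

lemma L2sq_tendsto_zero_iff:
  assumes "\<And>n. x n \<in> L2 f"
  shows "(\<lambda>n. L2sq f (x n)) \<longlonglongrightarrow> 0 \<longleftrightarrow> (\<lambda>n. L2norm (x n)) \<longlonglongrightarrow> 0"
proof -
  have "(\<lambda>n. L2sq f (x n)) \<longlonglongrightarrow> 0 \<longleftrightarrow> (\<lambda>n. ennreal ((L2norm (x n))\<^sup>2)) \<longlonglongrightarrow> ennreal 0"
    using assms by (simp add: L2sq_norm)
  also have "\<dots> \<longleftrightarrow> (\<lambda>n. (L2norm (x n))\<^sup>2) \<longlonglongrightarrow> 0"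
    by (rule tendsto_ennreal_iff) auto
  also have "\<dots> \<longleftrightarrow> (\<lambda>n. L2norm (x n)) \<longlonglongrightarrow> 0"
    using tendsto_power[of "\<lambda>n. L2norm (x n)" 0 sequentially 2]
      tendsto_real_sqrt[of "\<lambda>n. (L2norm (x n))\<^sup>2" 0 sequentially] by auto
  finally show ?thesis .
qed

lemma L2sq_eq_zero_iff: "x \<in> L2 f \<Longrightarrow> L2sq f x = 0 \<longleftrightarrow> L2norm x = 0"
  by (simp add: L2sq_norm)

end

lemma suminf_tail_tendsto_zero:
  fixes a :: "nat \<Rightarrow> real"
  assumes "summable a"
  shows "(\<lambda>n. \<Sum>i. a (i + n)) \<longlonglongrightarrow> 0"
proof -
  have "(\<lambda>n. suminf a - sum a {..<n}) \<longlonglongrightarrow> suminf a - suminf a"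
    by (intro tendsto_diff tendsto_const summable_LIMSEQ assms)
  then show ?thesis using suminf_minus_initial_segment[OF assms] by simp
qed

lemma (in prob_space) nn_integral_abs_square_le:
  fixes X :: "'a \<Rightarrow> real"
  assumes [measurable]: "X \<in> borel_measurable M"
  shows "(\<integral>\<^sup>+\<omega>. ennreal \<bar>X \<omega>\<bar> \<partial>M)\<^sup>2 \<le> (\<integral>\<^sup>+\<omega>. ennreal ((X \<omega>)\<^sup>2) \<partial>M)"
proof -
  have "(\<integral>\<^sup>+\<omega>. ennreal \<bar>X \<omega>\<bar> * 1 \<partial>M)\<^sup>2 \<le> (\<integral>\<^sup>+\<omega>. (ennreal \<bar>X \<omega>\<bar>)\<^sup>2 \<partial>M) * (\<integral>\<^sup>+\<omega>. 1\<^sup>2 \<partial>M)"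
    by (rule Cauchy_Schwarz_nn_integral) auto
  then show ?thesis by (simp add: emeasure_space_1 ennreal_power)
qed

text \<open>Mean square convergence implies convergence in mean: the squared means tend to 0, so for
  any \<open>c > 0\<close> the means are eventually at most \<open>c\<close>, which excludes a
  positive upper limit.\<close>

lemma (in prob_space) nn_integral_abs_tendsto_zero:
  fixes X :: "nat \<Rightarrow> 'a \<Rightarrow> real"
  assumes "\<And>n. X n \<in> borel_measurable M"
    and "(\<lambda>n. \<integral>\<^sup>+\<omega>. ennreal ((X n \<omega>)\<^sup>2) \<partial>M) \<longlonglongrightarrow> 0"
  shows "(\<lambda>n. \<integral>\<^sup>+\<omega>. ennreal \<bar>X n \<omega>\<bar> \<partial>M) \<longlonglongrightarrow> 0"
proof (rule tendsto_0_if_Limsup_eq_0_ennreal)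
  have sq: "(\<lambda>n. (\<integral>\<^sup>+\<omega>. ennreal \<bar>X n \<omega>\<bar> \<partial>M)\<^sup>2) \<longlonglongrightarrow> 0"
    by (rule tendsto_sandwich[OF _ _ tendsto_const assms(2)])
      (auto intro!: always_eventually nn_integral_abs_square_le assms(1))
  show "limsup (\<lambda>n. \<integral>\<^sup>+\<omega>. ennreal \<bar>X n \<omega>\<bar> \<partial>M) = 0"
  proof (rule ccontr)
    assume "limsup (\<lambda>n. \<integral>\<^sup>+\<omega>. ennreal \<bar>X n \<omega>\<bar> \<partial>M) \<noteq> 0"
    then have "0 < limsup (\<lambda>n. \<integral>\<^sup>+\<omega>. ennreal \<bar>X n \<omega>\<bar> \<partial>M)" by (simp add: zero_less_iff_neq_zero)
    then obtain c where c: "0 < c" "c < limsup (\<lambda>n. \<integral>\<^sup>+\<omega>. ennreal \<bar>X n \<omega>\<bar> \<partial>M)"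
      using dense by blast
    have "\<forall>\<^sub>F n in sequentially. (\<integral>\<^sup>+\<omega>. ennreal \<bar>X n \<omega>\<bar> \<partial>M)\<^sup>2 < c\<^sup>2"
      using sq c by (intro order_tendstoD) (auto simp: zero_less_iff_neq_zero)
    then have "\<forall>\<^sub>F n in sequentially. (\<integral>\<^sup>+\<omega>. ennreal \<bar>X n \<omega>\<bar> \<partial>M) \<le> c"
      by eventually_elim (meson less_imp_le not_le power_mono zero_le)
    then have "limsup (\<lambda>n. \<integral>\<^sup>+\<omega>. ennreal \<bar>X n \<omega>\<bar> \<partial>M) \<le> c" by (rule Limsup_bounded)
    with c show False by simp
  qed
qed

text \<open>The weak form of the noise assumptions: centring and second moment are stated through
  inner products and norms. The pointwise hypotheses are translated into this form by
  \<open>noise_moment_and_mean\<close>.\<close>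

locale war_noise = w2_space f + prob_space M for f and M :: "'a measure" +
  fixes \<epsilon> :: "int \<Rightarrow> 'a \<Rightarrow> real \<Rightarrow> real" and \<psi> :: "nat \<Rightarrow> real"
  assumes eps_meas: "\<epsilon> t \<in> measurable M (L2M f)"
    and eps_indep: "indep_vars (\<lambda>_. L2M f) \<epsilon> UNIV"
    and eps_ident: "distr M (L2M f) (\<epsilon> t) = distr M (L2M f) (\<epsilon> 0)"
    and eps_mean: "h \<in> L2 f \<Longrightarrow> (\<integral>\<omega>. L2inner f (\<epsilon> t \<omega>) h \<partial>M) = 0"
    and eps_moment: "(\<integral>\<^sup>+\<omega>. L2sq f (\<epsilon> 0 \<omega>) \<partial>M) < \<infinity>"
    and psi_summable: "summable (\<lambda>i. \<bar>\<psi> i\<bar>)"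
begin

abbreviation S :: "int \<Rightarrow> nat \<Rightarrow> 'a \<Rightarrow> real \<Rightarrow> real" where
  "S \<equiv> lin_partial \<psi> \<epsilon>"

text \<open>Determines \<open>V\<close> up to null events and null functions, so that everything is
  proved for an arbitrary version of the limit; \<open>series\<close> supplies one.\<close>

definition limit_process :: "(int \<Rightarrow> 'a \<Rightarrow> real \<Rightarrow> real) \<Rightarrow> bool" where
  "limit_process V \<longleftrightarrow> (\<forall>t. V t \<in> measurable M (L2M f)) \<and>
     (\<forall>t. AE \<omega> in M. (\<lambda>n. L2sq f (\<lambda>u. V t \<omega> u - S t n \<omega> u)) \<longlonglongrightarrow> 0)"

text \<open>One integrable random variable that dominates the squared remainders for every
  \<open>n\<close>, up to the deterministic factor \<open>psi_tail n\<close>. It takes values in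
  \<open>ennreal\<close> since it may be infinite on a null event.\<close>

definition weighted_energy :: "int \<Rightarrow> 'a \<Rightarrow> ennreal" where
  "weighted_energy t \<omega> = (\<Sum>i. ennreal \<bar>\<psi> i\<bar> * L2sq f (\<epsilon> (t - int i) \<omega>))"

definition psi_tail :: "nat \<Rightarrow> real" where
  "psi_tail n = (\<Sum>i. \<bar>\<psi> (i + Suc n)\<bar>)"

lemma eps_L2 [simp]: "\<omega> \<in> space M \<Longrightarrow> \<epsilon> t \<omega> \<in> L2 f"
  by (rule measurable_L2M_L2[OF eps_meas])

lemma S_eq: "S t n \<omega> = (\<lambda>u. \<Sum>i\<le>n. \<psi> i * \<epsilon> (t - int i) \<omega> u)"
  by (simp add: lin_partial_def fun_eq_iff)

lemma S_meas: "S t n \<in> measurable M (L2M f)"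
proof -
  have "(\<lambda>\<omega> u. \<Sum>i\<le>n. \<psi> i * \<epsilon> (t - int i) \<omega> u) \<in> measurable M (L2M f)"
    by (intro measurable_L2M_sum measurable_L2M_cmult eps_meas)
  then show ?thesis by (simp add: S_eq[abs_def])
qed

lemma S_L2 [simp]: "\<omega> \<in> space M \<Longrightarrow> S t n \<omega> \<in> L2 f"
  by (rule measurable_L2M_L2[OF S_meas])

lemma limit_process_meas: "limit_process V \<Longrightarrow> V t \<in> measurable M (L2M f)"
  by (simp add: limit_process_def)

lemma limit_process_L2: "limit_process V \<Longrightarrow> \<omega> \<in> space M \<Longrightarrow> V t \<omega> \<in> L2 f"
  by (rule measurable_L2M_L2[OF limit_process_meas])

lemma limit_process_tendsto:
  assumes "limit_process V"
  shows "AE \<omega> in M. (\<lambda>n. L2norm (\<lambda>u. V t \<omega> u - S t n \<omega> u)) \<longlonglongrightarrow> 0"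
proof -
  have "AE \<omega> in M. (\<lambda>n. L2sq f (\<lambda>u. V t \<omega> u - S t n \<omega> u)) \<longlonglongrightarrow> 0"
    using assms by (simp add: limit_process_def)
  with AE_space show ?thesis
  proof eventually_elim
    case (elim \<omega>)
    then show ?case
      using limit_process_L2[OF assms] by (subst L2sq_tendsto_zero_iff[symmetric]) auto
  qed
qed

lemma psi_tail_nonneg: "0 \<le> psi_tail n"
  unfolding psi_tail_def using psi_summable
  by (intro suminf_nonneg) (auto simp: summable_iff_shift[where f = "\<lambda>i. \<bar>\<psi> i\<bar>"] simp del: add_Suc_right)

lemma psi_tail_tendsto: "psi_tail \<longlonglongrightarrow> 0"
  unfolding psi_tail_def using LIMSEQ_Suc[OF suminf_tail_tendsto_zero[OF psi_summable]] .

lemma eps_moment_eq: "(\<integral>\<^sup>+\<omega>. L2sq f (\<epsilon> t \<omega>) \<partial>M) = (\<integral>\<^sup>+\<omega>. L2sq f (\<epsilon> 0 \<omega>) \<partial>M)"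
proof -
  have "(\<integral>\<^sup>+\<omega>. L2sq f (\<epsilon> s \<omega>) \<partial>M) = (\<integral>\<^sup>+x. L2sq f x \<partial>distr M (L2M f) (\<epsilon> s))" for s
    by (rule nn_integral_distr[symmetric, OF eps_meas]) (simp add: measurable_L2sq)
  then show ?thesis using eps_ident[of t] by simp
qed

lemma measurable_L2sq_comp:
  "X \<in> measurable N (L2M f) \<Longrightarrow> (\<lambda>\<omega>. L2sq f (X \<omega>)) \<in> borel_measurable N"
  by (rule measurable_compose[OF _ measurable_L2sq])

lemma weighted_energy_meas [measurable]: "weighted_energy t \<in> borel_measurable M"
  unfolding weighted_energy_def[abs_def] using measurable_L2sq_comp[OF eps_meas] by measurable

lemma weighted_energy_moment: "(\<integral>\<^sup>+\<omega>. weighted_energy t \<omega> \<partial>M) < \<infinity>"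
proof -
  have [measurable]: "(\<lambda>\<omega>. L2sq f (\<epsilon> s \<omega>)) \<in> borel_measurable M" for s
    by (rule measurable_L2sq_comp[OF eps_meas])
  have "(\<integral>\<^sup>+\<omega>. weighted_energy t \<omega> \<partial>M) = (\<Sum>i. \<integral>\<^sup>+\<omega>. ennreal \<bar>\<psi> i\<bar> * L2sq f (\<epsilon> (t - int i) \<omega>) \<partial>M)"
    unfolding weighted_energy_def by (rule nn_integral_suminf) simp
  also have "\<dots> = (\<Sum>i. ennreal \<bar>\<psi> i\<bar> * (\<integral>\<^sup>+\<omega>. L2sq f (\<epsilon> 0 \<omega>) \<partial>M))"
    by (intro arg_cong[of _ _ suminf] ext) (simp add: nn_integral_cmult eps_moment_eq[of "t - int _"])
  also have "\<dots> = (\<Sum>i. ennreal \<bar>\<psi> i\<bar>) * (\<integral>\<^sup>+\<omega>. L2sq f (\<epsilon> 0 \<omega>) \<partial>M)"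
    by (rule ennreal_suminf_multc)
  also have "(\<Sum>i. ennreal \<bar>\<psi> i\<bar>) = ennreal (\<Sum>i. \<bar>\<psi> i\<bar>)"
    using psi_summable by (intro suminf_ennreal2) auto
  finally show ?thesis using eps_moment by (simp add: ennreal_mult_less_top)
qed

lemma weighted_energy_summable:
  assumes "\<omega> \<in> space M" "weighted_energy t \<omega> < \<infinity>"
  shows "summable (\<lambda>i. \<bar>\<psi> i\<bar> * (L2norm (\<epsilon> (t - int i) \<omega>))\<^sup>2)"
    "weighted_energy t \<omega> = ennreal (\<Sum>i. \<bar>\<psi> i\<bar> * (L2norm (\<epsilon> (t - int i) \<omega>))\<^sup>2)"
proof -
  have eq: "weighted_energy t \<omega> = (\<Sum>i. ennreal (\<bar>\<psi> i\<bar> * (L2norm (\<epsilon> (t - int i) \<omega>))\<^sup>2))"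
    using assms(1) by (simp add: weighted_energy_def L2sq_norm ennreal_mult)
  then show s: "summable (\<lambda>i. \<bar>\<psi> i\<bar> * (L2norm (\<epsilon> (t - int i) \<omega>))\<^sup>2)"
    using assms(2) by (intro summable_suminf_not_top) auto
  show "weighted_energy t \<omega> = ennreal (\<Sum>i. \<bar>\<psi> i\<bar> * (L2norm (\<epsilon> (t - int i) \<omega>))\<^sup>2)"
    unfolding eq using s by (intro suminf_ennreal2) auto
qed

lemma weighted_energy_AE: "AE \<omega> in M. weighted_energy t \<omega> < \<infinity>"
  using nn_integral_PInf_AE[OF weighted_energy_meas, of t] weighted_energy_moment[of t]
  by (auto simp: less_top)

text \<open>Set to zero where the energy is infinite, so that every outcome, and not only almost
  every one, gives an element of \<open>L2 f\<close>, as \<open>random_tangent\<close>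
  demands.\<close>

definition series :: "int \<Rightarrow> 'a \<Rightarrow> real \<Rightarrow> real" where
  "series t \<omega> = (if weighted_energy t \<omega> < \<infinity> then (\<lambda>u. \<Sum>i. \<psi> i * \<epsilon> (t - int i) \<omega> u) else (\<lambda>u. 0))"

lemma series_L2: "\<omega> \<in> space M \<Longrightarrow> series t \<omega> \<in> L2 f"
  unfolding series_def
  by (auto intro!: L2_series(1) psi_summable weighted_energy_summable)

lemma series_bound:
  assumes "\<omega> \<in> space M" "weighted_energy t \<omega> < \<infinity>"
  shows "L2sq f (\<lambda>u. series t \<omega> u - S t n \<omega> u) \<le> ennreal (psi_tail n) * weighted_energy t \<omega>"
proof -
  have "(L2norm (\<lambda>u. series t \<omega> u - S t n \<omega> u))\<^sup>2
      \<le> psi_tail n * (\<Sum>i. \<bar>\<psi> i\<bar> * (L2norm (\<epsilon> (t - int i) \<omega>))\<^sup>2)"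
    using L2_series(2)[of "\<lambda>i. \<epsilon> (t - int i) \<omega>" \<psi> n, OF _ psi_summable weighted_energy_summable(1)[OF assms]] assms
    by (simp add: series_def S_eq psi_tail_def)
  then show ?thesis
    using assms series_L2[OF assms(1), of t] psi_tail_nonneg[of n]
    by (simp add: L2sq_norm weighted_energy_summable(2)[OF assms] ennreal_leI flip: ennreal_mult')
qed

lemma series_tendsto:
  assumes "\<omega> \<in> space M" "weighted_energy t \<omega> < \<infinity>"
  shows "(\<lambda>n. L2sq f (\<lambda>u. series t \<omega> u - S t n \<omega> u)) \<longlonglongrightarrow> 0"
proof (rule tendsto_sandwich[OF _ _ tendsto_const])
  have "(\<lambda>n. weighted_energy t \<omega> * ennreal (psi_tail n)) \<longlonglongrightarrow> weighted_energy t \<omega> * ennreal 0"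
    using psi_tail_tendsto assms(2) by (intro ennreal_tendsto_cmult tendsto_ennrealI) auto
  then show "(\<lambda>n. ennreal (psi_tail n) * weighted_energy t \<omega>) \<longlonglongrightarrow> 0" by (simp add: mult.commute)
qed (use series_bound[OF assms] in auto)

lemma L2inner_tendsto:
  assumes "x \<in> L2 f" "\<And>n. y n \<in> L2 f" "(\<lambda>n. L2norm (\<lambda>u. x u - y n u)) \<longlonglongrightarrow> 0" "h \<in> L2 f"
  shows "(\<lambda>n. L2inner f (y n) h) \<longlonglongrightarrow> L2inner f x h"
proof -
  have "(\<lambda>n. L2inner f x h - L2inner f (y n) h) \<longlonglongrightarrow> 0"
  proof (rule tendsto_0_le[OF assms(3), of _ "L2norm h"])
    have "\<bar>L2inner f x h - L2inner f (y n) h\<bar> \<le> L2norm (\<lambda>u. x u - y n u) * L2norm h" for n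
      using L2_cauchy_schwarz[of "\<lambda>u. x u - y n u" h] assms by (simp add: L2inner_diff_left)
    then show "\<forall>\<^sub>F n in sequentially. norm (L2inner f x h - L2inner f (y n) h)
        \<le> norm (L2norm (\<lambda>u. x u - y n u)) * L2norm h"
      by simp
  qed
  from tendsto_diff[OF tendsto_const[of "L2inner f x h"] this] show ?thesis by simp
qed

lemma series_meas: "series t \<in> measurable M (L2M f)"
proof (rule measurable_L2M_I)
  fix h assume h: "h \<in> L2 f"
  have [measurable]: "(\<lambda>\<omega>. L2inner f (S t n \<omega>) h) \<in> borel_measurable M" for n
    by (rule measurable_L2inner_comp[OF S_meas h])
  show "(\<lambda>\<omega>. L2inner f (series t \<omega>) h) \<in> borel_measurable M"
  \<comment> \<open>The approximants carry the case distinction of \<open>series\<close>, so that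
    they converge at every outcome.\<close>
  proof (rule borel_measurable_LIMSEQ_real)
    fix \<omega> assume \<omega>: "\<omega> \<in> space M"
    show "(\<lambda>n. if weighted_energy t \<omega> < \<infinity> then L2inner f (S t n \<omega>) h else 0) \<longlonglongrightarrow> L2inner f (series t \<omega>) h"
    proof (cases "weighted_energy t \<omega> < \<infinity>")
      case True
      have "(\<lambda>n. L2norm (\<lambda>u. series t \<omega> u - S t n \<omega> u)) \<longlonglongrightarrow> 0"
        using series_tendsto[OF \<omega> True] \<omega> series_L2[OF \<omega>] by (subst (asm) L2sq_tendsto_zero_iff) auto
      then show ?thesis
        using True \<omega> h series_L2[OF \<omega>] by (simp add: L2inner_tendsto)
    qed (simp add: series_def L2inner_def)
  qed measurable
qed (rule series_L2)

lemma limit_process_series: "limit_process series"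
  unfolding limit_process_def
proof (intro conjI allI)
  fix t
  show "AE \<omega> in M. (\<lambda>n. L2sq f (\<lambda>u. series t \<omega> u - S t n \<omega> u)) \<longlonglongrightarrow> 0"
    using weighted_energy_AE[of t] AE_space by eventually_elim (rule series_tendsto)
qed (rule series_meas)

lemma L2norm_limit_unique:
  assumes "x \<in> L2 f" "y \<in> L2 f" "\<And>n. z n \<in> L2 f"
    and "(\<lambda>n. L2norm (\<lambda>u. x u - z n u)) \<longlonglongrightarrow> 0" "(\<lambda>n. L2norm (\<lambda>u. y u - z n u)) \<longlonglongrightarrow> 0"
  shows "L2norm (\<lambda>u. x u - y u) = 0"
proof -
  have "L2norm (\<lambda>u. x u - y u) \<le> L2norm (\<lambda>u. x u - z n u) + L2norm (\<lambda>u. y u - z n u)" for n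
    using L2norm_diff_triangle[of x "z n" y] L2norm_minus_commute[of y "z n"] assms by simp
  moreover have "(\<lambda>n. L2norm (\<lambda>u. x u - z n u) + L2norm (\<lambda>u. y u - z n u)) \<longlonglongrightarrow> 0 + 0"
    by (intro tendsto_add assms)
  ultimately have "L2norm (\<lambda>u. x u - y u) \<le> 0"
    by (intro LIMSEQ_le_const) auto
  then show ?thesis using L2norm_nonneg[of "\<lambda>u. x u - y u"] by linarith
qed

text \<open>Any version has the same partial sums as \<open>series\<close> and hence distance zero
  from it almost surely, so it inherits the remainder bound.\<close>

lemma limit_process_bound:
  assumes V: "limit_process V"
  shows "AE \<omega> in M. \<forall>n. L2sq f (\<lambda>u. V t \<omega> u - S t n \<omega> u) \<le> ennreal (psi_tail n) * weighted_energy t \<omega>"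
  using limit_process_tendsto[OF V, of t] limit_process_tendsto[OF limit_process_series, of t]
    weighted_energy_AE[of t] AE_space
proof eventually_elim
  case (elim \<omega>)
  note L = limit_process_L2[OF V elim(4), of t] series_L2[OF elim(4), of t] S_L2[OF elim(4), of t]
  have 0: "L2norm (\<lambda>u. V t \<omega> u - series t \<omega> u) = 0"
    by (rule L2norm_limit_unique[OF L elim(1,2)])
  show ?case
  proof
    fix n
    have "L2norm (\<lambda>u. V t \<omega> u - S t n \<omega> u) \<le> L2norm (\<lambda>u. series t \<omega> u - S t n \<omega> u)"
      using L2norm_diff_triangle[OF L, of n] 0 by simp
    then have "L2sq f (\<lambda>u. V t \<omega> u - S t n \<omega> u) \<le> L2sq f (\<lambda>u. series t \<omega> u - S t n \<omega> u)"
      using L by (simp add: L2sq_norm ennreal_leI power_mono)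
    also have "\<dots> \<le> ennreal (psi_tail n) * weighted_energy t \<omega>"
      by (rule series_bound[OF elim(4,3)])
    finally show "L2sq f (\<lambda>u. V t \<omega> u - S t n \<omega> u) \<le> ennreal (psi_tail n) * weighted_energy t \<omega>" .
  qed
qed

lemma limit_process_mean_square:
  assumes V: "limit_process V"
  shows "(\<lambda>n. \<integral>\<^sup>+\<omega>. L2sq f (\<lambda>u. V t \<omega> u - S t n \<omega> u) \<partial>M) \<longlonglongrightarrow> 0"
proof (rule tendsto_sandwich[OF _ _ tendsto_const])
  let ?E = "\<integral>\<^sup>+\<omega>. weighted_energy t \<omega> \<partial>M"
  have "(\<lambda>n. ?E * ennreal (psi_tail n)) \<longlonglongrightarrow> ?E * ennreal 0"
    using psi_tail_tendsto weighted_energy_moment[of t] by (intro ennreal_tendsto_cmult tendsto_ennrealI) auto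
  then show "(\<lambda>n. ennreal (psi_tail n) * ?E) \<longlonglongrightarrow> 0" by (simp add: mult.commute)
  have "(\<integral>\<^sup>+\<omega>. L2sq f (\<lambda>u. V t \<omega> u - S t n \<omega> u) \<partial>M) \<le> ennreal (psi_tail n) * ?E" for n
  proof -
    have "(\<integral>\<^sup>+\<omega>. L2sq f (\<lambda>u. V t \<omega> u - S t n \<omega> u) \<partial>M) \<le> (\<integral>\<^sup>+\<omega>. ennreal (psi_tail n) * weighted_energy t \<omega> \<partial>M)"
      using limit_process_bound[OF V, of t] by (intro nn_integral_mono_AE) auto
    then show ?thesis by (simp add: nn_integral_cmult)
  qed
  then show "\<forall>\<^sub>F n in sequentially. (\<integral>\<^sup>+\<omega>. L2sq f (\<lambda>u. V t \<omega> u - S t n \<omega> u) \<partial>M) \<le> ennreal (psi_tail n) * ?E"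
    by simp
qed simp

lemma nn_integral_L2inner_square_le:
  assumes "X \<in> measurable M (L2M f)" "h \<in> L2 f"
  shows "(\<integral>\<^sup>+\<omega>. ennreal ((L2inner f (X \<omega>) h)\<^sup>2) \<partial>M) \<le> ennreal ((L2norm h)\<^sup>2) * (\<integral>\<^sup>+\<omega>. L2sq f (X \<omega>) \<partial>M)"
proof -
  have "(\<integral>\<^sup>+\<omega>. ennreal ((L2inner f (X \<omega>) h)\<^sup>2) \<partial>M) \<le> (\<integral>\<^sup>+\<omega>. ennreal ((L2norm h)\<^sup>2) * L2sq f (X \<omega>) \<partial>M)"
  proof (rule nn_integral_mono)
    fix \<omega> assume "\<omega> \<in> space M"
    then have X: "X \<omega> \<in> L2 f" by (rule measurable_L2M_L2[OF assms(1)])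
    have "\<bar>L2inner f (X \<omega>) h\<bar>\<^sup>2 \<le> (L2norm (X \<omega>) * L2norm h)\<^sup>2"
      by (intro power_mono L2_cauchy_schwarz X assms) simp
    then show "ennreal ((L2inner f (X \<omega>) h)\<^sup>2) \<le> ennreal ((L2norm h)\<^sup>2) * L2sq f (X \<omega>)"
      using X by (simp add: L2sq_norm power_mult_distrib mult.commute ennreal_leI flip: ennreal_mult')
  qed
  also have "\<dots> = ennreal ((L2norm h)\<^sup>2) * (\<integral>\<^sup>+\<omega>. L2sq f (X \<omega>) \<partial>M)"
    by (rule nn_integral_cmult[OF measurable_L2sq_comp[OF assms(1)]])
  finally show ?thesis .
qed

lemma limit_process_L2inner_tendsto:
  assumes V: "limit_process V" and h: "h \<in> L2 f"
  shows "(\<lambda>n. \<integral>\<^sup>+\<omega>. ennreal \<bar>L2inner f (V t \<omega>) h - L2inner f (S t n \<omega>) h\<bar> \<partial>M) \<longlonglongrightarrow> 0"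
proof (rule nn_integral_abs_tendsto_zero)
  show "(\<lambda>\<omega>. L2inner f (V t \<omega>) h - L2inner f (S t n \<omega>) h) \<in> borel_measurable M" for n
    by (intro borel_measurable_diff measurable_L2inner_comp limit_process_meas V S_meas h)
  let ?E = "\<lambda>n. \<integral>\<^sup>+\<omega>. L2sq f (\<lambda>u. V t \<omega> u - S t n \<omega> u) \<partial>M"
  show "(\<lambda>n. \<integral>\<^sup>+\<omega>. ennreal ((L2inner f (V t \<omega>) h - L2inner f (S t n \<omega>) h)\<^sup>2) \<partial>M) \<longlonglongrightarrow> 0"
  proof (rule tendsto_sandwich[OF _ _ tendsto_const])
    have "(\<lambda>n. ennreal ((L2norm h)\<^sup>2) * ?E n) \<longlonglongrightarrow> ennreal ((L2norm h)\<^sup>2) * 0"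
      by (intro ennreal_tendsto_cmult limit_process_mean_square V) simp
    then show "(\<lambda>n. ennreal ((L2norm h)\<^sup>2) * ?E n) \<longlonglongrightarrow> 0" by simp
    have "(\<integral>\<^sup>+\<omega>. ennreal ((L2inner f (V t \<omega>) h - L2inner f (S t n \<omega>) h)\<^sup>2) \<partial>M) \<le> ennreal ((L2norm h)\<^sup>2) * ?E n" for n
    proof -
      have "(\<integral>\<^sup>+\<omega>. ennreal ((L2inner f (V t \<omega>) h - L2inner f (S t n \<omega>) h)\<^sup>2) \<partial>M)
        = (\<integral>\<^sup>+\<omega>. ennreal ((L2inner f (\<lambda>u. V t \<omega> u - S t n \<omega> u) h)\<^sup>2) \<partial>M)"
        using h by (intro nn_integral_cong) (simp add: L2inner_diff_left limit_process_L2[OF V])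
      also have "\<dots> \<le> ennreal ((L2norm h)\<^sup>2) * ?E n"
        by (intro nn_integral_L2inner_square_le measurable_L2M_diff limit_process_meas V S_meas h)
      finally show ?thesis .
    qed
    then show "\<forall>\<^sub>F n in sequentially. (\<integral>\<^sup>+\<omega>. ennreal ((L2inner f (V t \<omega>) h - L2inner f (S t n \<omega>) h)\<^sup>2) \<partial>M)
        \<le> ennreal ((L2norm h)\<^sup>2) * ?E n" by simp
  qed simp
qed

lemma L2sq_add_le:
  assumes "x \<in> L2 f" "y \<in> L2 f"
  shows "L2sq f (\<lambda>u. x u + y u) \<le> 2 * L2sq f x + 2 * L2sq f y"
proof -
  have "(L2norm (\<lambda>u. x u + y u))\<^sup>2 \<le> (L2norm x + L2norm y)\<^sup>2"
    by (intro power_mono L2norm_add_le assms) simp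
  also have "\<dots> \<le> 2 * (L2norm x)\<^sup>2 + 2 * (L2norm y)\<^sup>2"
    using sum_squares_bound[of "L2norm x" "L2norm y"] by (simp add: power2_sum)
  finally have "ennreal ((L2norm (\<lambda>u. x u + y u))\<^sup>2) \<le> ennreal (2 * (L2norm x)\<^sup>2 + 2 * (L2norm y)\<^sup>2)"
    by (rule ennreal_leI)
  then show ?thesis using assms by (simp add: L2sq_norm ennreal_mult)
qed

text \<open>\<open>V t\<close> is split into \<open>S t 0\<close>, a multiple of a single noise
  term, and a remainder controlled by the energy.\<close>

lemma limit_process_moment:
  assumes V: "limit_process V"
  shows "(\<integral>\<^sup>+\<omega>. L2sq f (V t \<omega>) \<partial>M) < \<infinity>"
proof -
  let ?D = "\<lambda>\<omega> u. V t \<omega> u - S t 0 \<omega> u"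
  have Dm: "?D \<in> measurable M (L2M f)"
    by (intro measurable_L2M_diff limit_process_meas V S_meas)
  have "L2sq f (S t 0 \<omega>) = ennreal ((\<psi> 0)\<^sup>2) * L2sq f (\<epsilon> t \<omega>)" if "\<omega> \<in> space M" for \<omega>
    using that by (simp add: S_eq L2sq_norm L2norm_cmult power_mult_distrib ennreal_mult')
  then have "(\<integral>\<^sup>+\<omega>. L2sq f (S t 0 \<omega>) \<partial>M) = (\<integral>\<^sup>+\<omega>. ennreal ((\<psi> 0)\<^sup>2) * L2sq f (\<epsilon> t \<omega>) \<partial>M)"
    by (intro nn_integral_cong) simp
  also have "\<dots> < \<infinity>"
    using eps_moment
    by (simp add: nn_integral_cmult measurable_L2sq_comp[OF eps_meas] eps_moment_eq[of t] ennreal_mult_less_top)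
  finally have fS: "(\<integral>\<^sup>+\<omega>. L2sq f (S t 0 \<omega>) \<partial>M) < \<infinity>" .
  have "(\<integral>\<^sup>+\<omega>. L2sq f (?D \<omega>) \<partial>M) \<le> (\<integral>\<^sup>+\<omega>. ennreal (psi_tail 0) * weighted_energy t \<omega> \<partial>M)"
    using limit_process_bound[OF V, of t] by (intro nn_integral_mono_AE) auto
  also have "\<dots> < \<infinity>"
    using weighted_energy_moment[of t] by (simp add: nn_integral_cmult ennreal_mult_less_top)
  finally have fD: "(\<integral>\<^sup>+\<omega>. L2sq f (?D \<omega>) \<partial>M) < \<infinity>" .
  have "(\<integral>\<^sup>+\<omega>. L2sq f (V t \<omega>) \<partial>M) \<le> (\<integral>\<^sup>+\<omega>. 2 * L2sq f (?D \<omega>) + 2 * L2sq f (S t 0 \<omega>) \<partial>M)"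
  proof (rule nn_integral_mono)
    fix \<omega> assume "\<omega> \<in> space M"
    then show "L2sq f (V t \<omega>) \<le> 2 * L2sq f (?D \<omega>) + 2 * L2sq f (S t 0 \<omega>)"
      using L2sq_add_le[of "?D \<omega>" "S t 0 \<omega>"] limit_process_L2[OF V] by simp
  qed
  also have "\<dots> = 2 * (\<integral>\<^sup>+\<omega>. L2sq f (?D \<omega>) \<partial>M) + 2 * (\<integral>\<^sup>+\<omega>. L2sq f (S t 0 \<omega>) \<partial>M)"
    using measurable_L2sq_comp[OF Dm] measurable_L2sq_comp[OF S_meas[of t 0]]
    by (simp add: nn_integral_add nn_integral_cmult)
  also have "\<dots> < \<infinity>" using fS fD by (simp add: ennreal_mult_less_top)
  finally show ?thesis .
qed

lemma integrable_L2inner: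
  assumes X: "X \<in> measurable M (L2M f)" and "h \<in> L2 f" and fin: "(\<integral>\<^sup>+\<omega>. L2sq f (X \<omega>) \<partial>M) < \<infinity>"
  shows "integrable M (\<lambda>\<omega>. L2inner f (X \<omega>) h)" "integrable M (\<lambda>\<omega>. (L2inner f (X \<omega>) h)\<^sup>2)"
proof -
  have m [measurable]: "(\<lambda>\<omega>. L2inner f (X \<omega>) h) \<in> borel_measurable M"
    by (rule measurable_L2inner_comp[OF X \<open>h \<in> L2 f\<close>])
  have "(\<integral>\<^sup>+\<omega>. ennreal ((L2inner f (X \<omega>) h)\<^sup>2) \<partial>M) < \<infinity>"
    using nn_integral_L2inner_square_le[OF X \<open>h \<in> L2 f\<close>] fin
    by (auto simp: ennreal_mult_less_top intro: le_less_trans)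
  then show "integrable M (\<lambda>\<omega>. (L2inner f (X \<omega>) h)\<^sup>2)"
    by (subst integrable_iff_bounded) simp
  then show "integrable M (\<lambda>\<omega>. L2inner f (X \<omega>) h)"
    by (rule square_integrable_imp_integrable[OF m])
qed

text \<open>The partial sums are centred term by term, and convergence in mean of the coordinates
  carries this to the limit.\<close>

lemma limit_process_mean:
  assumes V: "limit_process V" and h: "h \<in> L2 f"
  shows "(\<integral>\<omega>. L2inner f (V t \<omega>) h \<partial>M) = 0"
proof -
  have ie: "integrable M (\<lambda>\<omega>. L2inner f (\<epsilon> s \<omega>) h)" for s
    using eps_moment by (intro integrable_L2inner eps_meas h) (simp add: eps_moment_eq[of s])
  have iV: "integrable M (\<lambda>\<omega>. L2inner f (V t \<omega>) h)"
    by (intro integrable_L2inner limit_process_meas V h limit_process_moment)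
  have SS: "L2inner f (S t n \<omega>) h = (\<Sum>i\<le>n. \<psi> i * L2inner f (\<epsilon> (t - int i) \<omega>) h)" if "\<omega> \<in> space M" for n \<omega>
    using that h by (simp add: S_eq L2inner_sum_left L2inner_cmult_left)
  have iS: "integrable M (\<lambda>\<omega>. L2inner f (S t n \<omega>) h)" for n
    using ie by (subst Bochner_Integration.integrable_cong[OF refl SS]) auto
  have mS: "(\<integral>\<omega>. L2inner f (S t n \<omega>) h \<partial>M) = 0" for n
    using ie by (subst Bochner_Integration.integral_cong[OF refl SS]) (auto simp: eps_mean[OF h])
  have "\<bar>\<integral>\<omega>. L2inner f (V t \<omega>) h \<partial>M\<bar> \<le> enn2real (\<integral>\<^sup>+\<omega>. ennreal \<bar>L2inner f (V t \<omega>) h - L2inner f (S t n \<omega>) h\<bar> \<partial>M)" for n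
  proof -
    have "\<bar>\<integral>\<omega>. L2inner f (V t \<omega>) h \<partial>M\<bar> = \<bar>\<integral>\<omega>. L2inner f (V t \<omega>) h - L2inner f (S t n \<omega>) h \<partial>M\<bar>"
      using iV iS mS by simp
    also have "\<dots> \<le> (\<integral>\<omega>. \<bar>L2inner f (V t \<omega>) h - L2inner f (S t n \<omega>) h\<bar> \<partial>M)"
      by (rule integral_abs_bound)
    also have "\<dots> = enn2real (\<integral>\<^sup>+\<omega>. ennreal \<bar>L2inner f (V t \<omega>) h - L2inner f (S t n \<omega>) h\<bar> \<partial>M)"
      using borel_measurable_integrable[OF iV] borel_measurable_integrable[OF iS[of n]]
      by (intro integral_eq_nn_integral) auto
    finally show ?thesis .
  qed
  moreover have "(\<lambda>n. enn2real (\<integral>\<^sup>+\<omega>. ennreal \<bar>L2inner f (V t \<omega>) h - L2inner f (S t n \<omega>) h\<bar> \<partial>M)) \<longlonglongrightarrow> enn2real 0"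
    by (rule tendsto_enn2real[OF _ _]) (use limit_process_L2inner_tendsto[OF V h, of t] in auto)
  ultimately have "\<bar>\<integral>\<omega>. L2inner f (V t \<omega>) h \<partial>M\<bar> \<le> 0"
    by (intro LIMSEQ_le_const) auto
  then show ?thesis by simp
qed

end

section \<open>Solution property and strict stationarity\<close>

lemma (in w2_space) L2norm_sum_le:
  assumes "\<And>i. i \<in> I \<Longrightarrow> x i \<in> L2 f"
  shows "L2norm (\<lambda>u. \<Sum>i\<in>I. x i u) \<le> (\<Sum>i\<in>I. L2norm (x i))"
  using assms
proof (induction I rule: infinite_finite_induct)
  case (insert i I)
  have "L2norm (\<lambda>u. x i u + (\<Sum>i\<in>I. x i u)) \<le> L2norm (x i) + L2norm (\<lambda>u. \<Sum>i\<in>I. x i u)"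
    using insert by (intro L2norm_add_le) auto
  then show ?case using insert by simp
qed (simp_all add: L2norm_def L2inner_def)

context war_noise
begin

lemma limit_process_solves:
  assumes rec: "\<And>n. \<psi> n - (\<Sum>j\<in>{1..p} \<inter> {..n}. \<beta> j * \<psi> (n - j)) = (if n = 0 then 1 else 0)"
    and V: "limit_process V"
  shows "AE \<omega> in M. L2norm (\<lambda>u. V t \<omega> u - (\<Sum>j=1..p. \<beta> j * V (t - int j) \<omega> u) - \<epsilon> t \<omega> u) = 0"
proof -
  have "AE \<omega> in M. \<forall>s. (\<lambda>n. L2norm (\<lambda>u. V s \<omega> u - S s n \<omega> u)) \<longlonglongrightarrow> 0"
    unfolding AE_all_countable using limit_process_tendsto[OF V] by blast
  with AE_space show ?thesis
  proof eventually_elim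
    case (elim \<omega>)
    note VL = limit_process_L2[OF V elim(1)]
    let ?d = "\<lambda>s n u. V s \<omega> u - S s n \<omega> u"
    let ?x = "\<lambda>u. V t \<omega> u - (\<Sum>j=1..p. \<beta> j * V (t - int j) \<omega> u) - \<epsilon> t \<omega> u"
    have dL: "?d s n \<in> L2 f" for s n using VL elim(1) by simp
    \<comment> \<open>The partial sum at lag \<open>j\<close> is shortened to order
      \<open>n - j\<close>, so that all sums use the same noise terms and
      \<open>psi_convolution\<close> cancels them; approximation errors remain.
      \<open>p \<le> n\<close> keeps \<open>n - j\<close> a true difference.\<close>
    have eq: "?x = (\<lambda>u. ?d t n u + (\<Sum>j=1..p. - \<beta> j * ?d (t - int j) (n - j) u))" if "p \<le> n" for n
    proof
      fix u
      have "(\<Sum>i | i + j \<le> n. \<psi> i * \<epsilon> (t - int (i + j)) \<omega> u) = S (t - int j) (n - j) \<omega> u" if "j \<in> {1..p}" for j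
      proof -
        have "{i. i + j \<le> n} = {..n - j}" using that \<open>p \<le> n\<close> by auto
        then show ?thesis by (simp add: S_eq algebra_simps)
      qed
      then have "S t n \<omega> u - (\<Sum>j=1..p. \<beta> j * S (t - int j) (n - j) \<omega> u) = \<epsilon> t \<omega> u"
        using psi_convolution[OF rec, where e = "\<lambda>i. \<epsilon> (t - int i) \<omega> u" and n = n] by (simp add: S_eq)
      then show "?x u = ?d t n u + (\<Sum>j=1..p. - \<beta> j * ?d (t - int j) (n - j) u)"
        by (simp add: right_diff_distrib sum_subtractf sum_negf algebra_simps)
    qed
    let ?b = "\<lambda>n. L2norm (?d t n) + (\<Sum>j=1..p. \<bar>\<beta> j\<bar> * L2norm (?d (t - int j) (n - j)))"
    have "L2norm ?x \<le> ?b n" if "p \<le> n" for n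
    proof -
      have "L2norm ?x \<le> L2norm (?d t n) + L2norm (\<lambda>u. \<Sum>j=1..p. - \<beta> j * ?d (t - int j) (n - j) u)"
        unfolding eq[OF that] by (intro L2norm_add_le dL L2_sum L2_cmult)
      also have "L2norm (\<lambda>u. \<Sum>j=1..p. - \<beta> j * ?d (t - int j) (n - j) u)
          \<le> (\<Sum>j=1..p. L2norm (\<lambda>u. - \<beta> j * ?d (t - int j) (n - j) u))"
        by (intro L2norm_sum_le dL L2_cmult)
      also have "\<dots> = (\<Sum>j=1..p. \<bar>\<beta> j\<bar> * L2norm (?d (t - int j) (n - j)))"
        by (subst L2norm_cmult[OF dL]) simp
      finally show ?thesis by simp
    qed
    moreover have "?b \<longlonglongrightarrow> 0 + (\<Sum>j=1..p. \<bar>\<beta> j\<bar> * 0)"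
      using elim(2)
      by (intro tendsto_add tendsto_sum tendsto_mult tendsto_const
          filterlim_compose[OF _ filterlim_minus_const_nat_at_top]) auto
    ultimately have "L2norm ?x \<le> 0" by (intro LIMSEQ_le_const) auto
    then show ?case using L2norm_nonneg[of ?x] by linarith
  qed
qed

section \<open>Noise paths and shift invariance\<close>

definition path_space :: "(int \<Rightarrow> real \<Rightarrow> real) measure" where
  "path_space = PiM UNIV (\<lambda>_. L2M f)"

lemma path_shift_meas: "(\<lambda>\<omega> i. \<epsilon> (i + h) \<omega>) \<in> measurable M path_space"
  unfolding path_space_def by (rule measurable_PiM_single') (auto simp: eps_meas space_PiM)

text \<open>Independence with equal laws makes the path law a product of copies of one law, and
  reindexing by an injective shift preserves such a product.\<close>

lemma path_shift_law:
  "distr M path_space (\<lambda>\<omega> i. \<epsilon> (i + h) \<omega>) = distr M path_space (\<lambda>\<omega> i. \<epsilon> i \<omega>)"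
proof -
  define D where "D = distr M (L2M f) (\<epsilon> 0)"
  interpret D: prob_space D unfolding D_def by (rule prob_space_distr[OF eps_meas])
  have setsD: "sets D = sets (L2M f)" by (simp add: D_def)
  have sets: "sets (PiM UNIV (\<lambda>_::int. D)) = sets path_space"
    unfolding path_space_def by (rule sets_PiM_cong) (simp_all add: setsD)
  have law: "distr M path_space (\<lambda>\<omega> i. \<epsilon> i \<omega>) = PiM UNIV (\<lambda>_. D)"
  proof -
    have "distr M (PiM UNIV (\<lambda>_. L2M f)) (\<lambda>x. \<lambda>i\<in>UNIV. \<epsilon> i x) = PiM UNIV (\<lambda>i. distr M (L2M f) (\<epsilon> i))"
      using eps_indep eps_meas by (subst indep_vars_iff_distr_eq_PiM[symmetric]) auto
    also have "(\<lambda>i. distr M (L2M f) (\<epsilon> i)) = (\<lambda>_. D)"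
      unfolding D_def by (rule ext) (rule eps_ident)
    finally show ?thesis by (simp add: path_space_def)
  qed
  have "distr M path_space (\<lambda>\<omega> i. \<epsilon> (i + h) \<omega>)
      = distr (distr M path_space (\<lambda>\<omega> i. \<epsilon> i \<omega>)) path_space (\<lambda>e i. e (i + h))"
  proof (subst distr_distr)
    show "(\<lambda>e i. e (i + h)) \<in> measurable path_space path_space"
      unfolding path_space_def by (rule measurable_PiM_single') (auto simp: space_PiM)
    show "(\<lambda>\<omega> i. \<epsilon> i \<omega>) \<in> measurable M path_space" using path_shift_meas[of 0] by simp
  qed (simp add: comp_def)
  also have "\<dots> = distr (PiM UNIV (\<lambda>_. D)) (PiM UNIV (\<lambda>_. D)) (\<lambda>e. \<lambda>i\<in>UNIV. e (i + h))"
    unfolding law by (rule distr_cong) (simp_all add: sets restrict_UNIV)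
  also have "\<dots> = PiM UNIV (\<lambda>_. D)"
    by (rule distr_PiM_reindex) (auto simp: inj_on_def D.prob_space_axioms)
  finally show ?thesis by (simp add: law)
qed

text \<open>Events of the limit at time \<open>t\<close> are, up to null sets, a fixed event of the noise path shifted
  by \<open>t\<close>; no measurable evaluation functional on function space is needed.\<close>

lemma limit_process_factor:
  assumes V: "limit_process V" and "A \<in> sets (L2M f)"
  shows "\<exists>A'\<in>sets path_space. \<forall>t. AE \<omega> in M. V t \<omega> \<in> A \<longleftrightarrow> (\<lambda>i. \<epsilon> (i + t) \<omega>) \<in> A'"
proof -
  define G where "G = {(\<lambda>x. L2inner f x h) -` B \<inter> L2 f | h B. h \<in> L2 f \<and> B \<in> sets borel}"
  have "A \<in> sigma_sets (L2 f) G"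
    using assms(2) unfolding L2M_def G_def by (subst (asm) sets_measure_of) auto
  then show ?thesis
  proof induction
    case (Basic A)
    then obtain h B where A: "A = (\<lambda>x. L2inner f x h) -` B \<inter> L2 f" "h \<in> L2 f" "B \<in> sets borel"
      by (auto simp: G_def)
    \<comment> \<open>\<open>lim\<close> has an unspecified value where the scalar series diverges;
      \<open>g\<close> is measurable all the same, and agreement is claimed only almost
      surely.\<close>
    define g where "g = (\<lambda>e. lim (\<lambda>n. \<Sum>i\<le>n. \<psi> i * L2inner f (e (- int i)) h))"
    have "(\<lambda>e. L2inner f (e i) h) \<in> borel_measurable path_space" for i
      unfolding path_space_def by (rule measurable_L2inner_comp[OF _ A(2)]) simp
    then have [measurable]: "g \<in> borel_measurable path_space"
      unfolding g_def by measurable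
    show ?case
    proof (intro bexI[of _ "g -` B \<inter> space path_space"] allI)
      fix t
      show "AE \<omega> in M. V t \<omega> \<in> A \<longleftrightarrow> (\<lambda>i. \<epsilon> (i + t) \<omega>) \<in> g -` B \<inter> space path_space"
        using limit_process_tendsto[OF V, of t] AE_space
      proof eventually_elim
        case (elim \<omega>)
        have "(\<lambda>n. L2inner f (S t n \<omega>) h) \<longlonglongrightarrow> L2inner f (V t \<omega>) h"
          using limit_process_L2[OF V elim(2)] elim A(2) by (intro L2inner_tendsto) auto
        then have "lim (\<lambda>n. L2inner f (S t n \<omega>) h) = L2inner f (V t \<omega>) h" by (rule limI)
        moreover have "L2inner f (S t n \<omega>) h = (\<Sum>i\<le>n. \<psi> i * L2inner f (\<epsilon> (t - int i) \<omega>) h)" for n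
          using elim(2) A(2) by (simp add: S_eq L2inner_sum_left L2inner_cmult_left)
        ultimately have "g (\<lambda>i. \<epsilon> (i + t) \<omega>) = L2inner f (V t \<omega>) h"
          by (simp add: g_def)
        moreover have "(\<lambda>i. \<epsilon> (i + t) \<omega>) \<in> space path_space"
          using measurable_space[OF path_shift_meas elim(2)] .
        ultimately show ?case
          using limit_process_L2[OF V elim(2)] by (simp add: A(1))
      qed
    qed (use A(3) in measurable)
  next
    case Empty
    show ?case by (intro bexI[of _ "{}"]) auto
  next
    case (Compl A)
    then obtain A' where A': "A' \<in> sets path_space"
      "\<And>t. AE \<omega> in M. V t \<omega> \<in> A \<longleftrightarrow> (\<lambda>i. \<epsilon> (i + t) \<omega>) \<in> A'" by blast
    show ?case
    proof (intro bexI[of _ "space path_space - A'"] allI)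
      fix t
      show "AE \<omega> in M. V t \<omega> \<in> L2 f - A \<longleftrightarrow> (\<lambda>i. \<epsilon> (i + t) \<omega>) \<in> space path_space - A'"
        using A'(2)[of t] AE_space
      proof eventually_elim
        case (elim \<omega>)
        then show ?case
          using limit_process_L2[OF V elim(2), of t] measurable_space[OF path_shift_meas elim(2)] by simp
      qed
    qed (use A'(1) in auto)
  next
    case (Union A)
    then have "\<forall>k. \<exists>A'. A' \<in> sets path_space \<and> (\<forall>t. AE \<omega> in M. V t \<omega> \<in> A k \<longleftrightarrow> (\<lambda>i. \<epsilon> (i + t) \<omega>) \<in> A')"
      by blast
    from choice[OF this] obtain A' where A': "\<And>k. A' k \<in> sets path_space"
      "\<And>k t. AE \<omega> in M. V t \<omega> \<in> A k \<longleftrightarrow> (\<lambda>i. \<epsilon> (i + t) \<omega>) \<in> A' k" by blast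
    show ?case
    proof (intro bexI[of _ "\<Union>k. A' k"] allI)
      fix t
      have "AE \<omega> in M. \<forall>k. V t \<omega> \<in> A k \<longleftrightarrow> (\<lambda>i. \<epsilon> (i + t) \<omega>) \<in> A' k"
        unfolding AE_all_countable using A'(2) by blast
      then show "AE \<omega> in M. V t \<omega> \<in> (\<Union>k. A k) \<longleftrightarrow> (\<lambda>i. \<epsilon> (i + t) \<omega>) \<in> (\<Union>k. A' k)"
        by eventually_elim auto
    qed (use A'(1) in auto)
  qed
qed

text \<open>Rectangles determine a law on a finite product. Each side of a rectangle is an event of
  the noise path, so the rectangle corresponds to one event \<open>C\<close>, the same for all
  \<open>h\<close>, of the path shifted by \<open>h\<close>; the path law is shift
  invariant.\<close>

lemma limit_process_strictly_stationary:
  assumes V: "limit_process V"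
  shows "strictly_stationary M (L2M f) V"
  unfolding strictly_stationary_def
proof (intro allI impI)
  fix J :: "int set" and h :: int assume J: "finite J"
  let ?N = "PiM J (\<lambda>_. L2M f)"
  let ?X = "\<lambda>h \<omega>. \<lambda>j\<in>J. V (j + h) \<omega>"
  have Xm: "?X h \<in> measurable M ?N" for h
    by (rule measurable_restrict) (rule limit_process_meas[OF V])
  have "distr M ?N (?X h) = distr M ?N (?X 0)"
  proof (rule measure_eqI_PiM_finite[OF J])
    fix A assume A: "\<And>i. i \<in> J \<Longrightarrow> A i \<in> sets (L2M f)"
    have "\<forall>j\<in>J. \<exists>A'. A' \<in> sets path_space \<and> (\<forall>t. AE \<omega> in M. V t \<omega> \<in> A j \<longleftrightarrow> (\<lambda>i. \<epsilon> (i + t) \<omega>) \<in> A')"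
      using limit_process_factor[OF V A] by blast
    from bchoice[OF this] obtain A' where A': "\<And>j. j \<in> J \<Longrightarrow> A' j \<in> sets path_space"
      "\<And>j t. j \<in> J \<Longrightarrow> AE \<omega> in M. V t \<omega> \<in> A j \<longleftrightarrow> (\<lambda>i. \<epsilon> (i + t) \<omega>) \<in> A' j" by blast
    define C where "C = {e \<in> space path_space. \<forall>j\<in>J. (\<lambda>i. e (i + j)) \<in> A' j}"
    have sh: "(\<lambda>e i. e (i + j)) \<in> measurable path_space path_space" for j
      unfolding path_space_def by (rule measurable_PiM_single') (auto simp: space_PiM)
    have "{e \<in> space path_space. (\<lambda>i. e (i + j)) \<in> A' j} \<in> sets path_space" if "j \<in> J" for j
      using measurable_sets[OF sh A'(1)[OF that], of j] by (simp add: vimage_def Int_def conj_commute)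
    then have C: "C \<in> sets path_space"
      unfolding C_def using J by (intro sets.sets_Collect_finite_All) auto
    have "emeasure (distr M ?N (?X h)) (PiE J A) = emeasure (distr M path_space (\<lambda>\<omega> i. \<epsilon> (i + h) \<omega>)) C" for h
    proof -
      have PA: "PiE J A \<in> sets ?N" using A J by (intro sets_PiM_I_finite) auto
      have "emeasure (distr M ?N (?X h)) (PiE J A) = emeasure M (?X h -` PiE J A \<inter> space M)"
        by (rule emeasure_distr[OF Xm PA])
      also have "\<dots> = emeasure M ((\<lambda>\<omega> i. \<epsilon> (i + h) \<omega>) -` C \<inter> space M)"
      proof (rule emeasure_eq_AE)
        have "AE \<omega> in M. \<forall>j\<in>J. V (j + h) \<omega> \<in> A j \<longleftrightarrow> (\<lambda>i. \<epsilon> (i + (j + h)) \<omega>) \<in> A' j"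
          using J A'(2) by (intro AE_finite_allI) auto
        with AE_space show "AE \<omega> in M. \<omega> \<in> ?X h -` PiE J A \<inter> space M
            \<longleftrightarrow> \<omega> \<in> (\<lambda>\<omega> i. \<epsilon> (i + h) \<omega>) -` C \<inter> space M"
        proof eventually_elim
          case (elim \<omega>)
          have "(\<lambda>i. \<epsilon> (i + h) \<omega>) \<in> space path_space"
            using measurable_space[OF path_shift_meas elim(1)] .
          moreover have "?X h \<omega> \<in> PiE J A \<longleftrightarrow> (\<forall>j\<in>J. V (j + h) \<omega> \<in> A j)" by (auto simp: PiE_iff)
          ultimately show ?case using elim by (simp add: C_def add.assoc)
        qed
      qed (use measurable_sets[OF Xm PA] measurable_sets[OF path_shift_meas C] in auto)
      also have "\<dots> = emeasure (distr M path_space (\<lambda>\<omega> i. \<epsilon> (i + h) \<omega>)) C"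
        by (rule emeasure_distr[symmetric, OF path_shift_meas C])
      finally show ?thesis .
    qed
    then show "emeasure (distr M ?N (?X h)) (PiE J A) = emeasure (distr M ?N (?X 0)) (PiE J A)"
      unfolding path_shift_law by metis
  next
    show "range (\<lambda>_::nat. space ?N) \<subseteq> prod_algebra J (\<lambda>_. L2M f)"
      using J sets.top[of "L2M f"] by (auto simp: space_PiM intro!: prod_algebraI_finite)
    show "emeasure (distr M ?N (?X h)) (space ?N) \<noteq> \<infinity>"
      using prob_space.emeasure_space_1[OF prob_space_distr[OF Xm]] by simp
  qed auto
  then show "distr M ?N (\<lambda>\<omega>. \<lambda>j\<in>J. V (j + h) \<omega>) = distr M ?N (\<lambda>\<omega>. \<lambda>j\<in>J. V j \<omega>)" by simp
qed

end

lemma strictly_stationary_compose: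
  assumes "strictly_stationary M N X" "\<And>t. X t \<in> measurable M N" "g \<in> measurable N K"
  shows "strictly_stationary M K (\<lambda>t \<omega>. g (X t \<omega>))"
  unfolding strictly_stationary_def
proof (intro allI impI)
  fix J :: "int set" and h :: int assume J: "finite J"
  let ?g = "\<lambda>x. \<lambda>j\<in>J. g (x j)"
  have gm: "?g \<in> measurable (PiM J (\<lambda>_. N)) (PiM J (\<lambda>_. K))"
    using assms(3) by measurable
  have *: "distr M (PiM J (\<lambda>_. K)) (\<lambda>\<omega>. \<lambda>j\<in>J. g (X (j + h) \<omega>))
      = distr (distr M (PiM J (\<lambda>_. N)) (\<lambda>\<omega>. \<lambda>j\<in>J. X (j + h) \<omega>)) (PiM J (\<lambda>_. K)) ?g" for h
  proof (subst distr_distr[OF gm])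
    show "(\<lambda>\<omega>. \<lambda>j\<in>J. X (j + h) \<omega>) \<in> measurable M (PiM J (\<lambda>_. N))"
      by (rule measurable_restrict) (rule assms(2))
  qed (auto simp: comp_def intro!: distr_cong)
  show "distr M (PiM J (\<lambda>_. K)) (\<lambda>\<omega>. \<lambda>j\<in>J. g (X (j + h) \<omega>)) = distr M (PiM J (\<lambda>_. K)) (\<lambda>\<omega>. \<lambda>j\<in>J. g (X j \<omega>))"
    using *[of h] *[of 0] assms(1) J by (simp add: strictly_stationary_def)
qed

section \<open>Uniqueness of the stationary solution\<close>

text \<open>These are the indices by which a full sum exceeds the one in
  \<open>psi_convolution\<close>: exactly \<open>j\<close> of them, from \<open>Suc n - j\<close> to
  \<open>n\<close>.\<close>

lemma sum_abs_le_tail: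
  fixes \<psi> :: "nat \<Rightarrow> real"
  assumes "summable (\<lambda>i. \<bar>\<psi> i\<bar>)" "j \<le> Suc n"
  shows "(\<Sum>i | i \<le> n \<and> n < i + j. \<bar>\<psi> i\<bar>) \<le> (\<Sum>i. \<bar>\<psi> (i + (Suc n - j))\<bar>)"
proof -
  have "(\<Sum>i | i \<le> n \<and> n < i + j. \<bar>\<psi> i\<bar>) = (\<Sum>k<j. \<bar>\<psi> (k + (Suc n - j))\<bar>)"
    by (rule sum.reindex_bij_witness[of _ "\<lambda>k. k + (Suc n - j)" "\<lambda>i. i - (Suc n - j)"])
      (use assms(2) in auto)
  also have "\<dots> \<le> (\<Sum>i. \<bar>\<psi> (i + (Suc n - j))\<bar>)"
    using assms(1) by (intro sum_le_suminf) (auto simp: summable_iff_shift[where f = "\<lambda>i. \<bar>\<psi> i\<bar>"])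
  finally show ?thesis .
qed

context war_noise
begin

text \<open>By Pythagoras no element of the dense family is closer to \<open>x\<close> than zero
  is.\<close>

lemma orthogonal_dense_imp_zero:
  assumes x: "x \<in> L2 f" and "\<And>cs. L2inner f x (ramps cs) = 0"
  shows "L2norm x = 0"
proof (rule ccontr)
  assume "L2norm x \<noteq> 0"
  then have "0 < L2norm x" using L2norm_nonneg[of x] by linarith
  then obtain cs where cs: "L2norm (\<lambda>u. x u - ramps cs u) < L2norm x" using ramps_dense[OF x] by blast
  have "(L2norm (\<lambda>u. x u - ramps cs u))\<^sup>2 < (L2norm x)\<^sup>2"
    using cs by (intro power_strict_mono) auto
  moreover have "(L2norm (\<lambda>u. x u - ramps cs u))\<^sup>2 = (L2norm x)\<^sup>2 + (L2norm (ramps cs))\<^sup>2"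
    using L2norm_diff_square[OF x ramps_L2[of cs]] assms(2) by simp
  ultimately show False using zero_le_power2[of "L2norm (ramps cs)"] by linarith
qed

text \<open>The covariance identity at lag 0, with \<open>h\<close> as both test functions, makes
  the second moment of the centred coordinate constant in time. The inequality
  \<open>\<bar>a\<bar> \<le> \<bar>b\<bar> + 1 + (a - b)\<^sup>2\<close> turns this into a uniform
  bound in mean.\<close>

lemma hilbert_stationary_L1_bound:
  assumes st: "hilbert_stationary M f W" and Wm: "\<And>t. W t \<in> measurable M (L2M f)" and h: "h \<in> L2 f"
  obtains C where "0 \<le> C" "\<And>t. (\<integral>\<^sup>+\<omega>. ennreal \<bar>L2inner f (W t \<omega>) h\<bar> \<partial>M) \<le> ennreal C"
proof -
  have mom: "\<And>t. (\<integral>\<^sup>+\<omega>. L2sq f (W t \<omega>) \<partial>M) < \<infinity>"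
    using st by (simp add: hilbert_stationary_def)
  obtain m where m: "m \<in> L2 f"
    and cov: "\<And>x y s t k. x \<in> L2 f \<Longrightarrow> y \<in> L2 f \<Longrightarrow>
       (\<integral>\<omega>. L2inner f (\<lambda>u. W s \<omega> u - m u) x * L2inner f (\<lambda>u. W (s + k) \<omega> u - m u) y \<partial>M)
     = (\<integral>\<omega>. L2inner f (\<lambda>u. W t \<omega> u - m u) x * L2inner f (\<lambda>u. W (t + k) \<omega> u - m u) y \<partial>M)"
    using st unfolding hilbert_stationary_def by blast
  let ?Y = "\<lambda>t \<omega>. L2inner f (W t \<omega>) h - L2inner f m h"
  have Y: "L2inner f (\<lambda>u. W t \<omega> u - m u) h = ?Y t \<omega>" if "\<omega> \<in> space M" for t \<omega>
    using that m h measurable_L2M_L2[OF Wm] by (simp add: L2inner_diff_left)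
  define c where "c = (\<integral>\<omega>. (?Y 0 \<omega>)\<^sup>2 \<partial>M)"
  have c: "(\<integral>\<omega>. (?Y t \<omega>)\<^sup>2 \<partial>M) = c" for t
  proof -
    have "(\<integral>\<omega>. (?Y s \<omega>)\<^sup>2 \<partial>M)
       = (\<integral>\<omega>. L2inner f (\<lambda>u. W s \<omega> u - m u) h * L2inner f (\<lambda>u. W (s + 0) \<omega> u - m u) h \<partial>M)" for s
      by (intro Bochner_Integration.integral_cong) (simp_all add: Y power2_eq_square)
    then show ?thesis using cov[OF h h, of t 0 0] by (simp add: c_def)
  qed
  have "0 \<le> c" unfolding c_def by simp
  define C where "C = \<bar>L2inner f m h\<bar> + 1 + c"
  show ?thesis
  proof (rule that[of C])
    show "0 \<le> C" using \<open>0 \<le> c\<close> by (simp add: C_def)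
    fix t
    have i1: "integrable M (\<lambda>\<omega>. L2inner f (W t \<omega>) h)" and i2: "integrable M (\<lambda>\<omega>. (L2inner f (W t \<omega>) h)\<^sup>2)"
      using integrable_L2inner[OF Wm h mom] by auto
    have iY: "integrable M (\<lambda>\<omega>. (?Y t \<omega>)\<^sup>2)"
      using i1 i2 by (simp add: power2_diff)
    have le: "\<bar>L2inner f (W t \<omega>) h\<bar> \<le> \<bar>L2inner f m h\<bar> + 1 + (?Y t \<omega>)\<^sup>2" for \<omega>
    proof -
      have "2 * \<bar>?Y t \<omega>\<bar> \<le> 1 + (?Y t \<omega>)\<^sup>2"
        using sum_squares_bound[of "\<bar>?Y t \<omega>\<bar>" 1] by simp
      moreover have "\<bar>a\<bar> \<le> \<bar>b\<bar> + 1 + s" if "2 * \<bar>a - b\<bar> \<le> 1 + s" "0 \<le> s" for a b s :: real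
        using that by (smt (verit))
      ultimately show ?thesis by (meson zero_le_power2)
    qed
    have "(\<integral>\<^sup>+\<omega>. ennreal \<bar>L2inner f (W t \<omega>) h\<bar> \<partial>M) = ennreal (\<integral>\<omega>. \<bar>L2inner f (W t \<omega>) h\<bar> \<partial>M)"
      using i1 by (intro nn_integral_eq_integral) auto
    also have "(\<integral>\<omega>. \<bar>L2inner f (W t \<omega>) h\<bar> \<partial>M) \<le> (\<integral>\<omega>. \<bar>L2inner f m h\<bar> + 1 + (?Y t \<omega>)\<^sup>2 \<partial>M)"
      using i1 iY le by (intro integral_mono) auto
    also have "\<dots> = C"
      using iY prob_space by (simp add: C_def c)
    finally show "(\<integral>\<^sup>+\<omega>. ennreal \<bar>L2inner f (W t \<omega>) h\<bar> \<partial>M) \<le> ennreal C" by (simp add: ennreal_leI)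
  qed
qed

text \<open>Solving the equation for the noise and inserting the result into the partial sum cancels
  everything except the terms \<open>\<psi> i * e (i + j)\<close> with
  \<open>i \<le> n < i + j\<close>. Their weights lie in a tail of \<open>\<psi>\<close>, and
  stationarity bounds the other factor in mean, uniformly in time.\<close>

lemma stationary_solution_tendsto:
  assumes rec: "\<And>n. \<psi> n - (\<Sum>j\<in>{1..p} \<inter> {..n}. \<beta> j * \<psi> (n - j)) = (if n = 0 then 1 else 0)"
    and Wm: "\<And>t. W t \<in> measurable M (L2M f)"
    and sol: "\<And>t. AE \<omega> in M. L2sq f (\<lambda>u. W t \<omega> u - (\<Sum>j=1..p. \<beta> j * W (t - int j) \<omega> u) - \<epsilon> t \<omega> u) = 0"
    and st: "hilbert_stationary M f W" and h: "h \<in> L2 f"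
  shows "(\<lambda>n. \<integral>\<^sup>+\<omega>. ennreal \<bar>L2inner f (W t \<omega>) h - L2inner f (S t n \<omega>) h\<bar> \<partial>M) \<longlonglongrightarrow> 0"
proof -
  note WL = measurable_L2M_L2[OF Wm]
  obtain C where C: "0 \<le> C" "\<And>t. (\<integral>\<^sup>+\<omega>. ennreal \<bar>L2inner f (W t \<omega>) h\<bar> \<partial>M) \<le> ennreal C"
    by (rule hilbert_stationary_L1_bound[OF st Wm h]) blast
  define e where "e i \<omega> = L2inner f (W (t - int i) \<omega>) h" for i :: nat and \<omega>
  have em [measurable]: "e i \<in> borel_measurable M" for i
    unfolding e_def by (rule measurable_L2inner_comp[OF Wm h])
  let ?I = "\<lambda>n j. {i::nat. i \<le> n \<and> n < i + j}"
  have finI: "finite (?I n j)" for n j by (rule finite_subset[of _ "{..n}"]) auto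
  have "AE \<omega> in M. \<forall>t. L2sq f (\<lambda>u. W t \<omega> u - (\<Sum>j=1..p. \<beta> j * W (t - int j) \<omega> u) - \<epsilon> t \<omega> u) = 0"
    unfolding AE_all_countable using sol by blast
  with AE_space have ae: "AE \<omega> in M. \<forall>n. L2inner f (W t \<omega>) h - L2inner f (S t n \<omega>) h
      = (\<Sum>j=1..p. \<beta> j * (\<Sum>i\<in>?I n j. \<psi> i * e (i + j) \<omega>))"
  proof eventually_elim
    case (elim \<omega>)
    have eps: "L2inner f (\<epsilon> s \<omega>) h = L2inner f (W s \<omega>) h - (\<Sum>j=1..p. \<beta> j * L2inner f (W (s - int j) \<omega>) h)" for s
    proof -
      let ?x = "\<lambda>u. W s \<omega> u - (\<Sum>j=1..p. \<beta> j * W (s - int j) \<omega> u) - \<epsilon> s \<omega> u"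
      have xL: "?x \<in> L2 f" using WL elim(1) by simp
      have "L2norm ?x = 0" using elim(2) L2sq_eq_zero_iff[OF xL] by simp
      then have "L2inner f ?x h = 0" using L2_cauchy_schwarz[OF xL h] by simp
      moreover have "L2inner f ?x h = L2inner f (W s \<omega>) h
          - (\<Sum>j=1..p. \<beta> j * L2inner f (W (s - int j) \<omega>) h) - L2inner f (\<epsilon> s \<omega>) h"
        using WL elim(1) h by (simp add: L2inner_diff_left L2inner_sum_left L2inner_cmult_left)
      ultimately show ?thesis by simp
    qed
    show ?case
    proof
      fix n
      have "L2inner f (S t n \<omega>) h = (\<Sum>i\<le>n. \<psi> i * L2inner f (\<epsilon> (t - int i) \<omega>) h)"
        using elim(1) h by (simp add: S_eq L2inner_sum_left L2inner_cmult_left)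
      also have "\<dots> = (\<Sum>i\<le>n. \<psi> i * (e i \<omega> - (\<Sum>j=1..p. \<beta> j * e (i + j) \<omega>)))"
        unfolding eps e_def by (simp add: algebra_simps)
      also have "\<dots> = (\<Sum>i\<le>n. \<psi> i * e i \<omega>) - (\<Sum>i\<le>n. \<Sum>j=1..p. \<beta> j * (\<psi> i * e (i + j) \<omega>))"
        by (simp add: right_diff_distrib sum_subtractf sum_distrib_left mult.left_commute)
      also have "(\<Sum>i\<le>n. \<Sum>j=1..p. \<beta> j * (\<psi> i * e (i + j) \<omega>)) = (\<Sum>j=1..p. \<beta> j * (\<Sum>i\<le>n. \<psi> i * e (i + j) \<omega>))"
        unfolding sum_distrib_left by (rule sum.swap)
      finally have S: "L2inner f (S t n \<omega>) h
        = (\<Sum>i\<le>n. \<psi> i * e i \<omega>) - (\<Sum>j=1..p. \<beta> j * (\<Sum>i\<le>n. \<psi> i * e (i + j) \<omega>))" .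
      \<comment> \<open>Isolates the part to which \<open>psi_convolution\<close> applies from the
        boundary terms.\<close>
      have split: "(\<Sum>i\<le>n. \<psi> i * e (i + j) \<omega>)
        = (\<Sum>i | i + j \<le> n. \<psi> i * e (i + j) \<omega>) + (\<Sum>i\<in>?I n j. \<psi> i * e (i + j) \<omega>)" for j
        using finI[of n j]
        by (subst sum.union_disjoint[symmetric]) (auto intro!: sum.cong finite_subset[of _ "{..n}"])
      have "(\<Sum>i\<le>n. \<psi> i * e i \<omega>) - (\<Sum>j=1..p. \<beta> j * (\<Sum>i | i + j \<le> n. \<psi> i * e (i + j) \<omega>)) = e 0 \<omega>"
        by (rule psi_convolution[OF rec])
      moreover have "e 0 \<omega> = L2inner f (W t \<omega>) h" by (simp add: e_def)
      ultimately show "L2inner f (W t \<omega>) h - L2inner f (S t n \<omega>) h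
          = (\<Sum>j=1..p. \<beta> j * (\<Sum>i\<in>?I n j. \<psi> i * e (i + j) \<omega>))"
        unfolding S split by (simp add: distrib_left sum.distrib)
    qed
  qed
  let ?T = "\<lambda>n. \<Sum>i. \<bar>\<psi> (i + n)\<bar>"
  let ?b = "\<lambda>n. \<Sum>j=1..p. \<bar>\<beta> j\<bar> * (?T (Suc n - j) * C)"
  have T0: "0 \<le> ?T n" for n
    using psi_summable by (intro suminf_nonneg) (auto simp: summable_iff_shift[where f = "\<lambda>i. \<bar>\<psi> i\<bar>"])
  have bound: "(\<integral>\<^sup>+\<omega>. ennreal \<bar>L2inner f (W t \<omega>) h - L2inner f (S t n \<omega>) h\<bar> \<partial>M) \<le> ennreal (?b n)"
    if n: "p \<le> n" for n
  proof -
    have "(\<integral>\<^sup>+\<omega>. ennreal \<bar>L2inner f (W t \<omega>) h - L2inner f (S t n \<omega>) h\<bar> \<partial>M)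
      \<le> (\<integral>\<^sup>+\<omega>. (\<Sum>j=1..p. \<Sum>i\<in>?I n j. ennreal (\<bar>\<beta> j\<bar> * \<bar>\<psi> i\<bar>) * ennreal \<bar>e (i + j) \<omega>\<bar>) \<partial>M)"
    proof (rule nn_integral_mono_AE, use ae in eventually_elim)
      case (elim \<omega>)
      have "\<bar>\<Sum>j=1..p. \<beta> j * (\<Sum>i\<in>?I n j. \<psi> i * e (i + j) \<omega>)\<bar>
        \<le> (\<Sum>j=1..p. \<bar>\<beta> j * (\<Sum>i\<in>?I n j. \<psi> i * e (i + j) \<omega>)\<bar>)"
        by (rule sum_abs)
      also have "\<dots> \<le> (\<Sum>j=1..p. \<Sum>i\<in>?I n j. (\<bar>\<beta> j\<bar> * \<bar>\<psi> i\<bar>) * \<bar>e (i + j) \<omega>\<bar>)"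
      proof (rule sum_mono)
        fix j
        have "\<bar>\<beta> j\<bar> * \<bar>\<Sum>i\<in>?I n j. \<psi> i * e (i + j) \<omega>\<bar> \<le> \<bar>\<beta> j\<bar> * (\<Sum>i\<in>?I n j. \<bar>\<psi> i * e (i + j) \<omega>\<bar>)"
          by (intro mult_left_mono sum_abs) simp
        then show "\<bar>\<beta> j * (\<Sum>i\<in>?I n j. \<psi> i * e (i + j) \<omega>)\<bar> \<le> (\<Sum>i\<in>?I n j. (\<bar>\<beta> j\<bar> * \<bar>\<psi> i\<bar>) * \<bar>e (i + j) \<omega>\<bar>)"
          unfolding abs_mult by (simp only: sum_distrib_left mult.assoc)
      qed
      finally have "ennreal \<bar>\<Sum>j=1..p. \<beta> j * (\<Sum>i\<in>?I n j. \<psi> i * e (i + j) \<omega>)\<bar>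
          \<le> ennreal (\<Sum>j=1..p. \<Sum>i\<in>?I n j. (\<bar>\<beta> j\<bar> * \<bar>\<psi> i\<bar>) * \<bar>e (i + j) \<omega>\<bar>)"
        by (rule ennreal_leI)
      also have "\<dots> = (\<Sum>j=1..p. \<Sum>i\<in>?I n j. ennreal (\<bar>\<beta> j\<bar> * \<bar>\<psi> i\<bar>) * ennreal \<bar>e (i + j) \<omega>\<bar>)"
        by (simp add: sum_ennreal[symmetric] sum_nonneg ennreal_mult')
      finally show ?case using elim by simp
    qed
    also have "\<dots> = (\<Sum>j=1..p. \<Sum>i\<in>?I n j. ennreal (\<bar>\<beta> j\<bar> * \<bar>\<psi> i\<bar>) * (\<integral>\<^sup>+\<omega>. ennreal \<bar>e (i + j) \<omega>\<bar> \<partial>M))"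
      by (simp add: nn_integral_sum nn_integral_cmult)
    also have "\<dots> \<le> (\<Sum>j=1..p. \<Sum>i\<in>?I n j. ennreal (\<bar>\<beta> j\<bar> * \<bar>\<psi> i\<bar>) * ennreal C)"
      by (intro sum_mono mult_left_mono) (auto simp: e_def C(2))
    also have "\<dots> = ennreal (\<Sum>j=1..p. \<Sum>i\<in>?I n j. (\<bar>\<beta> j\<bar> * \<bar>\<psi> i\<bar>) * C)"
      using C(1) by (simp add: sum_ennreal[symmetric] sum_nonneg ennreal_mult')
    also have "\<dots> \<le> ennreal (?b n)"
    proof (intro ennreal_leI sum_mono)
      fix j assume "j \<in> {1..p}"
      then have "(\<Sum>i\<in>?I n j. \<bar>\<psi> i\<bar>) \<le> ?T (Suc n - j)"
        using n by (intro sum_abs_le_tail psi_summable) auto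
      then have "\<bar>\<beta> j\<bar> * ((\<Sum>i\<in>?I n j. \<bar>\<psi> i\<bar>) * C) \<le> \<bar>\<beta> j\<bar> * (?T (Suc n - j) * C)"
        using C(1) by (intro mult_left_mono mult_right_mono) auto
      then show "(\<Sum>i\<in>?I n j. (\<bar>\<beta> j\<bar> * \<bar>\<psi> i\<bar>) * C) \<le> \<bar>\<beta> j\<bar> * (?T (Suc n - j) * C)"
        by (simp add: sum_distrib_left sum_distrib_right mult.assoc)
    qed
    finally show ?thesis .
  qed
  have "?b \<longlonglongrightarrow> (\<Sum>j=1..p. \<bar>\<beta> j\<bar> * (0 * C))"
  proof (intro tendsto_sum tendsto_mult tendsto_const)
    fix j
    have "filterlim (\<lambda>n. Suc n - j) sequentially sequentially"
      using filterlim_compose[OF filterlim_minus_const_nat_at_top filterlim_Suc] .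
    from filterlim_compose[OF suminf_tail_tendsto_zero[OF psi_summable] this]
    show "(\<lambda>n. ?T (Suc n - j)) \<longlonglongrightarrow> 0" .
  qed
  then have b: "(\<lambda>n. ennreal (?b n)) \<longlonglongrightarrow> 0"
    using tendsto_ennrealI[of ?b 0] by simp
  have ev: "\<forall>\<^sub>F n in sequentially.
      (\<integral>\<^sup>+\<omega>. ennreal \<bar>L2inner f (W t \<omega>) h - L2inner f (S t n \<omega>) h\<bar> \<partial>M) \<le> ennreal (?b n)"
    using eventually_ge_at_top[of p] by eventually_elim (rule bound)
  show ?thesis
    by (rule tendsto_sandwich[OF _ ev tendsto_const b]) simp
qed

text \<open>For each \<open>h\<close> the coordinates of both processes are limits in mean of the
  same partial sums. The null event depends on \<open>h\<close>; letting \<open>h\<close> run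
  through the countable family \<open>ramps\<close> gives a common one, and density does the
  rest.\<close>

lemma stationary_solution_unique:
  assumes rec: "\<And>n. \<psi> n - (\<Sum>j\<in>{1..p} \<inter> {..n}. \<beta> j * \<psi> (n - j)) = (if n = 0 then 1 else 0)"
    and Wm: "\<And>t. W t \<in> measurable M (L2M f)"
    and sol: "\<And>t. AE \<omega> in M. L2sq f (\<lambda>u. W t \<omega> u - (\<Sum>j=1..p. \<beta> j * W (t - int j) \<omega> u) - \<epsilon> t \<omega> u) = 0"
    and st: "hilbert_stationary M f W" and V: "limit_process V"
  shows "AE \<omega> in M. L2norm (\<lambda>u. W t \<omega> u - V t \<omega> u) = 0"
proof -
  have "AE \<omega> in M. L2inner f (W t \<omega>) h = L2inner f (V t \<omega>) h" if h: "h \<in> L2 f" for h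
  proof -
    have [measurable]: "(\<lambda>\<omega>. L2inner f (W t \<omega>) h) \<in> borel_measurable M"
      "(\<lambda>\<omega>. L2inner f (V t \<omega>) h) \<in> borel_measurable M"
      "(\<lambda>\<omega>. L2inner f (S t n \<omega>) h) \<in> borel_measurable M" for n
      by (auto intro!: measurable_L2inner_comp Wm S_meas limit_process_meas V h)
    let ?a = "\<lambda>n. \<integral>\<^sup>+\<omega>. ennreal \<bar>L2inner f (W t \<omega>) h - L2inner f (S t n \<omega>) h\<bar> \<partial>M"
    let ?c = "\<lambda>n. \<integral>\<^sup>+\<omega>. ennreal \<bar>L2inner f (V t \<omega>) h - L2inner f (S t n \<omega>) h\<bar> \<partial>M"
    let ?x = "\<integral>\<^sup>+\<omega>. ennreal \<bar>L2inner f (W t \<omega>) h - L2inner f (V t \<omega>) h\<bar> \<partial>M"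
    have "?x \<le> ?a n + ?c n" for n
    proof -
      have "?x \<le> (\<integral>\<^sup>+\<omega>. ennreal \<bar>L2inner f (W t \<omega>) h - L2inner f (S t n \<omega>) h\<bar>
          + ennreal \<bar>L2inner f (V t \<omega>) h - L2inner f (S t n \<omega>) h\<bar> \<partial>M)"
        by (intro nn_integral_mono) (simp flip: ennreal_plus)
      then show ?thesis by (simp add: nn_integral_add)
    qed
    moreover have "(\<lambda>n. ?a n + ?c n) \<longlonglongrightarrow> 0 + 0"
      by (intro tendsto_add stationary_solution_tendsto[OF rec Wm sol st h] limit_process_L2inner_tendsto[OF V h])
    ultimately have "?x \<le> 0"
      using LIMSEQ_le_const[of "\<lambda>n. ?a n + ?c n" 0 ?x] by auto
    then have "?x = 0" by simp
    then have "AE \<omega> in M. ennreal \<bar>L2inner f (W t \<omega>) h - L2inner f (V t \<omega>) h\<bar> = 0"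
      by (subst (asm) nn_integral_0_iff_AE) auto
    then show ?thesis by eventually_elim simp
  qed
  then have "AE \<omega> in M. \<forall>cs. L2inner f (W t \<omega>) (ramps cs) = L2inner f (V t \<omega>) (ramps cs)"
    unfolding AE_all_countable by simp
  with AE_space show ?thesis
  proof eventually_elim
    case (elim \<omega>)
    have "W t \<omega> \<in> L2 f" "V t \<omega> \<in> L2 f"
      using measurable_L2M_L2[OF Wm] limit_process_L2[OF V] elim(1) by auto
    then show ?case using elim(2) by (intro orthogonal_dense_imp_zero) (auto simp: L2inner_diff_left)
  qed
qed

end

section \<open>Quantile functions and the Wasserstein distance\<close>

context w2_space
begin

sublocale \<mu>: cdf_distribution \<mu>
  using real_distribution_\<mu> by (simp add: cdf_distribution_def)

lemma cdf_of_eq: "cdf_of f = cdf \<mu>"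
  by (simp add: cdf_of_def[abs_def] cdf_def[abs_def])

text \<open>\<open>\<mu>.I\<close> is the generalised inverse of Skorohod's construction. The
  identification opens access to its Galois connection with the distribution function and to the
  fact that it carries the uniform law to \<open>\<mu>\<close>.\<close>

lemma quantile_of_eq: "quantile_of f = \<mu>.I"
  by (simp add: quantile_of_def[abs_def] cdf_of_eq)

lemma quantile_le_iff: "0 < s \<Longrightarrow> s < 1 \<Longrightarrow> quantile_of f s \<le> x \<longleftrightarrow> s \<le> cdf_of f x"
  using \<mu>.pseudoinverse[of s x] by (simp add: quantile_of_eq cdf_of_eq)

lemma quantile_measurable: "quantile_of f \<in> borel_measurable (restrict_space borel {0<..<1})"
  unfolding quantile_of_eq by (rule \<mu>.measurable_CI)

lemma distr_quantile: "distr (restrict_space lborel {0<..<1}) borel (quantile_of f) = \<mu>"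
  unfolding quantile_of_eq by (rule \<mu>.distr_I_eq_M)

lemma cdf_of_measurable [measurable]: "cdf_of f \<in> borel_measurable borel"
  unfolding cdf_of_eq by (rule \<mu>.measurable_C)

lemma measure_\<mu>_singleton: "measure \<mu> {x} = 0"
proof -
  have "emeasure \<mu> {x} = (\<integral>\<^sup>+u. ennreal (f u) * indicator {x} u \<partial>lborel)"
    by (rule emeasure_density) auto
  also have "\<dots> = 0"
    by (rule nn_integral_null_set) (simp add: null_sets_def)
  finally show ?thesis by (simp add: measure_def)
qed

lemma cdf_of_cont: "isCont (cdf_of f) x"
  unfolding cdf_of_eq \<mu>.isCont_cdf by (rule measure_\<mu>_singleton)

text \<open>A density has no atoms, so the distribution function is continuous; exceeding
  \<open>s\<close> at the quantile, it would exceed \<open>s\<close> already slightly to the left,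
  against minimality.\<close>

lemma cdf_quantile:
  assumes "0 < s" "s < 1"
  shows "cdf_of f (quantile_of f s) = s"
proof (rule antisym)
  let ?q = "quantile_of f s"
  show "s \<le> cdf_of f ?q" using quantile_le_iff[OF assms, of ?q] by simp
  show "cdf_of f ?q \<le> s"
  proof (rule ccontr)
    assume "\<not> cdf_of f ?q \<le> s"
    then have "s < cdf_of f ?q" by simp
    moreover have "((\<lambda>x. cdf_of f x) \<longlongrightarrow> cdf_of f ?q) (at_left ?q)"
      using cdf_of_cont[of ?q] by (auto simp: isCont_def intro: filterlim_mono at_le)
    ultimately have "\<forall>\<^sub>F x in at_left ?q. s < cdf_of f x" by (rule order_tendstoD(1)[rotated])
    then obtain b where b: "b < ?q" "\<And>y. b < y \<Longrightarrow> y < ?q \<Longrightarrow> s < cdf_of f y"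
      using eventually_at_left[of "?q - 1" ?q] by auto
    obtain y where "b < y" "y < ?q" using dense[OF b(1)] by blast
    with b(2) have "s \<le> cdf_of f y" by (simp add: less_imp_le)
    then show False using quantile_le_iff[OF assms, of y] \<open>y < ?q\<close> by simp
  qed
qed

lemma nn_integral_quantile:
  assumes [measurable]: "g \<in> borel_measurable borel"
  shows "(\<integral>\<^sup>+ s\<in>{0<..<1}. g (quantile_of f s) \<partial>lborel) = (\<integral>\<^sup>+ u. g u \<partial>\<mu>)"
proof -
  have q: "quantile_of f \<in> measurable (restrict_space lborel {0<..<1}) borel"
    unfolding measurable_cong_sets[OF sets_restrict_space_cong[OF sets_lborel] refl]
    by (rule quantile_measurable)
  have "(\<integral>\<^sup>+ s\<in>{0<..<1}. g (quantile_of f s) \<partial>lborel)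
      = (\<integral>\<^sup>+ s. g (quantile_of f s) \<partial>restrict_space lborel {0<..<1})"
    by (subst nn_integral_restrict_space) auto
  also have "\<dots> = (\<integral>\<^sup>+ u. g u \<partial>distr (restrict_space lborel {0<..<1}) borel (quantile_of f))"
    by (subst nn_integral_distr[OF q]) auto
  finally show ?thesis by (simp add: distr_quantile)
qed

text \<open>Truncated outside the range of the distribution function on which the quantile function of \<open>g\<close> is
  meaningful; the exceptional set is \<open>\<mu>\<close>-null.\<close>

definition transport_map :: "(real \<Rightarrow> real) \<Rightarrow> real \<Rightarrow> real" where
  "transport_map g u = (if cdf_of f u \<in> {0<..<1} then quantile_of g (cdf_of f u) else 0)"

lemma transport_map_quantile: "0 < s \<Longrightarrow> s < 1 \<Longrightarrow> transport_map g (quantile_of f s) = quantile_of g s"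
  by (simp add: transport_map_def cdf_quantile)

lemma transport_map_measurable:
  assumes "W2_density g"
  shows "transport_map g \<in> borel_measurable borel"
proof -
  interpret g: w2_space g using assms by unfold_locales
  have "(\<lambda>s. if s \<in> {0<..<1} then quantile_of g s else 0) \<in> borel_measurable borel"
    using g.quantile_measurable by (subst (asm) measurable_restrict_space_iff[where c = 0]) auto
  from measurable_compose[OF cdf_of_measurable this] show ?thesis
    by (simp add: transport_map_def[abs_def])
qed

lemma nn_integral_transport_map:
  assumes g: "W2_density g" and [measurable]: "case_prod k \<in> borel_measurable (borel \<Otimes>\<^sub>M borel)"
  shows "(\<integral>\<^sup>+ s\<in>{0<..<1}. k (quantile_of g s) (quantile_of f s) \<partial>lborel)
       = (\<integral>\<^sup>+ u. k (transport_map g u) u \<partial>\<mu>)"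
proof -
  have [measurable]: "transport_map g \<in> borel_measurable borel" by (rule transport_map_measurable[OF g])
  have "(\<integral>\<^sup>+ s\<in>{0<..<1}. k (quantile_of g s) (quantile_of f s) \<partial>lborel)
      = (\<integral>\<^sup>+ s\<in>{0<..<1}. k (transport_map g (quantile_of f s)) (quantile_of f s) \<partial>lborel)"
    by (intro nn_integral_cong) (auto simp: transport_map_quantile split: split_indicator)
  also have "\<dots> = (\<integral>\<^sup>+ u. k (transport_map g u) u \<partial>\<mu>)"
    by (rule nn_integral_quantile[where g = "\<lambda>u. k (transport_map g u) u"]) measurable
  finally show ?thesis .
qed

lemma transport_map_L2:
  assumes g: "W2_density g"
  shows "transport_map g \<in> L2 f"
proof -
  interpret g: w2_space g using g by unfold_locales
  have "L2sq f (transport_map g) = (\<integral>\<^sup>+ u. ennreal ((transport_map g u)\<^sup>2) \<partial>\<mu>)"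
    by (rule L2sq_eq_nn_integral[OF transport_map_measurable[OF g]])
  also have "\<dots> = (\<integral>\<^sup>+ s\<in>{0<..<1}. ennreal ((quantile_of g s)\<^sup>2) \<partial>lborel)"
    by (rule nn_integral_transport_map[OF g, where k = "\<lambda>x u. ennreal (x\<^sup>2)", symmetric]) measurable
  also have "\<dots> = (\<integral>\<^sup>+ x. ennreal (x\<^sup>2) \<partial>g.\<mu>)"
    by (rule g.nn_integral_quantile) measurable
  also have "\<dots> = L2sq g (\<lambda>x. x)" by (simp add: g.L2sq_eq_nn_integral)
  also have "\<dots> < \<infinity>" using g.L2_id by (simp add: L2_def)
  finally show ?thesis by (simp add: L2_def transport_map_measurable[OF g])
qed

text \<open>The substitution \<open>u = quantile_of f s\<close> turns the uniform law into
  \<open>\<mu>\<close>. It is used with \<open>T\<close> the identity plus a displacement for a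
  transported density, and with \<open>T\<close> the identity for \<open>k = f\<close>.\<close>

lemma dW2_eq_L2sq:
  assumes g: "W2_density g"
    and T: "T \<in> borel_measurable borel" "\<And>s. 0 < s \<Longrightarrow> s < 1 \<Longrightarrow> quantile_of k s = T (quantile_of f s)"
  shows "dW2 k g = L2sq f (\<lambda>u. transport_map g u - T u)"
proof -
  have [measurable]: "transport_map g \<in> borel_measurable borel" "T \<in> borel_measurable borel"
    by (rule transport_map_measurable[OF g], rule T(1))
  have "dW2 k g = (\<integral>\<^sup>+ s\<in>{0<..<1}. ennreal ((quantile_of g s - T (quantile_of f s))\<^sup>2) \<partial>lborel)"
    unfolding dW2_def by (intro nn_integral_cong) (auto simp: T(2) split: split_indicator)
  also have "\<dots> = (\<integral>\<^sup>+ u. ennreal ((transport_map g u - T u)\<^sup>2) \<partial>\<mu>)"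
    by (rule nn_integral_transport_map[OF g, where k = "\<lambda>x u. ennreal ((x - T u)\<^sup>2)"]) measurable
  also have "\<dots> = L2sq f (\<lambda>u. transport_map g u - T u)"
    by (subst L2sq_eq_nn_integral) auto
  finally show ?thesis .
qed

lemma dW2_commute: "dW2 k g = dW2 g k"
  by (simp add: dW2_def power2_commute)

lemma dW2_self: "dW2 g g = 0"
  by (simp add: dW2_def)

end

section \<open>Transported densities\<close>

lemma has_derivative_add_id_pos:
  fixes V :: "real \<Rightarrow> real"
  assumes "\<exists>d. (V has_real_derivative d) (at u within D) \<and> d > -1"
  shows "\<exists>d>0. ((\<lambda>u. V u + u) has_real_derivative d) (at u within D)"
proof -
  obtain d where "(V has_real_derivative d) (at u within D)" "d > -1" using assms by blast
  then have "((\<lambda>u. V u + u) has_real_derivative d + 1) (at u within D)" "d + 1 > 0"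
    by (auto intro!: derivative_eq_intros)
  then show ?thesis by blast
qed

text \<open>At an endpoint of the interval the derivative is only one-sided, so its sign is used in
  the open interval between \<open>u\<close> and \<open>v\<close>, with mere continuity at the
  ends.\<close>

lemma strict_mono_on_if_deriv_pos_within:
  fixes T :: "real \<Rightarrow> real"
  assumes D: "is_interval D"
    and T: "\<And>u. u \<in> D \<Longrightarrow> \<exists>d>0. (T has_real_derivative d) (at u within D)"
  shows "strict_mono_on D T"
proof (rule strict_mono_onI)
  fix u v assume uv: "u \<in> D" "v \<in> D" "u < v"
  have sub: "{u..v} \<subseteq> D"
    using D uv unfolding is_interval_1 by (meson atLeastAtMost_iff subsetI)
  show "T u < T v"
  proof (rule DERIV_pos_imp_increasing_open[OF uv(3)])
    fix x assume x: "u < x" "x < v"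
    then have "x \<in> D" using sub by auto
    then obtain d where d: "d > 0" "(T has_real_derivative d) (at x within D)" using T by blast
    have "x \<in> interior D"
      using x sub by (intro interiorI[of "{u<..<v}"]) auto
    then have "(T has_real_derivative d) (at x)" using d(2) at_within_interior by metis
    with d(1) show "\<exists>y. (T has_real_derivative y) (at x) \<and> 0 < y" by blast
  next
    have "continuous_on D T"
      using T by (meson DERIV_continuous continuous_on_eq_continuous_within)
    then show "continuous_on {u..v} T" using sub by (rule continuous_on_subset)
  qed
qed

text \<open>The source of absolute continuity of the transported measure. The inverse satisfies a
  difference bound centred at each image point \<open>y = T x\<close>, with constant
  \<open>2 / d\<close> for \<open>d\<close> the derivative at \<open>x\<close>; such pointwise
  bounds suffice for it to map null sets to null sets.\<close>

lemma negligible_vimage_if_deriv_pos_within: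
  fixes T :: "real \<Rightarrow> real"
  assumes D: "is_interval D"
    and T: "\<And>u. u \<in> D \<Longrightarrow> \<exists>d>0. (T has_real_derivative d) (at u within D)"
    and N: "negligible N"
  shows "negligible (T -` N \<inter> D)"
proof -
  have sm: "strict_mono_on D T" by (rule strict_mono_on_if_deriv_pos_within[OF D T])
  then have inj: "inj_on T D" by (rule strict_mono_on_imp_inj_on)
  define R where "R = the_inv_into D T"
  have R: "R (T x) = x" if "x \<in> D" for x using that inj by (simp add: R_def the_inv_into_f_f)
  have "negligible (R ` (N \<inter> T ` D))"
  proof (rule negligible_locally_Lipschitz_image)
    show "negligible (N \<inter> T ` D)" using N by (rule negligible_subset) auto
    fix y assume "y \<in> N \<inter> T ` D"
    then obtain x where x: "x \<in> D" "y = T x" by auto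
    then obtain d where d: "d > 0" "(T has_real_derivative d) (at x within D)" using T by blast
    have "((\<lambda>z. (T z - T x) / (z - x)) \<longlongrightarrow> d) (at x within D)"
      using d(2) by (simp add: has_field_derivative_iff)
    then have "\<forall>\<^sub>F z in at x within D. d / 2 < (T z - T x) / (z - x)"
      using d(1) by (intro order_tendstoD(1)) auto
    then obtain r where r: "r > 0" "\<And>z. z \<in> D \<Longrightarrow> z \<noteq> x \<Longrightarrow> dist z x < r \<Longrightarrow> d / 2 < (T z - T x) / (z - x)"
      by (auto simp: eventually_at)
    \<comment> \<open>The rise of \<open>T\<close> over a step \<open>r / 2\<close> on either side
      of \<open>x\<close>: values closer than both force arguments closer than \<open>r\<close>. The
      default 1 applies when the step leaves the interval, and then no point of \<open>D\<close>
      lies at distance \<open>r\<close> or more on that side.\<close>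
    define \<eta>1 where "\<eta>1 = (if x + r / 2 \<in> D then T (x + r / 2) - T x else 1)"
    define \<eta>2 where "\<eta>2 = (if x - r / 2 \<in> D then T x - T (x - r / 2) else 1)"
    have \<eta>: "\<eta>1 > 0" "\<eta>2 > 0"
      using strict_mono_onD[OF sm, of x "x + r / 2"] strict_mono_onD[OF sm, of "x - r / 2" x] x r(1)
      by (auto simp: \<eta>1_def \<eta>2_def)
    have near: "\<bar>z - x\<bar> < r" if z: "z \<in> D" "\<bar>T z - T x\<bar> < min \<eta>1 \<eta>2" for z
    proof (rule ccontr)
      assume "\<not> \<bar>z - x\<bar> < r"
      then consider "x + r \<le> z" | "z \<le> x - r" by linarith
      then show False
      proof cases
        case 1
        then have m: "x + r / 2 \<in> D"
          using D x(1) z(1) r(1) unfolding is_interval_1 by (smt (verit) field_sum_of_halves)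
        have "T (x + r / 2) < T z" using strict_mono_onD[OF sm m z(1)] 1 r(1) by simp
        then show False using z(2) m unfolding \<eta>1_def by (simp split: if_splits) linarith
      next
        case 2
        then have m: "x - r / 2 \<in> D"
          using D x(1) z(1) r(1) unfolding is_interval_1 by (smt (verit) field_sum_of_halves)
        have "T z < T (x - r / 2)" using strict_mono_onD[OF sm z(1) m] 2 r(1) by simp
        then show False using z(2) m unfolding \<eta>2_def by (simp split: if_splits) linarith
      qed
    qed
    show "\<exists>U B. open U \<and> y \<in> U \<and> (\<forall>y'\<in>(N \<inter> T ` D) \<inter> U. norm (R y' - R y) \<le> B * norm (y' - y))"
    proof (intro exI[of _ "ball y (min \<eta>1 \<eta>2)"] exI[of _ "2 / d"] conjI ballI)
      show "y \<in> ball y (min \<eta>1 \<eta>2)" using \<eta> by simp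
      fix y' assume y': "y' \<in> (N \<inter> T ` D) \<inter> ball y (min \<eta>1 \<eta>2)"
      then obtain z where z: "z \<in> D" "y' = T z" by auto
      have zn: "\<bar>z - x\<bar> < r" using y' z x by (intro near) (auto simp: dist_real_def abs_minus_commute)
      have "d / 2 * \<bar>z - x\<bar> \<le> \<bar>T z - T x\<bar>"
      proof (cases "z = x")
        case False
        then have "d / 2 < (T z - T x) / (z - x)" using r(2)[OF z(1) False] zn by (simp add: dist_real_def)
        also have "\<dots> \<le> \<bar>T z - T x\<bar> / \<bar>z - x\<bar>" by (metis abs_divide abs_ge_self)
        finally show ?thesis using False by (simp add: field_simps)
      qed simp
      then have "\<bar>z - x\<bar> \<le> 2 / d * \<bar>T z - T x\<bar>" using d(1) by (simp add: field_simps)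
      then show "norm (R y' - R y) \<le> 2 / d * norm (y' - y)"
        using z x R by simp
    qed simp
  qed simp
  moreover have "T -` N \<inter> D \<subseteq> R ` (N \<inter> T ` D)"
  proof
    fix x assume "x \<in> T -` N \<inter> D"
    then show "x \<in> R ` (N \<inter> T ` D)" using R[of x] by (intro image_eqI[of x R "T x"]) auto
  qed
  ultimately show ?thesis by (rule negligible_subset)
qed

context w2_space
begin

text \<open>The complement of the support is covered by null balls, of which Lindelof's theorem
  selects countably many.\<close>

lemma density_support_AE: "AE u in \<mu>. u \<in> density_support f"
proof -
  define \<F> where "\<F> = {ball x e | x e. e > 0 \<and> emeasure \<mu> (ball x e) = 0}"
  have op: "\<And>S. S \<in> \<F> \<Longrightarrow> open S" by (auto simp: \<F>_def)
  obtain \<G> where \<G>: "\<G> \<subseteq> \<F>" "countable \<G>" "\<Union>\<G> = \<Union>\<F>"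
    using Lindelof[of \<F>] op by blast
  have "\<Union>\<G> \<in> null_sets \<mu>"
    using \<G> by (intro null_sets_UN'[of \<G> "\<lambda>S. S", simplified]) (auto simp: \<F>_def null_sets_def)
  moreover have "{u \<in> space \<mu>. u \<notin> density_support f} \<subseteq> \<Union>\<G>"
  proof
    fix u assume "u \<in> {u \<in> space \<mu>. u \<notin> density_support f}"
    then obtain e where "e > 0" "emeasure \<mu> (ball u e) = 0"
      by (auto simp: density_support_def not_less)
    then have "ball u e \<in> \<F>" "u \<in> ball u e" by (auto simp: \<F>_def)
    then show "u \<in> \<Union>\<G>" unfolding \<G>(3) by blast
  qed
  ultimately show ?thesis by (rule AE_I')
qed

text \<open>Radon-Nikodym: \<open>\<mu>\<close> lives on its support, where \<open>T\<close> pulls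
  Lebesgue null sets back to null sets.\<close>

lemma Exp_map_has_density:
  assumes D: "is_interval (density_support f)" and V: "V \<in> L2 f"
    and dV: "\<And>u. u \<in> density_support f \<Longrightarrow> \<exists>d. (V has_real_derivative d) (at u within density_support f) \<and> d > -1"
  obtains g where "W2_density g" "Exp_map f V = density lborel g"
proof -
  let ?D = "density_support f" and ?N = "Exp_map f V"
  define T where "T = (\<lambda>u. V u + u)"
  have [measurable]: "V \<in> borel_measurable borel" by (rule L2_measurable[OF V])
  have Tm [measurable]: "T \<in> borel_measurable borel" unfolding T_def by measurable
  have N: "?N = distr \<mu> borel T" by (simp add: Exp_map_def T_def)
  have dT: "\<exists>d>0. (T has_real_derivative d) (at u within ?D)" if u: "u \<in> ?D" for u
    unfolding T_def by (rule has_derivative_add_id_pos[OF dV[OF u]])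
  have ac: "absolutely_continuous lborel ?N"
    unfolding absolutely_continuous_def
  proof
    fix A :: "real set" assume A: "A \<in> null_sets lborel"
    then have [measurable]: "A \<in> sets borel" by (auto simp: null_sets_def)
    have "negligible A"
      using A by (simp add: negligible_iff_null_sets null_sets_completionI)
    then have "negligible (T -` A \<inter> ?D)"
      by (intro negligible_vimage_if_deriv_pos_within[OF D dT])
    then have "T -` A \<inter> ?D \<in> null_sets lebesgue" by (simp add: negligible_iff_null_sets)
    \<comment> \<open>Negligibility refers to the completed measure; a null cover in
      \<open>lborel\<close> yields a Borel set that is null for \<open>\<mu>\<close> as
      well.\<close>
    then obtain B where B: "B \<in> null_sets lborel" "T -` A \<inter> ?D \<subseteq> B"
      unfolding null_sets_completion_iff2 by blast
    have "B \<in> null_sets \<mu>"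
      using B(1) absolutely_continuousI_density[of "\<lambda>x. ennreal (f x)" lborel]
      by (auto simp: absolutely_continuous_def)
    then have "AE u in \<mu>. u \<notin> B" by (rule AE_not_in)
    with density_support_AE have "AE u in \<mu>. T u \<notin> A"
      by eventually_elim (use B(2) in auto)
    then have "AE x in ?N. x \<notin> A"
      unfolding N by (subst AE_distr_iff) auto
    then show "A \<in> null_sets ?N"
      by (subst (asm) AE_iff_null_sets[symmetric]) (auto simp: N)
  qed
  have prob: "prob_space ?N" unfolding N by (rule \<mu>.prob_space_distr) simp
  have fin: "finite_measure ?N" by (rule prob_space.finite_measure[OF prob])
  have sets: "sets ?N = sets lborel" by (simp add: N)
  obtain g where g: "g \<in> borel_measurable lborel" "AE x in lborel. RN_deriv lborel ?N x = ennreal (g x)"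
    "\<And>x. 0 \<le> g x"
    by (rule sigma_finite_measure.real_RN_deriv[OF sigma_finite_lborel fin ac sets]) blast
  have eq: "?N = density lborel g"
  proof -
    have "?N = density lborel (RN_deriv lborel ?N)"
      by (rule sigma_finite_measure.density_RN_deriv[OF sigma_finite_lborel ac sets, symmetric])
    also have "\<dots> = density lborel g"
      using g by (intro density_cong) auto
    finally show ?thesis .
  qed
  have gm [measurable]: "g \<in> borel_measurable borel" using g(1) by simp
  have "W2_density g"
    unfolding W2_density_def
  proof (intro conjI allI)
    have "(\<integral>\<^sup>+ x. ennreal (g x) \<partial>lborel) = emeasure ?N (space ?N)"
      unfolding eq by (subst emeasure_density) auto
    then show "(\<integral>\<^sup>+ x. ennreal (g x) \<partial>lborel) = 1" by (simp add: prob_space.emeasure_space_1[OF prob])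
    have "(\<integral>\<^sup>+ x. ennreal (x\<^sup>2 * g x) \<partial>lborel) = (\<integral>\<^sup>+ x. ennreal (x\<^sup>2) \<partial>?N)"
      unfolding eq by (subst nn_integral_density) (auto simp: ennreal_mult' g(3) mult.commute)
    also have "\<dots> = L2sq f (\<lambda>u. V u + u)"
      unfolding N by (subst nn_integral_distr) (auto simp: L2sq_eq_nn_integral T_def)
    also have "\<dots> < \<infinity>" using L2_add[OF V L2_id] by (simp add: L2_def)
    finally show "(\<integral>\<^sup>+ x. ennreal (x\<^sup>2 * g x) \<partial>lborel) < \<infinity>" .
  qed (use gm g(3) in auto)
  then show ?thesis using eq that by blast
qed

text \<open>Monotonicity of \<open>T\<close> is known on the support only. For \<open>v\<close>
  there, the distribution function of \<open>g\<close> at \<open>T v\<close> is that of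
  \<open>f\<close> at \<open>v\<close>. One inequality follows by taking \<open>v\<close> to be the
  quantile itself, the other by approaching it from the left inside the support.\<close>

lemma quantile_of_Exp_map:
  assumes D: "is_interval (density_support f)" and V: "V \<in> L2 f"
    and dV: "\<And>u. u \<in> density_support f \<Longrightarrow> \<exists>d. (V has_real_derivative d) (at u within density_support f) \<and> d > -1"
    and g: "W2_density g" "Exp_map f V = density lborel g" and s: "0 < s" "s < 1"
  shows "quantile_of g s = V (quantile_of f s) + quantile_of f s"
proof -
  interpret g: w2_space g using g(1) by unfold_locales
  let ?D = "density_support f" and ?q = "quantile_of f s"
  define T where "T = (\<lambda>u. V u + u)"
  have [measurable]: "V \<in> borel_measurable borel" by (rule L2_measurable[OF V])
  have Tm [measurable]: "T \<in> borel_measurable borel" unfolding T_def by measurable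
  have dT: "\<exists>d>0. (T has_real_derivative d) (at u within ?D)" if u: "u \<in> ?D" for u
    unfolding T_def by (rule has_derivative_add_id_pos[OF dV[OF u]])
  have sm: "strict_mono_on ?D T" by (rule strict_mono_on_if_deriv_pos_within[OF D dT])
  have cdf_g: "cdf_of g x = measure \<mu> (T -` {..x})" for x
    unfolding cdf_of_def g(2)[symmetric] Exp_map_def T_def[symmetric] by (subst measure_distr) auto
  have mass: "0 < measure \<mu> {a<..?q}" if "a < ?q" for a
  proof -
    have "cdf_of f a < s" using quantile_le_iff[OF s, of a] that by simp
    moreover have "cdf_of f ?q = s" by (rule cdf_quantile[OF s])
    moreover have "measure \<mu> {a<..?q} = cdf_of f ?q - cdf_of f a"
      using that by (simp add: cdf_of_eq \<mu>.cdf_diff_eq)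
    ultimately show ?thesis by simp
  qed
  \<comment> \<open>An interval of positive mass ending at the quantile cannot miss the support, and
    its right end carries no mass.\<close>
  have pt: "\<exists>u\<in>?D. a < u \<and> u < ?q" if "a < ?q" for a
  proof (rule ccontr)
    assume none: "\<not> (\<exists>u\<in>?D. a < u \<and> u < ?q)"
    have "AE u in \<mu>. u \<noteq> ?q"
      using measure_\<mu>_singleton[of ?q]
      by (intro AE_not_in[of "{?q}", simplified]) (simp add: null_sets_def \<mu>.emeasure_eq_measure)
    with density_support_AE have "AE u in \<mu>. u \<notin> {a<..?q}"
      by eventually_elim (use none in force)
    then have "{a<..?q} \<in> null_sets \<mu>" by (subst (asm) AE_iff_null_sets[symmetric]) auto
    then show False using mass[OF that] by (simp add: measure_def null_sets_def)
  qed
  have qD: "?q \<in> ?D"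
    unfolding density_support_def
  proof (intro CollectI allI impI)
    fix e :: real assume "e > 0"
    have "0 < measure \<mu> {?q - e / 2<..?q}" using \<open>e > 0\<close> by (intro mass) simp
    also have "\<dots> \<le> measure \<mu> (ball ?q e)"
      using \<open>e > 0\<close> by (intro \<mu>.finite_measure_mono) (auto simp: dist_real_def)
    finally show "0 < emeasure \<mu> (ball ?q e)" by (simp add: \<mu>.emeasure_eq_measure)
  qed
  \<comment> \<open>Off the support \<open>T\<close> may fail to be monotone, so the two sets agree
    only almost everywhere.\<close>
  have le_iff: "measure \<mu> (T -` {..T v}) = cdf_of f v" if "v \<in> ?D" for v
    unfolding cdf_of_def
  proof (rule \<mu>.finite_measure_eq_AE)
    show "AE u in \<mu>. u \<in> T -` {..T v} \<longleftrightarrow> u \<in> {..v}"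
      using density_support_AE
    proof eventually_elim
      case (elim u)
      then show ?case
        using strict_mono_onD[OF sm, of u v] strict_mono_onD[OF sm, of v u] that
        by (cases u v rule: linorder_cases) auto
    qed
    show "T -` {..T v} \<in> sets \<mu>" using measurable_sets[OF Tm, of "{..T v}"] by simp
  qed simp
  have "quantile_of g s = T ?q"
  proof (rule antisym)
    show "quantile_of g s \<le> T ?q"
      using cdf_quantile[OF s] by (simp add: g.quantile_le_iff[OF s] cdf_g le_iff[OF qD])
    show "T ?q \<le> quantile_of g s"
    proof (rule ccontr)
      assume "\<not> T ?q \<le> quantile_of g s"
      then have lt: "quantile_of g s < T ?q" by simp
      \<comment> \<open>Continuity moves the strict inequality to a support point \<open>v\<close>
        left of the quantile, where the distribution function would already reach
        \<open>s\<close>.\<close>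
      have "continuous_on ?D T"
        using dT by (meson DERIV_continuous continuous_on_eq_continuous_within)
      then have "(T \<longlongrightarrow> T ?q) (at ?q within ?D)" using qD by (simp add: continuous_on_def)
      then have "\<forall>\<^sub>F u in at ?q within ?D. quantile_of g s < T u"
        using lt by (rule order_tendstoD(1))
      then obtain r where r: "r > 0" "\<And>u. u \<in> ?D \<Longrightarrow> u \<noteq> ?q \<Longrightarrow> dist u ?q < r \<Longrightarrow> quantile_of g s < T u"
        by (auto simp: eventually_at)
      obtain v where v: "v \<in> ?D" "?q - r < v" "v < ?q" using pt[of "?q - r"] r(1) by auto
      have "quantile_of g s \<le> T v" using r(2)[OF v(1)] v by (simp add: dist_real_def)
      then have "s \<le> cdf_of f v" by (simp add: g.quantile_le_iff[OF s] cdf_g le_iff[OF v(1)])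
      then show False using quantile_le_iff[OF s, of v] v(3) by simp
    qed
  qed
  then show ?thesis by (simp add: T_def)
qed

end

section \<open>The expected squared distance and the Wasserstein mean\<close>

context war_noise
begin

text \<open>The cross term may be negative, so the square is expanded under a real integral, once
  finite moments are available, before returning to \<open>ennreal\<close>.\<close>

lemma nn_integral_L2sq_diff:
  assumes V: "limit_process V" and h: "h \<in> L2 f"
  shows "(\<integral>\<^sup>+\<omega>. L2sq f (\<lambda>u. h u - V t \<omega> u) \<partial>M) = L2sq f h + (\<integral>\<^sup>+\<omega>. L2sq f (V t \<omega>) \<partial>M)"
proof -
  note VL = limit_process_L2[OF V]
  have m: "(\<lambda>\<omega>. (L2norm (V t \<omega>))\<^sup>2) \<in> borel_measurable M"
    using measurable_compose[OF limit_process_meas[OF V] measurable_L2norm_square] .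
  have nnV: "(\<integral>\<^sup>+\<omega>. L2sq f (V t \<omega>) \<partial>M) = (\<integral>\<^sup>+\<omega>. ennreal ((L2norm (V t \<omega>))\<^sup>2) \<partial>M)"
    by (intro nn_integral_cong) (simp add: L2sq_norm VL)
  have i1: "integrable M (\<lambda>\<omega>. (L2norm (V t \<omega>))\<^sup>2)"
    using limit_process_moment[OF V, of t] m by (subst integrable_iff_bounded) (simp add: nnV)
  have i2: "integrable M (\<lambda>\<omega>. L2inner f (V t \<omega>) h)"
    by (intro integrable_L2inner limit_process_meas V h limit_process_moment)
  have eq: "(L2norm (\<lambda>u. h u - V t \<omega> u))\<^sup>2
      = (L2norm h)\<^sup>2 - 2 * L2inner f (V t \<omega>) h + (L2norm (V t \<omega>))\<^sup>2" if "\<omega> \<in> space M" for \<omega>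
    using L2norm_diff_square[OF h VL[OF that, of t]] by (simp add: L2inner_commute[of h])
  have i3: "integrable M (\<lambda>\<omega>. (L2norm h)\<^sup>2 - 2 * L2inner f (V t \<omega>) h + (L2norm (V t \<omega>))\<^sup>2)"
    using i1 i2 by simp
  have "(\<integral>\<^sup>+\<omega>. L2sq f (\<lambda>u. h u - V t \<omega> u) \<partial>M)
      = (\<integral>\<^sup>+\<omega>. ennreal ((L2norm h)\<^sup>2 - 2 * L2inner f (V t \<omega>) h + (L2norm (V t \<omega>))\<^sup>2) \<partial>M)"
    using h VL by (intro nn_integral_cong) (simp add: L2sq_norm eq)
  also have "\<dots> = ennreal (\<integral>\<omega>. (L2norm h)\<^sup>2 - 2 * L2inner f (V t \<omega>) h + (L2norm (V t \<omega>))\<^sup>2 \<partial>M)"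
    using i3 by (intro nn_integral_eq_integral) (auto intro!: AE_I2 simp flip: eq)
  also have "(\<integral>\<omega>. (L2norm h)\<^sup>2 - 2 * L2inner f (V t \<omega>) h + (L2norm (V t \<omega>))\<^sup>2 \<partial>M)
      = (L2norm h)\<^sup>2 + (\<integral>\<omega>. (L2norm (V t \<omega>))\<^sup>2 \<partial>M)"
    using i1 i2 prob_space by (simp add: limit_process_mean[OF V h])
  also have "ennreal \<dots> = L2sq f h + ennreal (\<integral>\<omega>. (L2norm (V t \<omega>))\<^sup>2 \<partial>M)"
    using h by (simp add: L2sq_norm)
  also have "ennreal (\<integral>\<omega>. (L2norm (V t \<omega>))\<^sup>2 \<partial>M) = (\<integral>\<^sup>+\<omega>. L2sq f (V t \<omega>) \<partial>M)"
    unfolding nnV using i1 by (intro nn_integral_eq_integral[symmetric]) auto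
  finally show ?thesis .
qed

lemma wasserstein_mean_limit_process:
  assumes V: "limit_process V" and D: "is_interval (density_support f)"
    and dV: "AE \<omega> in M. \<forall>u\<in>density_support f.
        \<exists>d. (V t \<omega> has_real_derivative d) (at u within density_support f) \<and> d > -1"
    and F: "AE \<omega> in M. W2_density (F \<omega>) \<and> Exp_map f (V t \<omega>) = density lborel (F \<omega>)"
  shows "is_wasserstein_mean M F f"
proof -
  let ?E = "\<integral>\<^sup>+\<omega>. L2sq f (V t \<omega>) \<partial>M"
  have key: "(\<integral>\<^sup>+\<omega>. dW2 (F \<omega>) g \<partial>M) = dW2 g f + ?E" if g: "W2_density g" for g
  proof -
    define h where "h = (\<lambda>u. transport_map g u - u)"
    have h: "h \<in> L2 f" unfolding h_def by (intro L2_diff transport_map_L2[OF g] L2_id)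
    have "AE \<omega> in M. dW2 (F \<omega>) g = L2sq f (\<lambda>u. h u - V t \<omega> u)"
      using dV F AE_space
    proof eventually_elim
      case (elim \<omega>)
      have VL: "V t \<omega> \<in> L2 f" by (rule limit_process_L2[OF V elim(3)])
      have "dW2 (F \<omega>) g = L2sq f (\<lambda>u. transport_map g u - (V t \<omega> u + u))"
      proof (rule dW2_eq_L2sq[OF g])
        show "(\<lambda>u. V t \<omega> u + u) \<in> borel_measurable borel" using L2_measurable[OF VL] by measurable
        show "quantile_of (F \<omega>) s = V t \<omega> (quantile_of f s) + quantile_of f s" if "0 < s" "s < 1" for s
          using elim(1,2) that by (intro quantile_of_Exp_map[OF D VL]) auto
      qed
      then show ?case by (simp add: h_def algebra_simps)
    qed
    \<comment> \<open>No measurability of \<open>F\<close> is assumed; the almost sure identity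
      replaces the integrand by a measurable one.\<close>
    then have "(\<integral>\<^sup>+\<omega>. dW2 (F \<omega>) g \<partial>M) = (\<integral>\<^sup>+\<omega>. L2sq f (\<lambda>u. h u - V t \<omega> u) \<partial>M)"
      by (rule nn_integral_cong_AE)
    also have "\<dots> = L2sq f h + ?E" by (rule nn_integral_L2sq_diff[OF V h])
    also have "L2sq f h = dW2 f g"
      unfolding h_def by (rule dW2_eq_L2sq[OF g, symmetric]) simp_all
    finally show ?thesis by (simp add: dW2_commute[of f])
  qed
  have keyf: "(\<integral>\<^sup>+\<omega>. dW2 (F \<omega>) f \<partial>M) = ?E" using key[OF W2] by (simp add: dW2_self)
  have fin: "?E \<noteq> \<top>" using limit_process_moment[OF V, of t] by (simp add: less_top)
  show ?thesis
    unfolding is_wasserstein_mean_def keyf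
  proof (intro conjI allI impI)
    fix g assume g: "W2_density g"
    show "?E \<le> (\<integral>\<^sup>+\<omega>. dW2 (F \<omega>) g \<partial>M)" by (simp add: key[OF g])
    assume "(\<integral>\<^sup>+\<omega>. dW2 (F \<omega>) g \<partial>M) = ?E"
    then have "?E + dW2 g f = ?E + 0" by (simp add: key[OF g] add.commute)
    \<comment> \<open>Cancelling \<open>?E\<close> in \<open>ennreal\<close> requires its
      finiteness.\<close>
    then show "dW2 g f = 0" using fin by (subst (asm) ennreal_add_left_cancel) auto
  qed (rule W2)
qed

end

text \<open>Joint measurability permits Fubini, which converts the covariance trace into a second
  moment of the norm and the pointwise means into means of inner products.\<close>

lemma noise_moment_and_mean:
  fixes M :: "'a measure" and \<epsilon> :: "int \<Rightarrow> 'a \<Rightarrow> real \<Rightarrow> real"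
  assumes M: "prob_space M" and f: "W2_density f"
    and elem: "\<And>t. \<epsilon> t \<in> measurable M (L2M f)"
    and joint: "\<And>t. (\<lambda>(\<omega>, u). \<epsilon> t \<omega> u) \<in> borel_measurable (M \<Otimes>\<^sub>M lborel)"
    and mean: "\<And>t u. u \<in> density_support f \<Longrightarrow> (\<integral>\<omega>. \<epsilon> t \<omega> u \<partial>M) = 0"
    and cov: "\<And>t. (\<integral>\<^sup>+ u. (\<integral>\<^sup>+ \<omega>. ennreal ((\<epsilon> t \<omega> u - (\<integral> \<omega>'. \<epsilon> t \<omega>' u \<partial>M))\<^sup>2) \<partial>M)
                          * ennreal (f u) \<partial>lborel) < \<infinity>"
  shows "(\<integral>\<^sup>+\<omega>. L2sq f (\<epsilon> t \<omega>) \<partial>M) < \<infinity>"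
    and "h \<in> L2 f \<Longrightarrow> (\<integral>\<omega>. L2inner f (\<epsilon> t \<omega>) h \<partial>M) = 0"
proof -
  interpret prob_space M by fact
  interpret w2_space f using f by unfold_locales
  interpret P: pair_sigma_finite M lborel
    by (intro pair_sigma_finite.intro sigma_finite_lborel prob_space_imp_sigma_finite M)
  interpret Q: pair_sigma_finite M \<mu>
    by (intro pair_sigma_finite.intro prob_space_imp_sigma_finite M prob_space_\<mu>)
  have jm [measurable]: "(\<lambda>x. \<epsilon> t (fst x) (snd x)) \<in> borel_measurable (M \<Otimes>\<^sub>M lborel)"
    using joint[of t] by (simp add: split_beta')
  have sets: "sets (M \<Otimes>\<^sub>M \<mu>) = sets (M \<Otimes>\<^sub>M lborel)" by (intro sets_pair_measure_cong) auto
  have jq [measurable]: "(\<lambda>x. \<epsilon> t (fst x) (snd x)) \<in> borel_measurable (M \<Otimes>\<^sub>M \<mu>)"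
    using jm unfolding measurable_cong_sets[OF sets refl] .
  have ae: "AE u in lborel. 0 < f u \<longrightarrow> u \<in> density_support f"
    using density_support_AE by (subst (asm) AE_density) auto
  have L: "\<epsilon> t \<omega> \<in> L2 f" if "\<omega> \<in> space M" for \<omega> by (rule measurable_L2M_L2[OF elem that])
  have "(\<integral>\<^sup>+\<omega>. L2sq f (\<epsilon> t \<omega>) \<partial>M) = (\<integral>\<^sup>+\<omega>. \<integral>\<^sup>+u. ennreal ((\<epsilon> t \<omega> u)\<^sup>2 * f u) \<partial>lborel \<partial>M)"
    by (simp add: L2sq_def)
  also have "\<dots> = (\<integral>\<^sup>+u. \<integral>\<^sup>+\<omega>. ennreal ((\<epsilon> t \<omega> u)\<^sup>2 * f u) \<partial>M \<partial>lborel)"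
    by (rule P.Fubini'[symmetric]) (simp add: split_beta')
  \<comment> \<open>Almost every \<open>u\<close> with \<open>f u > 0\<close> lies in the support,
    where the mean subtracted in the covariance is 0; elsewhere the weight \<open>f u\<close>
    removes both integrands.\<close>
  also have "\<dots> = (\<integral>\<^sup>+ u. (\<integral>\<^sup>+ \<omega>. ennreal ((\<epsilon> t \<omega> u - (\<integral> \<omega>'. \<epsilon> t \<omega>' u \<partial>M))\<^sup>2) \<partial>M) * ennreal (f u) \<partial>lborel)"
  proof (rule nn_integral_cong_AE, use ae in eventually_elim)
    case (elim u)
    show ?case
    proof (cases "0 < f u")
      case True
      have "(\<lambda>\<omega>. \<epsilon> t \<omega> u) \<in> borel_measurable M"
        using measurable_compose[OF measurable_Pair2'[of u lborel M] jm] by simp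
      then show ?thesis
        using elim True by (simp add: mean ennreal_mult nn_integral_multc)
    next
      case False
      then have "f u = 0" using f_nonneg[of u] by linarith
      then show ?thesis by simp
    qed
  qed
  finally show mom: "(\<integral>\<^sup>+\<omega>. L2sq f (\<epsilon> t \<omega>) \<partial>M) < \<infinity>" using cov[of t] by simp
  assume h: "h \<in> L2 f"
  have [measurable]: "h \<in> borel_measurable borel" by (rule L2_measurable[OF h])
  let ?k = "\<lambda>x. \<epsilon> t (fst x) (snd x) * h (snd x)"
  have int: "integrable (M \<Otimes>\<^sub>M \<mu>) (\<lambda>(\<omega>, u). \<epsilon> t \<omega> u * h u)"
  proof -
    have "integrable (M \<Otimes>\<^sub>M \<mu>) (\<lambda>x. (\<epsilon> t (fst x) (snd x))\<^sup>2)"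
    proof (subst integrable_iff_bounded, intro conjI)
      have "(\<integral>\<^sup>+x. ennreal ((\<epsilon> t (fst x) (snd x))\<^sup>2) \<partial>(M \<Otimes>\<^sub>M \<mu>)) = (\<integral>\<^sup>+\<omega>. \<integral>\<^sup>+u. ennreal ((\<epsilon> t \<omega> u)\<^sup>2) \<partial>\<mu> \<partial>M)"
        by (subst \<mu>.nn_integral_fst[symmetric]) simp_all
      also have "\<dots> = (\<integral>\<^sup>+\<omega>. L2sq f (\<epsilon> t \<omega>) \<partial>M)"
        by (intro nn_integral_cong) (simp add: L2sq_eq_nn_integral L2_measurable[OF L])
      finally show "(\<integral>\<^sup>+x. ennreal (norm ((\<epsilon> t (fst x) (snd x))\<^sup>2)) \<partial>(M \<Otimes>\<^sub>M \<mu>)) < \<infinity>" using mom by simp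
    qed simp
    moreover have "integrable (M \<Otimes>\<^sub>M \<mu>) (\<lambda>x. (h (snd x))\<^sup>2)"
    proof (subst integrable_iff_bounded, intro conjI)
      have "(\<integral>\<^sup>+x. ennreal ((h (snd x))\<^sup>2) \<partial>(M \<Otimes>\<^sub>M \<mu>)) = (\<integral>\<^sup>+\<omega>. L2sq f h \<partial>M)"
        by (subst \<mu>.nn_integral_fst[symmetric]) (simp_all add: L2sq_eq_nn_integral)
      also have "\<dots> < \<infinity>" using h by (simp add: emeasure_space_1 L2_def)
      finally show "(\<integral>\<^sup>+x. ennreal (norm ((h (snd x))\<^sup>2)) \<partial>(M \<Otimes>\<^sub>M \<mu>)) < \<infinity>" by simp
    qed simp
    ultimately have "integrable (M \<Otimes>\<^sub>M \<mu>) (\<lambda>x. (\<epsilon> t (fst x) (snd x))\<^sup>2 + (h (snd x))\<^sup>2)" by (rule Bochner_Integration.integrable_add)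
    then have "integrable (M \<Otimes>\<^sub>M \<mu>) ?k"
    proof (rule Bochner_Integration.integrable_bound)
      show "AE x in M \<Otimes>\<^sub>M \<mu>. norm (?k x) \<le> norm ((\<epsilon> t (fst x) (snd x))\<^sup>2 + (h (snd x))\<^sup>2)"
        using abs_mult_le_sum_squares by (intro AE_I2) simp
    qed simp
    then show ?thesis by (simp add: split_beta')
  qed
  have "(\<integral>\<omega>. L2inner f (\<epsilon> t \<omega>) h \<partial>M) = (\<integral>\<omega>. \<integral>u. \<epsilon> t \<omega> u * h u \<partial>\<mu> \<partial>M)"
    by (intro Bochner_Integration.integral_cong) (simp_all add: L2inner_eq L2_measurable[OF L])
  also have "\<dots> = (\<integral>u. \<integral>\<omega>. \<epsilon> t \<omega> u * h u \<partial>M \<partial>\<mu>)"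
    by (rule Q.Fubini_integral[OF int, symmetric])
  also have "\<dots> = (\<integral>u. 0 \<partial>\<mu>)"
  proof (rule integral_cong_AE)
    show "AE u in \<mu>. (\<integral>\<omega>. \<epsilon> t \<omega> u * h u \<partial>M) = 0"
      using density_support_AE by eventually_elim (simp add: mean)
    show "(\<lambda>u. \<integral>\<omega>. \<epsilon> t \<omega> u * h u \<partial>M) \<in> borel_measurable \<mu>"
      using Q.integrable_snd[OF int] by (auto dest: borel_measurable_integrable)
  qed simp
  finally show "(\<integral>\<omega>. L2inner f (\<epsilon> t \<omega>) h \<partial>M) = 0" by simp
qed

text \<open>\<open>V\<close> ranges over all versions of the limit of the series, and the first
  conjunct ensures that one exists. Equality in the tangent space is a vanishing
  \<open>L2sq\<close>. Stationarity of the densities is stated for the measures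
  \<open>Exp_map f (V t \<omega>)\<close>, since a density is determined only up to null
  sets.\<close>

theorem theorem3:
  fixes M :: "'a measure" and f :: "real \<Rightarrow> real" and D :: "real set"
    and p :: nat and \<beta> :: "nat \<Rightarrow> real" and \<psi> :: "nat \<Rightarrow> real"
    and \<epsilon> :: "int \<Rightarrow> 'a \<Rightarrow> real \<Rightarrow> real"
  assumes M: "prob_space M"
    and f: "W2_density f"
    and D: "D = density_support f" "is_interval D"
    and A1: "\<forall>z::complex. cmod z \<le> 1 \<longrightarrow> ar_poly p \<beta> z \<noteq> 0"
    and psi: "\<forall>z::complex. cmod z \<le> 1 \<longrightarrow> (\<lambda>i. complex_of_real (\<psi> i) * z ^ i) sums (1 / ar_poly p \<beta> z)"
    and A2_elem: "\<forall>t. random_tangent M f (\<epsilon> t)"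
    and A2_joint: "\<forall>t. (\<lambda>(\<omega>, u). \<epsilon> t \<omega> u) \<in> borel_measurable (M \<Otimes>\<^sub>M lborel)"
    and A2_indep: "prob_space.indep_vars M (\<lambda>_. L2M f) \<epsilon> UNIV"
    and A2_ident: "\<forall>t. distr M (L2M f) (\<epsilon> t) = distr M (L2M f) (\<epsilon> 0)"
    and A2_mean: "\<forall>t. \<forall>u\<in>D. integrable M (\<lambda>\<omega>. \<epsilon> t \<omega> u) \<and> (\<integral> \<omega>. \<epsilon> t \<omega> u \<partial>M) = 0"
    and A2_cov: "\<forall>t. (\<integral>\<^sup>+ u. (\<integral>\<^sup>+ \<omega>. ennreal ((\<epsilon> t \<omega> u - (\<integral> \<omega>'. \<epsilon> t \<omega>' u \<partial>M))\<^sup>2) \<partial>M)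
                          * ennreal (f u) \<partial>lborel) < \<infinity>"
  shows
    "(\<exists>V. (\<forall>t. random_tangent M f (V t)) \<and>
          (\<forall>t. AE \<omega> in M. (\<lambda>n. L2sq f (\<lambda>u. V t \<omega> u - lin_partial \<psi> \<epsilon> t n \<omega> u)) \<longlonglongrightarrow> 0))
   \<and> (\<forall>V. (\<forall>t. random_tangent M f (V t)) \<and>
          (\<forall>t. AE \<omega> in M. (\<lambda>n. L2sq f (\<lambda>u. V t \<omega> u - lin_partial \<psi> \<epsilon> t n \<omega> u)) \<longlonglongrightarrow> 0)
        \<longrightarrow> WAR_solution M f p \<beta> \<epsilon> V
          \<and> strictly_stationary M (L2M f) V
          \<and> (\<forall>t. (\<lambda>n. \<integral>\<^sup>+ \<omega>. L2sq f (\<lambda>u. V t \<omega> u - lin_partial \<psi> \<epsilon> t n \<omega> u) \<partial>M) \<longlonglongrightarrow> 0)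
          \<and> ((\<forall>t. AE \<omega> in M. \<forall>u\<in>D. \<exists>d. (V t \<omega> has_real_derivative d) (at u within D) \<and> d > -1)
             \<longrightarrow> (\<forall>t. AE \<omega> in M. strict_mono_on D (\<lambda>u. V t \<omega> u + u))
               \<and> (\<exists>F. (\<forall>t. AE \<omega> in M. W2_density (F t \<omega>)
                             \<and> Exp_map f (V t \<omega>) = density lborel (F t \<omega>))
                     \<and> strictly_stationary M (subprob_algebra borel) (\<lambda>t \<omega>. Exp_map f (V t \<omega>))
                     \<and> (\<forall>t. is_wasserstein_mean M (F t) f))))
   \<and> (\<forall>W V. WAR_solution M f p \<beta> \<epsilon> W \<and> hilbert_stationary M f W
          \<and> (\<forall>t. random_tangent M f (V t))
          \<and> (\<forall>t. AE \<omega> in M. (\<lambda>n. L2sq f (\<lambda>u. V t \<omega> u - lin_partial \<psi> \<epsilon> t n \<omega> u)) \<longlonglongrightarrow> 0)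
        \<longrightarrow> (\<forall>t. AE \<omega> in M. L2sq f (\<lambda>u. W t \<omega> u - V t \<omega> u) = 0))"
proof -
  interpret w2_space f using f by unfold_locales
  \<comment> \<open>As the tangent space is all of \<open>L2 f\<close>, membership in it is part of
    measurability into \<open>L2M f\<close>.\<close>
  have rt: "random_tangent M f X \<longleftrightarrow> X \<in> measurable M (L2M f)" for X
    unfolding random_tangent_def tangent_space_eq_L2 using measurable_L2M_L2[of X M] by auto
  have eps_meas: "\<epsilon> t \<in> measurable M (L2M f)" for t
    using A2_elem rt by blast
  have mean: "(\<integral>\<omega>. \<epsilon> t \<omega> u \<partial>M) = 0" if "u \<in> density_support f" for t u
    using A2_mean that D(1) by blast
  note noise = noise_moment_and_mean[OF M f eps_meas A2_joint[rule_format] mean A2_cov[rule_format]]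
  interpret N: war_noise f M \<epsilon> \<psi>
  proof (intro war_noise.intro war_noise_axioms.intro)
    show "w2_space f" by (rule w2_space_axioms)
    show "prob_space M" by (rule M)
    show "distr M (L2M f) (\<epsilon> t) = distr M (L2M f) (\<epsilon> 0)" for t using A2_ident by blast
    show "summable (\<lambda>i. \<bar>\<psi> i\<bar>)" by (rule summable_abs_psi[OF A1 psi])
  qed (use eps_meas A2_indep noise in auto)
  note rec = psi_recursion[OF A1 psi]
  have lp: "(\<forall>t. random_tangent M f (V t)) \<and>
      (\<forall>t. AE \<omega> in M. (\<lambda>n. L2sq f (\<lambda>u. V t \<omega> u - lin_partial \<psi> \<epsilon> t n \<omega> u)) \<longlonglongrightarrow> 0)
    \<longleftrightarrow> N.limit_process V" for V
    by (simp add: N.limit_process_def rt)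
  have solves: "WAR_solution M f p \<beta> \<epsilon> V" if V: "N.limit_process V" for V
    unfolding WAR_solution_def
  proof (intro conjI allI)
    fix t
    show "random_tangent M f (V t)" using N.limit_process_meas[OF V] by (simp add: rt)
    show "AE \<omega> in M. L2sq f (\<lambda>u. V t \<omega> u - (\<Sum>j=1..p. \<beta> j * V (t - int j) \<omega> u) - \<epsilon> t \<omega> u) = 0"
      using N.limit_process_solves[OF rec V, of t] AE_space
    proof eventually_elim
      case (elim \<omega>)
      then show ?case
        by (subst L2sq_eq_zero_iff) (auto intro!: L2_diff L2_sum L2_cmult N.limit_process_L2[OF V])
    qed
  qed
  have unique: "AE \<omega> in M. L2sq f (\<lambda>u. W t \<omega> u - V t \<omega> u) = 0"
    if W: "WAR_solution M f p \<beta> \<epsilon> W" "hilbert_stationary M f W" and V: "N.limit_process V" for W V t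
  proof -
    have Wm: "W t \<in> measurable M (L2M f)" for t using W(1) by (simp add: WAR_solution_def rt)
    have "AE \<omega> in M. L2norm (\<lambda>u. W t \<omega> u - V t \<omega> u) = 0"
      using W by (intro N.stationary_solution_unique[OF rec Wm _ _ V]) (auto simp: WAR_solution_def)
    with AE_space show ?thesis
    proof eventually_elim
      case (elim \<omega>)
      then show ?case
        using measurable_L2M_L2[OF Wm elim(1), of t] N.limit_process_L2[OF V elim(1), of t]
        by (simp add: L2sq_eq_zero_iff)
    qed
  qed
  have third: "(\<forall>t. AE \<omega> in M. strict_mono_on D (\<lambda>u. V t \<omega> u + u))
     \<and> (\<exists>F. (\<forall>t. AE \<omega> in M. W2_density (F t \<omega>) \<and> Exp_map f (V t \<omega>) = density lborel (F t \<omega>))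
          \<and> strictly_stationary M (subprob_algebra borel) (\<lambda>t \<omega>. Exp_map f (V t \<omega>))
          \<and> (\<forall>t. is_wasserstein_mean M (F t) f))"
    if V: "N.limit_process V"
      and dV: "\<forall>t. AE \<omega> in M. \<forall>u\<in>D. \<exists>d. (V t \<omega> has_real_derivative d) (at u within D) \<and> d > -1" for V
  proof (intro conjI allI)
    fix t
    show "AE \<omega> in M. strict_mono_on D (\<lambda>u. V t \<omega> u + u)"
      using dV[rule_format, of t]
    proof eventually_elim
      case (elim \<omega>)
      then show ?case
        by (intro strict_mono_on_if_deriv_pos_within D(2) has_derivative_add_id_pos) blast
    qed
  next
    \<comment> \<open>A density exists almost surely, so it is chosen outcome by outcome; the choice
      affects neither the measures nor the distances to other densities.\<close>
    define F where "F = (\<lambda>t \<omega>. SOME g. W2_density g \<and> Exp_map f (V t \<omega>) = density lborel g)"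
    have F: "AE \<omega> in M. W2_density (F t \<omega>) \<and> Exp_map f (V t \<omega>) = density lborel (F t \<omega>)" for t
      using dV[rule_format, of t] AE_space
    proof eventually_elim
      case (elim \<omega>)
      obtain g where "W2_density g" "Exp_map f (V t \<omega>) = density lborel g"
        using Exp_map_has_density[of "V t \<omega>"] D elim(1) N.limit_process_L2[OF V elim(2)] by blast
      then have "\<exists>g. W2_density g \<and> Exp_map f (V t \<omega>) = density lborel g" by blast
      then show ?case unfolding F_def by (rule someI_ex)
    qed
    moreover have "strictly_stationary M (subprob_algebra borel) (\<lambda>t \<omega>. Exp_map f (V t \<omega>))"
      by (rule strictly_stationary_compose[OF N.limit_process_strictly_stationary[OF V]
            N.limit_process_meas[OF V] measurable_Exp_map])
    moreover have "is_wasserstein_mean M (F t) f" for t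
      using dV D F by (intro N.wasserstein_mean_limit_process[OF V]) auto
    ultimately show "\<exists>F. (\<forall>t. AE \<omega> in M. W2_density (F t \<omega>) \<and> Exp_map f (V t \<omega>) = density lborel (F t \<omega>))
        \<and> strictly_stationary M (subprob_algebra borel) (\<lambda>t \<omega>. Exp_map f (V t \<omega>))
        \<and> (\<forall>t. is_wasserstein_mean M (F t) f)"
      by blast
  qed
  show ?thesis
  proof (intro conjI allI impI)
    show "\<exists>V. (\<forall>t. random_tangent M f (V t)) \<and>
        (\<forall>t. AE \<omega> in M. (\<lambda>n. L2sq f (\<lambda>u. V t \<omega> u - lin_partial \<psi> \<epsilon> t n \<omega> u)) \<longlonglongrightarrow> 0)"
      unfolding lp using N.limit_process_series by blast
  next
    fix V t
    assume "(\<forall>t. random_tangent M f (V t)) \<and>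
        (\<forall>t. AE \<omega> in M. (\<lambda>n. L2sq f (\<lambda>u. V t \<omega> u - lin_partial \<psi> \<epsilon> t n \<omega> u)) \<longlonglongrightarrow> 0)"
    then have V: "N.limit_process V" by (simp only: lp)
    show "WAR_solution M f p \<beta> \<epsilon> V" by (rule solves[OF V])
    show "strictly_stationary M (L2M f) V" by (rule N.limit_process_strictly_stationary[OF V])
    show "(\<lambda>n. \<integral>\<^sup>+ \<omega>. L2sq f (\<lambda>u. V t \<omega> u - lin_partial \<psi> \<epsilon> t n \<omega> u) \<partial>M) \<longlonglongrightarrow> 0"
      by (rule N.limit_process_mean_square[OF V])
    assume dV: "\<forall>t. AE \<omega> in M. \<forall>u\<in>D. \<exists>d. (V t \<omega> has_real_derivative d) (at u within D) \<and> d > -1"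
    show "AE \<omega> in M. strict_mono_on D (\<lambda>u. V t \<omega> u + u)" using third[OF V dV] by blast
    show "\<exists>F. (\<forall>t. AE \<omega> in M. W2_density (F t \<omega>) \<and> Exp_map f (V t \<omega>) = density lborel (F t \<omega>))
        \<and> strictly_stationary M (subprob_algebra borel) (\<lambda>t \<omega>. Exp_map f (V t \<omega>))
        \<and> (\<forall>t. is_wasserstein_mean M (F t) f)"
      using third[OF V dV] by blast
  next
    fix W V t
    assume "WAR_solution M f p \<beta> \<epsilon> W \<and> hilbert_stationary M f W
          \<and> (\<forall>t. random_tangent M f (V t))
          \<and> (\<forall>t. AE \<omega> in M. (\<lambda>n. L2sq f (\<lambda>u. V t \<omega> u - lin_partial \<psi> \<epsilon> t n \<omega> u)) \<longlonglongrightarrow> 0)"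
    then show "AE \<omega> in M. L2sq f (\<lambda>u. W t \<omega> u - V t \<omega> u) = 0"
      using unique lp by blast
  qed
qed

end
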